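(* Let $g$ be a Riemannian metric on $Q$, $L(v)=\frac12g(v,v)$, $\mathcal{D}$ a distribution on $Q$, let $\exp^{nh}_q$ be the nonholonomic exponential map of the purely kinetic nonholonomic system $(L,\mathcal{D})$, and let $\hat g$ be a Riemannian metric on $Q$ which is a $\mathcal{D}$-preserving modification of $g$. If, for all $q\in Q$ and all $v_q\in\mathcal{D}_q$, they satisfy both $$\hat g_{\exp^{nh}_q(v_q)}\left(T_{v_q}(\exp^{nh}_q)(v_q),T_{v_q}(\exp^{nh}_q)(u_q)\right)=\hat g_q(v_q,u_q),\qquad\forall u_q\in\mathcal{D}_q,$$ and (for all $t$ such that both sides are defined) $$\hat g_{\exp^{nh}_q(tv_q)}\left(T_{tv_q}(\exp^{nh}_q)(tv_q),W(t)\right)+t\,\big(h(t)\big)\big(W(t)\big)=\hat g_q(tv_q,w_q),\qquad\forall w_q\in\mathcal{D}^g_q,$$ then $\hat g$ is a geodesic extension of $(L,\mathcal{D})$. Here $W(t)$ is the parallel transport of $w_q$ along the nonholonomic trajectory $c_{v_q}(t)=\exp^{nh}_q(tv_q)$ with respect to the linear connection $\overline\nabla$, and $h(t)$ is the 1-form along $c_{v_q}(t)$ determined by $\overline\nabla_{\dot c_{v_q}(t)}h(t)=\lambda(t)$, $h(0)=0$.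
   Context: All objects are smooth and repeated indices are summed. $Q$ is an $n$-dimensional manifold, $\tau:TQ\to Q$ its tangent bundle, $\mathcal{D}$ has rank $m$, $\mathcal{D}^g$ is the $g$-orthogonal complement of $\mathcal{D}$, and $P:TQ\to\mathcal{D}$, $Q:TQ\to\mathcal{D}^g$ are the corresponding orthogonal projections (the letter $Q$ denotes both the manifold and this projection). A globally defined frame $\{X_\alpha\}=\{X_a,X_i\}$ on $Q$ is fixed, with $\{X_a\}$ spanning $\mathcal{D}$ and $\{X_i\}$ spanning $\mathcal{D}^g$; $\{X^a,X^i\}$ is the dual frame of 1-forms. Quasi-velocities $v^\alpha=(v^a,v^i)$ are the functions on $TQ$ with $v_q=v^\alpha X_\alpha(q)$; $\mathcal{C}=\{v^i=0\}$ is $\mathcal{D}$ viewed as a submanifold of $TQ$. $X^C$, $X^V$ are the complete and vertical lifts to $TQ$ of a vector field $X$ on $Q$. $\hat g$ is a $\mathcal{D}$-preserving modification of $g$ if $\hat g|_{\mathcal{D}\times\mathcal{D}}=g|_{\mathcal{D}\times\mathcal{D}}$. The nonholonomic vector field $\Gamma_{(L,\mathcal{D})}$ is the unique vector field on $\mathcal{C}$ of the form $v^aX_a^C+f^aX_a^V$ satisfying $\Gamma_{(L,\mathcal{D})}(X^V(L))-X^C(L)=0$ on $\mathcal{C}$ for all $X\in\mathrm{Sec}(\mathcal{D})$. Its base integral curves are the nonholonomic trajectories; $c_{v_q}$ is the one with $\dot c_{v_q}(0)=v_q$. With $\phi^{nh}_t$ the flow of $\Gamma_{(L,\mathcal{D})}$,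 the nonholonomic exponential map is $\exp^{nh}_q(v_q)=\tau(\phi^{nh}_1(v_q))$, defined for $v_q$ in an open starshaped neighbourhood of $0_q$ in $\mathcal{D}_q$; it satisfies $\exp^{nh}_q(tv_q)=c_{v_q}(t)$. The conditions involving $\exp^{nh}_q$ are understood for arguments in its domain; $T_{v_q}(\mathcal{D}_q)$ is identified with $\mathcal{D}_q$. The multipliers are the functions $\lambda_i=\Gamma_{(L,\mathcal{D})}(X_i^V(L))-X_i^C(L)$ on $\mathcal{C}$, and $\lambda(t)=\lambda_i(\dot c_{v_q}(t))\,X^i(c_{v_q}(t))$. With $\nabla^g$ the Levi-Civita connection of $g$, the linear connection $\overline\nabla$ on $Q$ is, for $X,Y\in\mathcal{X}(Q)$, $$\overline\nabla_XY=P\big(\nabla^g_{P(X)}P(Y)\big)+P\big([Q(X),P(Y)]\big)+Q\big(\nabla^g_{Q(X)}Q(Y)\big)+Q\big([P(X),Q(Y)]\big).$$ For a 1-form $h(t)$ along $c_{v_q}$, $(\overline\nabla_{\dot c_{v_q}}h)(X)=\frac{d}{dt}(h(X))-h(\overline\nabla_{\dot c_{v_q}}X)$ for vector fields $X(t)$ along $c_{v_q}$. A geodesic extension of $(L,\mathcal{D})$ is a Riemannian metric $\hat g$ on $Q$ whose geodesic spray $\Gamma_{\hat g}$ satisfies $\Gamma_{\hat g}|_{\mathcal{C}}=\Gamma_{(L,\mathcal{D})}$ (equivalently, every nonholonomic trajectory is a geodesic of $\hat g$). *)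

theory Defs
  imports "HOL-Analysis.Analysis" "HOL-Library.Function_Algebras"
begin

section \<open>Pointwise vector space structure on functions\<close>

instantiation "fun" :: (type, real_vector) real_vector
begin

definition scaleR_fun_def: "r *\<^sub>R f = (\<lambda>x. r *\<^sub>R f x)"

instance
  by standard (auto simp: scaleR_fun_def plus_fun_def scaleR_add_right scaleR_add_left)

end


section \<open>Smooth maps between normed spaces\<close>

text \<open>Both notions are meant for open sets only.\<close>

primrec Ck_on :: "nat \<Rightarrow> 'a::real_normed_vector set \<Rightarrow> ('a \<Rightarrow> 'b::real_normed_vector) \<Rightarrow> bool" where
  "Ck_on 0 S f = continuous_on S f"
| "Ck_on (Suc k) S f =
     (f differentiable_on S \<and> (\<forall>v. Ck_on k S (\<lambda>x. frechet_derivative f (at x) v)))"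

definition smooth_on :: "'a::real_normed_vector set \<Rightarrow> ('a \<Rightarrow> 'b::real_normed_vector) \<Rightarrow> bool" where
  "smooth_on S f \<longleftrightarrow> (\<forall>k. Ck_on k S f)"


section \<open>Manifolds\<close>

text \<open>
  An atlas is an indexed family of charts; the underlying point set is the union of the chart
  domains, and its topology is the one induced by the charts. The indexing matters below: an atlas
  and the atlas it induces on the tangent bundle have the same index type.
\<close>

record ('i, 'q, 'e) atlas =
  cdom :: "'i \<Rightarrow> 'q set"
  cmap :: "'i \<Rightarrow> 'q \<Rightarrow> 'e"

definition points :: "('i, 'q, 'e) atlas \<Rightarrow> 'q set" where
  "points M = (\<Union>i. cdom M i)"

definition cinv :: "('i, 'q, 'e) atlas \<Rightarrow> 'i \<Rightarrow> 'e \<Rightarrow> 'q" where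
  "cinv M i = inv_into (cdom M i) (cmap M i)"

definition manifold_topology :: "('i, 'q, 'e::euclidean_space) atlas \<Rightarrow> 'q topology" where
  "manifold_topology M =
     topology (\<lambda>U. U \<subseteq> points M \<and> (\<forall>i. open (cmap M i ` (U \<inter> cdom M i))))"

definition smooth_manifold :: "('i, 'q, 'e::euclidean_space) atlas \<Rightarrow> bool" where
  "smooth_manifold M \<longleftrightarrow>
     (\<forall>i. inj_on (cmap M i) (cdom M i)) \<and>
     (\<forall>i j. open (cmap M i ` (cdom M i \<inter> cdom M j))) \<and>
     (\<forall>i j. smooth_on (cmap M i ` (cdom M i \<inter> cdom M j)) (\<lambda>x. cmap M j (cinv M i x))) \<and>
     Hausdorff_space (manifold_topology M) \<and>
     second_countable (manifold_topology M)"

lemma openin_manifold_topology: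
  assumes "smooth_manifold M"
  shows "openin (manifold_topology M) U \<longleftrightarrow>
    U \<subseteq> points M \<and> (\<forall>i. open (cmap M i ` (U \<inter> cdom M i)))"
proof -
  have inj: "inj_on (cmap M i) (cdom M i)" for i
    using assms by (simp add: smooth_manifold_def)
  have "istopology (\<lambda>U. U \<subseteq> points M \<and> (\<forall>i. open (cmap M i ` (U \<inter> cdom M i))))"
    unfolding istopology_def
  proof (intro conjI allI impI, goal_cases)
    case (1 S T) then show ?case by blast
  next
    case (2 S T i)
    have "cmap M i ` (S \<inter> T \<inter> cdom M i) =
        cmap M i ` (S \<inter> cdom M i) \<inter> cmap M i ` (T \<inter> cdom M i)"
      using inj[of i] by (auto simp: inj_on_def)
    with 2 show ?case by auto
  next
    case (3 K) then show ?case by blast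
  next
    case (4 K i)
    have "cmap M i ` (\<Union>K \<inter> cdom M i) = (\<Union>U\<in>K. cmap M i ` (U \<inter> cdom M i))" by blast
    with 4 show ?case by auto
  qed
  then show ?thesis by (simp add: manifold_topology_def)
qed

definition smooth_fun :: "('i, 'q, 'e::euclidean_space) atlas \<Rightarrow> ('q \<Rightarrow> real) \<Rightarrow> bool" where
  "smooth_fun M f \<longleftrightarrow> (\<forall>i. smooth_on (cmap M i ` cdom M i) (\<lambda>x. f (cinv M i x)))"


section \<open>Tangent vectors and the tangent bundle\<close>

text \<open>
  A tangent vector is the family of its coordinate representatives, related by the derivatives of
  the transition maps; representatives for charts not containing the base point are set to zero.
\<close>

definition tangent_space :: "('i, 'q, 'e::euclidean_space) atlas \<Rightarrow> 'q \<Rightarrow> ('i \<Rightarrow> 'e) set" where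
  "tangent_space M q =
     {v. (\<forall>i. q \<notin> cdom M i \<longrightarrow> v i = 0) \<and>
         (\<forall>i j. q \<in> cdom M i \<and> q \<in> cdom M j \<longrightarrow>
            v j = frechet_derivative (\<lambda>x. cmap M j (cinv M i x)) (at (cmap M i q)) (v i))}"

text \<open>The tangent vector at \<open>q\<close> (in the domain of chart \<open>i\<close>) whose \<open>i\<close>-th representative is \<open>x\<close>.\<close>

definition tvec :: "('i, 'q, 'e::euclidean_space) atlas \<Rightarrow> 'i \<Rightarrow> 'q \<Rightarrow> 'e \<Rightarrow> ('i \<Rightarrow> 'e)" where
  "tvec M i q x = (\<lambda>j. if q \<in> cdom M j
     then frechet_derivative (\<lambda>y. cmap M j (cinv M i y)) (at (cmap M i q)) x else 0)"

definition tangent_bundle ::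
  "('i, 'q, 'e::euclidean_space) atlas \<Rightarrow> ('i, 'q \<times> ('i \<Rightarrow> 'e), 'e \<times> 'e) atlas" where
  "tangent_bundle M =
     \<lparr> cdom = (\<lambda>i. {(q, v). q \<in> cdom M i \<and> v \<in> tangent_space M q}),
       cmap = (\<lambda>i (q, v). (cmap M i q, v i)) \<rparr>"

definition vector_field ::
  "('i, 'q, 'e::euclidean_space) atlas \<Rightarrow> ('q \<Rightarrow> 'i \<Rightarrow> 'e) \<Rightarrow> bool" where
  "vector_field M X \<longleftrightarrow>
     (\<forall>q\<in>points M. X q \<in> tangent_space M q) \<and>
     (\<forall>i. smooth_on (cmap M i ` cdom M i) (\<lambda>x. X (cinv M i x) i))"

definition tderiv ::
  "('i, 'q, 'e::euclidean_space) atlas \<Rightarrow> 'q \<Rightarrow> ('i \<Rightarrow> 'e) \<Rightarrow> ('q \<Rightarrow> real) \<Rightarrow> real" where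
  "tderiv M q v f = (let i = (SOME i. q \<in> cdom M i)
     in frechet_derivative (\<lambda>x. f (cinv M i x)) (at (cmap M i q)) (v i))"

definition vf_deriv ::
  "('i, 'q, 'e::euclidean_space) atlas \<Rightarrow> ('q \<Rightarrow> 'i \<Rightarrow> 'e) \<Rightarrow> 'i \<Rightarrow> 'q \<Rightarrow> 'e \<Rightarrow> 'e" where
  "vf_deriv M X i q w = frechet_derivative (\<lambda>x. X (cinv M i x) i) (at (cmap M i q)) w"

definition lie_bracket ::
  "('i, 'q, 'e::euclidean_space) atlas \<Rightarrow> ('q \<Rightarrow> 'i \<Rightarrow> 'e) \<Rightarrow> ('q \<Rightarrow> 'i \<Rightarrow> 'e) \<Rightarrow> 'q \<Rightarrow> 'i \<Rightarrow> 'e" where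
  "lie_bracket M X Y q = (\<lambda>i. if q \<in> cdom M i
     then vf_deriv M Y i q (X q i) - vf_deriv M X i q (Y q i) else 0)"

definition complete_lift ::
  "('i, 'q, 'e::euclidean_space) atlas \<Rightarrow> ('q \<Rightarrow> 'i \<Rightarrow> 'e) \<Rightarrow> 'q \<times> ('i \<Rightarrow> 'e) \<Rightarrow> 'i \<Rightarrow> 'e \<times> 'e" where
  "complete_lift M X = (\<lambda>(q, v) i. if q \<in> cdom M i then (X q i, vf_deriv M X i q (v i)) else 0)"

definition vertical_lift ::
  "('i, 'q, 'e::euclidean_space) atlas \<Rightarrow> ('q \<Rightarrow> 'i \<Rightarrow> 'e) \<Rightarrow> 'q \<times> ('i \<Rightarrow> 'e) \<Rightarrow> 'i \<Rightarrow> 'e \<times> 'e" where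
  "vertical_lift M X = (\<lambda>(q, v) i. if q \<in> cdom M i then (0, X q i) else 0)"


section \<open>Curves and flows\<close>

definition has_velocity ::
  "('i, 'q, 'e::euclidean_space) atlas \<Rightarrow> (real \<Rightarrow> 'q) \<Rightarrow> real \<Rightarrow> ('i \<Rightarrow> 'e) \<Rightarrow> bool" where
  "has_velocity M c t v \<longleftrightarrow> c t \<in> points M \<and> v \<in> tangent_space M (c t) \<and>
     (\<forall>i. c t \<in> cdom M i \<longrightarrow> (\<forall>\<^sub>F s in nhds t. c s \<in> cdom M i) \<and>
        ((\<lambda>s. cmap M i (c s)) has_vector_derivative v i) (at t))"

definition velocity ::
  "('i, 'q, 'e::euclidean_space) atlas \<Rightarrow> (real \<Rightarrow> 'q) \<Rightarrow> real \<Rightarrow> ('i \<Rightarrow> 'e)" where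
  "velocity M c t = (\<lambda>i. if c t \<in> cdom M i
     then vector_derivative (\<lambda>s. cmap M i (c s)) (at t) else 0)"

definition open_interval_about_0 :: "real set \<Rightarrow> bool" where
  "open_interval_about_0 I \<longleftrightarrow> open I \<and> is_interval I \<and> 0 \<in> I"

text \<open>Integral curves of a vector field \<open>Z\<close> given along a subset \<open>S\<close> (a submanifold) of \<open>M\<close>.\<close>

definition integral_curve ::
  "('i, 'q, 'e::euclidean_space) atlas \<Rightarrow> 'q set \<Rightarrow> ('q \<Rightarrow> 'i \<Rightarrow> 'e) \<Rightarrow> real set \<Rightarrow>
     (real \<Rightarrow> 'q) \<Rightarrow> bool" where
  "integral_curve M S Z I c \<longleftrightarrow> (\<forall>t\<in>I. c t \<in> S \<and> has_velocity M c t (Z (c t)))"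

definition flow_dom ::
  "('i, 'q, 'e::euclidean_space) atlas \<Rightarrow> 'q set \<Rightarrow> ('q \<Rightarrow> 'i \<Rightarrow> 'e) \<Rightarrow> real \<Rightarrow> 'q set" where
  "flow_dom M S Z t =
     {p. \<exists>I c. open_interval_about_0 I \<and> t \<in> I \<and> integral_curve M S Z I c \<and> c 0 = p}"

definition flow ::
  "('i, 'q, 'e::euclidean_space) atlas \<Rightarrow> 'q set \<Rightarrow> ('q \<Rightarrow> 'i \<Rightarrow> 'e) \<Rightarrow> real \<Rightarrow> 'q \<Rightarrow> 'q" where
  "flow M S Z t p = (THE p'. \<exists>I c. open_interval_about_0 I \<and> t \<in> I \<and>
     integral_curve M S Z I c \<and> c 0 = p \<and> c t = p')"


section \<open>Riemannian metrics\<close>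

definition linear_on_tangent ::
  "('i, 'q, 'e::euclidean_space) atlas \<Rightarrow> 'q \<Rightarrow> (('i \<Rightarrow> 'e) \<Rightarrow> real) \<Rightarrow> bool" where
  "linear_on_tangent M q \<theta> \<longleftrightarrow>
     (\<forall>u\<in>tangent_space M q. \<forall>v\<in>tangent_space M q. \<forall>r.
        \<theta> (u + v) = \<theta> u + \<theta> v \<and> \<theta> (r *\<^sub>R u) = r * \<theta> u)"

definition metric_rep ::
  "('i, 'q, 'e::euclidean_space) atlas \<Rightarrow> ('q \<Rightarrow> ('i \<Rightarrow> 'e) \<Rightarrow> ('i \<Rightarrow> 'e) \<Rightarrow> real) \<Rightarrow>
     'i \<Rightarrow> 'e \<Rightarrow> 'e \<Rightarrow> 'e \<Rightarrow> real" where
  "metric_rep M g i x v w = g (cinv M i x) (tvec M i (cinv M i x) v) (tvec M i (cinv M i x) w)"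

definition riemannian_metric ::
  "('i, 'q, 'e::euclidean_space) atlas \<Rightarrow> ('q \<Rightarrow> ('i \<Rightarrow> 'e) \<Rightarrow> ('i \<Rightarrow> 'e) \<Rightarrow> real) \<Rightarrow> bool" where
  "riemannian_metric M g \<longleftrightarrow>
     (\<forall>q\<in>points M. \<forall>u\<in>tangent_space M q.
        linear_on_tangent M q (g q u) \<and>
        (\<forall>v\<in>tangent_space M q. g q u v = g q v u) \<and>
        (u \<noteq> 0 \<longrightarrow> g q u u > 0)) \<and>
     (\<forall>i v w. smooth_on (cmap M i ` cdom M i) (\<lambda>x. metric_rep M g i x v w))"

text \<open>
  Christoffel symbols in the chart \<open>i\<close> as bilinear maps,
  \<open>(v, w) \<mapsto> \<Gamma>\<^sup>k\<^sub>a\<^sub>b v\<^sup>a w\<^sup>b\<close>, via the first-kind formula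
  \<open>g\<^sub>c\<^sub>k \<Gamma>\<^sup>k\<^sub>a\<^sub>b = 1/2 (\<partial>\<^sub>a g\<^sub>b\<^sub>c + \<partial>\<^sub>b g\<^sub>a\<^sub>c - \<partial>\<^sub>c g\<^sub>a\<^sub>b)\<close>.
\<close>

definition christoffel ::
  "('i, 'q, 'e::euclidean_space) atlas \<Rightarrow> ('q \<Rightarrow> ('i \<Rightarrow> 'e) \<Rightarrow> ('i \<Rightarrow> 'e) \<Rightarrow> real) \<Rightarrow>
     'i \<Rightarrow> 'e \<Rightarrow> 'e \<Rightarrow> 'e \<Rightarrow> 'e" where
  "christoffel M g i x v w = (THE z. \<forall>y. metric_rep M g i x z y =
     (frechet_derivative (\<lambda>x. metric_rep M g i x w y) (at x) v
    + frechet_derivative (\<lambda>x. metric_rep M g i x v y) (at x) w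
    - frechet_derivative (\<lambda>x. metric_rep M g i x v w) (at x) y) / 2)"

definition levi_civita ::
  "('i, 'q, 'e::euclidean_space) atlas \<Rightarrow> ('q \<Rightarrow> ('i \<Rightarrow> 'e) \<Rightarrow> ('i \<Rightarrow> 'e) \<Rightarrow> real) \<Rightarrow>
     ('q \<Rightarrow> 'i \<Rightarrow> 'e) \<Rightarrow> ('q \<Rightarrow> 'i \<Rightarrow> 'e) \<Rightarrow> 'q \<Rightarrow> 'i \<Rightarrow> 'e" where
  "levi_civita M g X Y q = (\<lambda>i. if q \<in> cdom M i
     then vf_deriv M Y i q (X q i) + christoffel M g i (cmap M i q) (X q i) (Y q i) else 0)"

definition geodesic_spray ::
  "('i, 'q, 'e::euclidean_space) atlas \<Rightarrow> ('q \<Rightarrow> ('i \<Rightarrow> 'e) \<Rightarrow> ('i \<Rightarrow> 'e) \<Rightarrow> real) \<Rightarrow>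
     'q \<times> ('i \<Rightarrow> 'e) \<Rightarrow> 'i \<Rightarrow> 'e \<times> 'e" where
  "geodesic_spray M g = (\<lambda>(q, v) i. if q \<in> cdom M i
     then (v i, - christoffel M g i (cmap M i q) (v i) (v i)) else 0)"

definition kinetic ::
  "('q \<Rightarrow> ('i \<Rightarrow> 'e) \<Rightarrow> ('i \<Rightarrow> 'e) \<Rightarrow> real) \<Rightarrow> 'q \<times> ('i \<Rightarrow> 'e) \<Rightarrow> real" where
  "kinetic g = (\<lambda>(q, v). g q v v / 2)"


section \<open>Distributions and adapted frames\<close>

text \<open>
  Smoothness: locally spanned by smooth sections; these may be taken globally defined, by cutting
  off with a bump function.
\<close>

definition distribution ::
  "('i, 'q, 'e::euclidean_space) atlas \<Rightarrow> nat \<Rightarrow> ('q \<Rightarrow> ('i \<Rightarrow> 'e) set) \<Rightarrow> bool" where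
  "distribution M m D \<longleftrightarrow>
     (\<forall>q\<in>points M. D q \<subseteq> tangent_space M q \<and> subspace (D q) \<and> dim (D q) = m) \<and>
     (\<forall>q\<in>points M. \<exists>U (Y :: nat \<Rightarrow> 'q \<Rightarrow> 'i \<Rightarrow> 'e). openin (manifold_topology M) U \<and> q \<in> U \<and>
        (\<forall>k<m. vector_field M (Y k)) \<and> (\<forall>p\<in>U. D p = span ((\<lambda>k. Y k p) ` {..<m})))"

definition section_of ::
  "('i, 'q, 'e::euclidean_space) atlas \<Rightarrow> ('q \<Rightarrow> ('i \<Rightarrow> 'e) set) \<Rightarrow> ('q \<Rightarrow> 'i \<Rightarrow> 'e) \<Rightarrow> bool" where
  "section_of M D X \<longleftrightarrow> vector_field M X \<and> (\<forall>q\<in>points M. X q \<in> D q)"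

definition orth_compl ::
  "('i, 'q, 'e::euclidean_space) atlas \<Rightarrow> ('q \<Rightarrow> ('i \<Rightarrow> 'e) \<Rightarrow> ('i \<Rightarrow> 'e) \<Rightarrow> real) \<Rightarrow>
     ('q \<Rightarrow> ('i \<Rightarrow> 'e) set) \<Rightarrow> 'q \<Rightarrow> ('i \<Rightarrow> 'e) set" where
  "orth_compl M g D q = {w \<in> tangent_space M q. \<forall>u\<in>D q. g q u w = 0}"

definition orth_proj ::
  "('q \<Rightarrow> ('i \<Rightarrow> 'e::euclidean_space) \<Rightarrow> ('i \<Rightarrow> 'e) \<Rightarrow> real) \<Rightarrow>
     ('q \<Rightarrow> ('i \<Rightarrow> 'e) set) \<Rightarrow> ('q \<Rightarrow> 'i \<Rightarrow> 'e) \<Rightarrow> 'q \<Rightarrow> 'i \<Rightarrow> 'e" where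
  "orth_proj g S X q = (THE u. u \<in> S q \<and> (\<forall>s\<in>S q. g q (X q - u) s = 0))"

text \<open>
  A global frame \<open>E\<close>, indexed by a type with as many elements as the dimension; the indices in \<open>A\<close>
  belong to \<open>D\<close>, the remaining ones to its orthogonal complement.
\<close>

definition adapted_frame ::
  "('i, 'q, real^'n) atlas \<Rightarrow> ('q \<Rightarrow> ('i \<Rightarrow> real^'n) \<Rightarrow> ('i \<Rightarrow> real^'n) \<Rightarrow> real) \<Rightarrow>
     ('q \<Rightarrow> ('i \<Rightarrow> real^'n) set) \<Rightarrow> ('n \<Rightarrow> 'q \<Rightarrow> 'i \<Rightarrow> real^'n) \<Rightarrow> 'n set \<Rightarrow> bool" where
  "adapted_frame M g D E A \<longleftrightarrow>
     (\<forall>\<alpha>. vector_field M (E \<alpha>)) \<and>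
     (\<forall>q\<in>points M.
        inj (\<lambda>\<alpha>. E \<alpha> q) \<and> independent (range (\<lambda>\<alpha>. E \<alpha> q)) \<and>
        tangent_space M q = span (range (\<lambda>\<alpha>. E \<alpha> q)) \<and>
        D q = span ((\<lambda>\<alpha>. E \<alpha> q) ` A) \<and>
        orth_compl M g D q = span ((\<lambda>\<alpha>. E \<alpha> q) ` (- A)))"

text \<open>
  The coefficients of a tangent vector in the frame: read as functions of \<open>(q, v)\<close> these are the
  quasi-velocities, read as functionals of \<open>v\<close> they are the dual frame.
\<close>

definition frame_coeff ::
  "('n::finite \<Rightarrow> 'q \<Rightarrow> 'i \<Rightarrow> 'e::euclidean_space) \<Rightarrow> 'q \<Rightarrow> ('i \<Rightarrow> 'e) \<Rightarrow> 'n \<Rightarrow> real" where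
  "frame_coeff E q v = (THE c. v = (\<Sum>\<alpha>\<in>UNIV. c \<alpha> *\<^sub>R E \<alpha> q))"


section \<open>The nonholonomic vector field and its exponential map\<close>

definition constraint_mfd :: "('i, 'q, 'e) atlas \<Rightarrow> ('q \<Rightarrow> ('i \<Rightarrow> 'e) set) \<Rightarrow> ('q \<times> ('i \<Rightarrow> 'e)) set" where
  "constraint_mfd M D = {(q, v). q \<in> points M \<and> v \<in> D q}"

text \<open>\<open>Z(Y\<^sup>V(L)) - Y\<^sup>C(L)\<close> at the point \<open>p\<close> of the tangent bundle.\<close>

definition euler_lagrange ::
  "('i, 'q, 'e::euclidean_space) atlas \<Rightarrow> ('q \<times> ('i \<Rightarrow> 'e) \<Rightarrow> real) \<Rightarrow>
     ('q \<times> ('i \<Rightarrow> 'e) \<Rightarrow> 'i \<Rightarrow> 'e \<times> 'e) \<Rightarrow> ('q \<Rightarrow> 'i \<Rightarrow> 'e) \<Rightarrow> 'q \<times> ('i \<Rightarrow> 'e) \<Rightarrow> real" where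
  "euler_lagrange M L Z Y p =
     tderiv (tangent_bundle M) p (Z p)
       (\<lambda>p'. tderiv (tangent_bundle M) p' (vertical_lift M Y p') L)
     - tderiv (tangent_bundle M) p (complete_lift M Y p) L"

text \<open>
  Smooth functions on the closed embedded submanifold \<open>constraint_mfd M D\<close> are the restrictions of
  smooth functions on the tangent bundle, whence the quantification over \<open>F\<close>. Tangency of \<open>\<Gamma>\<close> to
  the constraint manifold follows from the form of \<open>\<Gamma>\<close>, because \<open>[X\<^sub>a, X\<^sub>b]\<close> is skew in \<open>a, b\<close>.
  Nothing is required of \<open>\<Gamma>\<close> away from the constraint manifold.
\<close>

definition nonholonomic_field ::
  "('i, 'q, real^'n) atlas \<Rightarrow> ('q \<Rightarrow> ('i \<Rightarrow> real^'n) set) \<Rightarrow> ('n \<Rightarrow> 'q \<Rightarrow> 'i \<Rightarrow> real^'n) \<Rightarrow> 'n set \<Rightarrow>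
     ('q \<times> ('i \<Rightarrow> real^'n) \<Rightarrow> real) \<Rightarrow> ('q \<times> ('i \<Rightarrow> real^'n) \<Rightarrow> 'i \<Rightarrow> (real^'n) \<times> (real^'n)) \<Rightarrow> bool" where
  "nonholonomic_field M D E A L \<Gamma> \<longleftrightarrow>
     (\<exists>F. (\<forall>a\<in>A. smooth_fun (tangent_bundle M) (F a)) \<and>
        (\<forall>p\<in>constraint_mfd M D. \<Gamma> p =
           (\<Sum>a\<in>A. frame_coeff E (fst p) (snd p) a *\<^sub>R complete_lift M (E a) p
                   + F a p *\<^sub>R vertical_lift M (E a) p))) \<and>
     (\<forall>X. section_of M D X \<longrightarrow>
        (\<forall>p\<in>constraint_mfd M D. euler_lagrange M L \<Gamma> X p = 0))"

definition nh_exp_dom ::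
  "('i, 'q, 'e::euclidean_space) atlas \<Rightarrow> ('q \<Rightarrow> ('i \<Rightarrow> 'e) set) \<Rightarrow>
     ('q \<times> ('i \<Rightarrow> 'e) \<Rightarrow> 'i \<Rightarrow> 'e \<times> 'e) \<Rightarrow> 'q \<Rightarrow> ('i \<Rightarrow> 'e) set" where
  "nh_exp_dom M D \<Gamma> q =
     {v \<in> D q. (q, v) \<in> flow_dom (tangent_bundle M) (constraint_mfd M D) \<Gamma> 1}"

definition nh_exp ::
  "('i, 'q, 'e::euclidean_space) atlas \<Rightarrow> ('q \<Rightarrow> ('i \<Rightarrow> 'e) set) \<Rightarrow>
     ('q \<times> ('i \<Rightarrow> 'e) \<Rightarrow> 'i \<Rightarrow> 'e \<times> 'e) \<Rightarrow> 'q \<Rightarrow> ('i \<Rightarrow> 'e) \<Rightarrow> 'q" where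
  "nh_exp M D \<Gamma> q v = fst (flow (tangent_bundle M) (constraint_mfd M D) \<Gamma> 1 (q, v))"

text \<open>The tangent vector to \<open>D q\<close> at \<open>v\<close> identified with \<open>u \<in> D q\<close> is the velocity of \<open>s \<mapsto> v + s u\<close>.\<close>

definition nh_exp_tangent ::
  "('i, 'q, 'e::euclidean_space) atlas \<Rightarrow> ('q \<Rightarrow> ('i \<Rightarrow> 'e) set) \<Rightarrow>
     ('q \<times> ('i \<Rightarrow> 'e) \<Rightarrow> 'i \<Rightarrow> 'e \<times> 'e) \<Rightarrow> 'q \<Rightarrow> ('i \<Rightarrow> 'e) \<Rightarrow> ('i \<Rightarrow> 'e) \<Rightarrow> ('i \<Rightarrow> 'e)" where
  "nh_exp_tangent M D \<Gamma> q v u = velocity M (\<lambda>s. nh_exp M D \<Gamma> q (v + s *\<^sub>R u)) 0"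


section \<open>The connection and covariant derivatives along curves\<close>

definition nabla_bar ::
  "('i, 'q, 'e::euclidean_space) atlas \<Rightarrow> ('q \<Rightarrow> ('i \<Rightarrow> 'e) \<Rightarrow> ('i \<Rightarrow> 'e) \<Rightarrow> real) \<Rightarrow>
     ('q \<Rightarrow> ('i \<Rightarrow> 'e) set) \<Rightarrow> ('q \<Rightarrow> 'i \<Rightarrow> 'e) \<Rightarrow> ('q \<Rightarrow> 'i \<Rightarrow> 'e) \<Rightarrow> 'q \<Rightarrow> 'i \<Rightarrow> 'e" where
  "nabla_bar M g D X Y =
     (let P = orth_proj g D; Q = orth_proj g (orth_compl M g D) in
        P (levi_civita M g (P X) (P Y)) + P (lie_bracket M (Q X) (P Y))
      + Q (levi_civita M g (Q X) (Q Y)) + Q (lie_bracket M (P X) (Q Y)))"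

text \<open>
  Covariant derivative of a vector field \<open>X\<close> along a curve \<open>c\<close> for a linear connection \<open>nabla\<close>,
  expressed in a global frame (the result does not depend on the frame).
\<close>

definition cov_deriv ::
  "('i, 'q, 'e::euclidean_space) atlas \<Rightarrow> ('n::finite \<Rightarrow> 'q \<Rightarrow> 'i \<Rightarrow> 'e) \<Rightarrow>
     (('q \<Rightarrow> 'i \<Rightarrow> 'e) \<Rightarrow> ('q \<Rightarrow> 'i \<Rightarrow> 'e) \<Rightarrow> 'q \<Rightarrow> 'i \<Rightarrow> 'e) \<Rightarrow>
     (real \<Rightarrow> 'q) \<Rightarrow> (real \<Rightarrow> 'i \<Rightarrow> 'e) \<Rightarrow> real \<Rightarrow> 'i \<Rightarrow> 'e" where
  "cov_deriv M E nabla c X t =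
     (\<Sum>\<alpha>\<in>UNIV. deriv (\<lambda>s. frame_coeff E (c s) (X s) \<alpha>) t *\<^sub>R E \<alpha> (c t))
   + (\<Sum>\<alpha>\<in>UNIV. \<Sum>\<beta>\<in>UNIV.
        (frame_coeff E (c t) (velocity M c t) \<beta> * frame_coeff E (c t) (X t) \<alpha>)
          *\<^sub>R nabla (E \<beta>) (E \<alpha>) (c t))"

text \<open>
  Differentiability is enough in the next two notions: they are only used for solutions of linear
  differential equations with smooth coefficients (hence automatically smooth), and for the test
  fields in the definition of the covariant derivative of a one-form.
\<close>

definition field_along ::
  "('i, 'q, 'e::euclidean_space) atlas \<Rightarrow> ('n::finite \<Rightarrow> 'q \<Rightarrow> 'i \<Rightarrow> 'e) \<Rightarrow> real set \<Rightarrow>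
     (real \<Rightarrow> 'q) \<Rightarrow> (real \<Rightarrow> 'i \<Rightarrow> 'e) \<Rightarrow> bool" where
  "field_along M E I c X \<longleftrightarrow>
     (\<forall>t\<in>I. X t \<in> tangent_space M (c t)) \<and>
     (\<forall>\<alpha>. (\<lambda>t. frame_coeff E (c t) (X t) \<alpha>) differentiable_on I)"

definition oneform_along ::
  "('i, 'q, 'e::euclidean_space) atlas \<Rightarrow> ('n::finite \<Rightarrow> 'q \<Rightarrow> 'i \<Rightarrow> 'e) \<Rightarrow> real set \<Rightarrow>
     (real \<Rightarrow> 'q) \<Rightarrow> (real \<Rightarrow> ('i \<Rightarrow> 'e) \<Rightarrow> real) \<Rightarrow> bool" where
  "oneform_along M E I c h \<longleftrightarrow>
     (\<forall>t\<in>I. linear_on_tangent M (c t) (h t)) \<and>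
     (\<forall>\<alpha>. (\<lambda>t. h t (E \<alpha> (c t))) differentiable_on I)"

definition parallel_transport ::
  "('i, 'q, 'e::euclidean_space) atlas \<Rightarrow> ('n::finite \<Rightarrow> 'q \<Rightarrow> 'i \<Rightarrow> 'e) \<Rightarrow>
     (('q \<Rightarrow> 'i \<Rightarrow> 'e) \<Rightarrow> ('q \<Rightarrow> 'i \<Rightarrow> 'e) \<Rightarrow> 'q \<Rightarrow> 'i \<Rightarrow> 'e) \<Rightarrow>
     real set \<Rightarrow> (real \<Rightarrow> 'q) \<Rightarrow> ('i \<Rightarrow> 'e) \<Rightarrow> (real \<Rightarrow> 'i \<Rightarrow> 'e) \<Rightarrow> bool" where
  "parallel_transport M E nabla I c w W \<longleftrightarrow>
     field_along M E I c W \<and> W 0 = w \<and> (\<forall>t\<in>I. cov_deriv M E nabla c W t = 0)"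

definition oneform_solution ::
  "('i, 'q, 'e::euclidean_space) atlas \<Rightarrow> ('n::finite \<Rightarrow> 'q \<Rightarrow> 'i \<Rightarrow> 'e) \<Rightarrow>
     (('q \<Rightarrow> 'i \<Rightarrow> 'e) \<Rightarrow> ('q \<Rightarrow> 'i \<Rightarrow> 'e) \<Rightarrow> 'q \<Rightarrow> 'i \<Rightarrow> 'e) \<Rightarrow>
     real set \<Rightarrow> (real \<Rightarrow> 'q) \<Rightarrow> (real \<Rightarrow> ('i \<Rightarrow> 'e) \<Rightarrow> real) \<Rightarrow>
     (real \<Rightarrow> ('i \<Rightarrow> 'e) \<Rightarrow> real) \<Rightarrow> bool" where
  "oneform_solution M E nabla I c \<mu> h \<longleftrightarrow>
     oneform_along M E I c h \<and>
     (\<forall>u\<in>tangent_space M (c 0). h 0 u = 0) \<and>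
     (\<forall>X. field_along M E I c X \<longrightarrow>
        (\<forall>t\<in>I. deriv (\<lambda>s. h s (X s)) t - h t (cov_deriv M E nabla c X t) = \<mu> t (X t)))"

text \<open>\<open>\<lambda>(t) = \<lambda>\<^sub>i(c'(t)) X\<^sup>i(c(t))\<close>, the sum running over the frame indices not in \<open>A\<close>.\<close>

definition multiplier_form ::
  "('i, 'q, 'e::euclidean_space) atlas \<Rightarrow> ('n::finite \<Rightarrow> 'q \<Rightarrow> 'i \<Rightarrow> 'e) \<Rightarrow> 'n set \<Rightarrow>
     ('q \<times> ('i \<Rightarrow> 'e) \<Rightarrow> real) \<Rightarrow> ('q \<times> ('i \<Rightarrow> 'e) \<Rightarrow> 'i \<Rightarrow> 'e \<times> 'e) \<Rightarrow>
     (real \<Rightarrow> 'q) \<Rightarrow> real \<Rightarrow> ('i \<Rightarrow> 'e) \<Rightarrow> real" where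
  "multiplier_form M E A L \<Gamma> c t u =
     (\<Sum>i\<in>- A. euler_lagrange M L \<Gamma> (E i) (c t, velocity M c t) * frame_coeff E (c t) u i)"


section \<open>Modifications of a metric\<close>

definition preserving_modification ::
  "('i, 'q, 'e::euclidean_space) atlas \<Rightarrow> ('q \<Rightarrow> ('i \<Rightarrow> 'e) set) \<Rightarrow>
     ('q \<Rightarrow> ('i \<Rightarrow> 'e) \<Rightarrow> ('i \<Rightarrow> 'e) \<Rightarrow> real) \<Rightarrow> ('q \<Rightarrow> ('i \<Rightarrow> 'e) \<Rightarrow> ('i \<Rightarrow> 'e) \<Rightarrow> real) \<Rightarrow> bool" where
  "preserving_modification M D g gh \<longleftrightarrow>
     (\<forall>q\<in>points M. \<forall>u\<in>D q. \<forall>v\<in>D q. gh q u v = g q u v)"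

definition geodesic_extension ::
  "('i, 'q, 'e::euclidean_space) atlas \<Rightarrow> ('q \<Rightarrow> ('i \<Rightarrow> 'e) set) \<Rightarrow>
     ('q \<times> ('i \<Rightarrow> 'e) \<Rightarrow> 'i \<Rightarrow> 'e \<times> 'e) \<Rightarrow> ('q \<Rightarrow> ('i \<Rightarrow> 'e) \<Rightarrow> ('i \<Rightarrow> 'e) \<Rightarrow> real) \<Rightarrow> bool" where
  "geodesic_extension M D \<Gamma> gh \<longleftrightarrow>
     riemannian_metric M gh \<and> (\<forall>p\<in>constraint_mfd M D. geodesic_spray M gh p = \<Gamma> p)"

end

theory Submission
  imports Defs
begin

text \<open>
  In every chart the nonholonomic vector field has the form \<open>(v, a)\<close>, with an acceleration \<open>a\<close> that
  depends on the point and on \<open>v\<close>, and the geodesic spray of \<open>gh\<close> has the form \<open>(v, - C (v, v))\<close>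
  with the Christoffel symbols \<open>C\<close> of \<open>gh\<close>. The two agree on \<open>D\<close> if the covariant acceleration
  \<open>a + C (v, v)\<close> vanishes, and for this it is enough that it is \<open>gh\<close>-orthogonal to \<open>D\<close> and to the
  \<open>g\<close>-orthogonal complement of \<open>D\<close>, which together span the tangent space. Each of the two conditions on
  the exponential map gives one of these relations, by differentiation along a trajectory.

  The first condition is the Gauss lemma, and \<open>acceleration_orthogonal_D\<close> runs the usual proof of that
  lemma backwards. For the variation field \<open>\<xi>\<close> of the trajectories \<open>c\<^sub>s\<close> with initial velocities
  \<open>v + s u\<close>, the condition reads \<open>gh (c', \<xi>) = t gh (v, u)\<close>; with \<open>u = v\<close> it says that the
  trajectories have constant speed for \<open>gh\<close>. The derivative of the first identity in \<open>t\<close>, minus half of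
  the derivative of the squared speed in \<open>s\<close>, makes the covariant acceleration orthogonal to \<open>\<xi>\<close>, and
  \<open>\<xi> / t\<close> tends to \<open>u\<close> as \<open>t\<close> tends to 0.

  The second condition says that \<open>gh (c', W) + h (W)\<close> is constant for the transported field \<open>W\<close>. The
  derivative of \<open>h (W)\<close> is \<open>\<lambda> (W)\<close>, because \<open>W\<close> is parallel, and this is the \<open>g\<close>-inner product of \<open>W\<close>
  with the covariant acceleration for \<open>g\<close>. Let \<open>N\<close> and \<open>N'\<close> be the covariant derivatives of \<open>W\<close> along \<open>c\<close>
  for \<open>gh\<close> and for \<open>g\<close>, at \<open>t = 0\<close>. As \<open>g (c', W) = 0\<close>, the product just mentioned is \<open>- g (v, N')\<close>, and
  so the product of \<open>w\<close> with the covariant acceleration for \<open>gh\<close> is \<open>g (v, N') - gh (v, N)\<close>. Extend \<open>v\<close>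
  to a section \<open>V\<close> of \<open>D\<close>. Then \<open>gh (v, N)\<close> is half the derivative of \<open>gh (V, V)\<close> along \<open>w\<close> plus the
  \<open>gh\<close>-product of \<open>v\<close> with the bracket of \<open>V\<close> and \<open>W\<close>, and likewise for \<open>g\<close>. Parallel transport for the
  connection of the statement is exactly what puts this bracket into \<open>D\<close>, so that only values on \<open>D\<close>
  enter, where both metrics agree (\<open>transported_field\<close> and \<open>acceleration_orthogonal_D_orth\<close>).

  These computations take place in one chart, but the conditions speak of the flow on the tangent
  bundle. The bridge is \<open>local_trajectories\<close>: near \<open>t = 0\<close> the exponential map at \<open>t (v + s u)\<close> is the
  position at time \<open>t\<close> of the trajectory with initial velocity \<open>v + s u\<close>, and these trajectories depend
  differentiably on \<open>s\<close>. It rests on three facts. Solutions of continuously differentiable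
  differential equations are differentiable in the initial value
  (\<open>flow_differentiable_in_initial_value\<close>); motions on the manifold are unique (\<open>motion_unique\<close>); and the
  acceleration is quadratic in the velocity (\<open>acceleration_homogeneous\<close>), as the Lagrange-d'Alembert
  equations determine its component in \<open>D\<close>.
\<close>


section \<open>Continuously differentiable maps\<close>

text \<open>
  The derivative is a bounded linear map, so that its continuity is continuity in the operator norm;
  this is what makes the estimates on compact sets uniform in the direction.
\<close>

definition C1_on :: "'a::real_normed_vector set \<Rightarrow> ('a \<Rightarrow> 'b::real_normed_vector) \<Rightarrow> bool" where
  "C1_on S f \<longleftrightarrow>
     (\<exists>f'. (\<forall>x\<in>S. (f has_derivative blinfun_apply (f' x)) (at x)) \<and> continuous_on S f')"

lemma C1_on_subset: "C1_on S f \<Longrightarrow> T \<subseteq> S \<Longrightarrow> C1_on T f"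
  unfolding C1_on_def by (auto intro: continuous_on_subset)

lemma C1_onI:
  fixes f :: "'a::euclidean_space \<Rightarrow> 'b::real_normed_vector"
  assumes "\<And>x. x \<in> S \<Longrightarrow> (f has_derivative f' x) (at x)"
    and "\<And>v. v \<in> Basis \<Longrightarrow> continuous_on S (\<lambda>x. f' x v)"
  shows "C1_on S f"
proof -
  have bl: "blinfun_apply (Blinfun (f' x)) = f' x" if "x \<in> S" for x
    using assms(1)[OF that] by (intro bounded_linear_Blinfun_apply has_derivative_bounded_linear)
  have "continuous_on S (\<lambda>x. Blinfun (f' x))"
  proof (rule continuous_on_blinfun_componentwise)
    fix v :: 'a assume "v \<in> Basis"
    then show "continuous_on S (\<lambda>x. blinfun_apply (Blinfun (f' x)) v)"
      using assms(2)[of v] bl by (auto cong: continuous_on_cong)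
  qed
  then show ?thesis
    using assms(1) bl unfolding C1_on_def by (intro exI[of _ "\<lambda>x. Blinfun (f' x)"]) auto
qed

lemma C1_onD:
  assumes "C1_on S f"
  shows C1_on_has_derivative: "x \<in> S \<Longrightarrow> (f has_derivative frechet_derivative f (at x)) (at x)"
    and C1_on_continuous: "continuous_on S f"
    and C1_on_frechet_continuous: "continuous_on S (\<lambda>x. frechet_derivative f (at x) v)"
proof -
  obtain f' where f': "\<And>x. x \<in> S \<Longrightarrow> (f has_derivative blinfun_apply (f' x)) (at x)"
    and c: "continuous_on S f'"
    using assms unfolding C1_on_def by auto
  have eq: "frechet_derivative f (at x) = blinfun_apply (f' x)" if "x \<in> S" for x
    using f'[OF that] frechet_derivative_at by metis
  show "x \<in> S \<Longrightarrow> (f has_derivative frechet_derivative f (at x)) (at x)"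
    using f' eq by simp
  show "continuous_on S f"
    using f' by (meson continuous_at_imp_continuous_on has_derivative_continuous)
  have "continuous_on S (\<lambda>x. blinfun_apply (f' x) v)"
    using c by (intro continuous_intros)
  then show "continuous_on S (\<lambda>x. frechet_derivative f (at x) v)"
    using eq by (auto cong: continuous_on_cong)
qed

lemma C1_on_compose:
  assumes f: "C1_on S f" and g: "C1_on T g" and sub: "f ` S \<subseteq> T"
  shows "C1_on S (\<lambda>x. g (f x))"
proof -
  obtain f' where f': "\<And>x. x \<in> S \<Longrightarrow> (f has_derivative blinfun_apply (f' x)) (at x)"
    and cf: "continuous_on S f'"
    using f unfolding C1_on_def by auto
  obtain g' where g': "\<And>x. x \<in> T \<Longrightarrow> (g has_derivative blinfun_apply (g' x)) (at x)"
    and cg: "continuous_on T g'"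
    using g unfolding C1_on_def by auto
  have "continuous_on S (\<lambda>x. g' (f x) o\<^sub>L f' x)"
    using continuous_on_compose2[OF cg C1_on_continuous[OF f] sub] cf
    by (intro continuous_intros)
  moreover have "((\<lambda>x. g (f x)) has_derivative blinfun_apply (g' (f x) o\<^sub>L f' x)) (at x)" if "x \<in> S" for x
    using has_derivative_compose[OF f'[OF that] g'[of "f x"]] that sub
    by (auto simp: o_def blinfun_compose.rep_eq)
  ultimately show ?thesis
    unfolding C1_on_def by (intro exI[of _ "\<lambda>x. g' (f x) o\<^sub>L f' x"] conjI ballI)
qed

lemma C1_on_bounded_linear: "bounded_linear f \<Longrightarrow> C1_on S f"
  unfolding C1_on_def
  by (rule exI[of _ "\<lambda>_. Blinfun f"])
     (auto simp: bounded_linear_Blinfun_apply intro: bounded_linear_imp_has_derivative continuous_on_const)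

lemma C1_on_const: "C1_on S (\<lambda>_. c)"
  unfolding C1_on_def by (rule exI[of _ "\<lambda>_. 0"]) (auto intro!: derivative_eq_intros)

lemma C1_on_add:
  assumes "C1_on S f" "C1_on S g" shows "C1_on S (\<lambda>x. f x + g x)"
proof -
  obtain f' where f': "\<And>x. x \<in> S \<Longrightarrow> (f has_derivative blinfun_apply (f' x)) (at x)"
    and cf: "continuous_on S f'"
    using assms unfolding C1_on_def by auto
  obtain g' where g': "\<And>x. x \<in> S \<Longrightarrow> (g has_derivative blinfun_apply (g' x)) (at x)"
    and cg: "continuous_on S g'"
    using assms unfolding C1_on_def by auto
  show ?thesis unfolding C1_on_def
    by (rule exI[of _ "\<lambda>x. f' x + g' x"])
       (auto simp: plus_blinfun.rep_eq intro!: has_derivative_add f' g' continuous_intros cf cg)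
qed

lemma C1_on_sum:
  assumes "\<And>k. k \<in> K \<Longrightarrow> C1_on S (f k)" shows "C1_on S (\<lambda>x. \<Sum>k\<in>K. f k x)"
  using assms
proof (induction K rule: infinite_finite_induct)
  case (insert k K)
  then show ?case using C1_on_add[of S "f k" "\<lambda>x. \<Sum>k\<in>K. f k x"] by simp
qed (auto intro: C1_on_const)

lemma C1_on_Pair:
  fixes f :: "'a::real_normed_vector \<Rightarrow> 'b::real_normed_vector"
    and g :: "'a \<Rightarrow> 'c::real_normed_vector"
  assumes "C1_on S f" "C1_on S g" shows "C1_on S (\<lambda>x. (f x, g x))"
proof -
  have "C1_on S (\<lambda>x. (f x, 0::'c) + (0, g x))"
    by (intro C1_on_add C1_on_compose[OF assms(1) C1_on_bounded_linear[of "\<lambda>y. (y, 0::'c)" UNIV]]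
          C1_on_compose[OF assms(2) C1_on_bounded_linear[of "\<lambda>y. (0::'b, y)" UNIV]])
       (auto intro!: bounded_linear_Pair bounded_linear_ident bounded_linear_zero)
  then show ?thesis by simp
qed

lemma C1_on_bilinear:
  fixes f :: "'a::real_normed_vector \<Rightarrow> 'b::euclidean_space"
    and g :: "'a \<Rightarrow> 'c::euclidean_space"
  assumes "bounded_bilinear bil" "C1_on S f" "C1_on S g"
  shows "C1_on S (\<lambda>x. bil (f x) (g x))"
proof -
  interpret bounded_bilinear bil by fact
  have "C1_on UNIV (\<lambda>p. bil (fst p) (snd p))"
  proof (rule C1_onI)
    show "((\<lambda>p. bil (fst p) (snd p)) has_derivative
        (\<lambda>h. bil (fst p) (snd h) + bil (fst h) (snd p))) (at p)" for p
      by (auto intro!: derivative_eq_intros FDERIV)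
    show "continuous_on UNIV (\<lambda>p. bil (fst p) (snd v) + bil (fst v) (snd p))" for v
      by (intro continuous_on_add continuous_on[OF continuous_on_fst continuous_on_const]
            continuous_on[OF continuous_on_const continuous_on_snd] continuous_on_id)
  qed
  from C1_on_compose[OF C1_on_Pair[OF assms(2,3)] this subset_UNIV] show ?thesis by simp
qed

lemmas C1_on_scaleR = C1_on_bilinear[OF bounded_bilinear_scaleR]
lemmas C1_on_fst = C1_on_bounded_linear[OF bounded_linear_fst]
lemmas C1_on_snd = C1_on_bounded_linear[OF bounded_linear_snd]
lemmas C1_on_inner_left = C1_on_bounded_linear[OF bounded_linear_inner_left]

lemma C1_on_lipschitz:
  fixes f :: "'a::euclidean_space \<Rightarrow> 'b::real_normed_vector"
  assumes f: "C1_on K f" and K: "compact K" "convex K"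
  obtains L where "L > 0"
    "\<And>x y. x \<in> K \<Longrightarrow> y \<in> K \<Longrightarrow> norm (f x - f y) \<le> L * norm (x - y)"
proof -
  obtain f' where f': "\<And>x. x \<in> K \<Longrightarrow> (f has_derivative blinfun_apply (f' x)) (at x)"
    and cf: "continuous_on K f'"
    using f[unfolded C1_on_def] by (elim exE conjE) blast
  have "bounded (f' ` K)"
    using compact_continuous_image[OF cf K(1)] by (rule compact_imp_bounded)
  then obtain L where L: "L > 0" "\<And>x. x \<in> K \<Longrightarrow> norm (f' x) \<le> L"
    unfolding bounded_pos by auto
  have "norm (f x - f y) \<le> L * norm (x - y)" if "x \<in> K" "y \<in> K" for x y
    by (rule differentiable_bound[OF K(2) has_derivative_at_withinI[OF f']])
       (use L(2) that in \<open>simp_all add: norm_blinfun.rep_eq[symmetric]\<close>)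
  with L(1) show ?thesis by (rule that)
qed

lemma smooth_on_derivative:
  assumes "smooth_on S f"
  shows "smooth_on S (\<lambda>x. frechet_derivative f (at x) v)"
proof -
  have "Ck_on (Suc k) S f" for k using assms unfolding smooth_on_def by blast
  then show ?thesis by (auto simp: smooth_on_def)
qed

lemma smooth_on_C1:
  fixes f :: "'a::euclidean_space \<Rightarrow> 'b::real_normed_vector"
  assumes "smooth_on S f" "open S"
  shows "C1_on S f"
proof (rule C1_onI)
  have "Ck_on (Suc 0) S f" using assms unfolding smooth_on_def by blast
  then have d: "f differentiable_on S"
    and c: "continuous_on S (\<lambda>x. frechet_derivative f (at x) v)" for v
    by auto
  show "(f has_derivative frechet_derivative f (at x)) (at x)" if "x \<in> S" for x
    using d assms(2) that
    by (metis differentiable_on_eq_differentiable_at frechet_derivative_works)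
  show "continuous_on S (\<lambda>x. frechet_derivative f (at x) v)" for v by (fact c)
qed

lemma linear_sum_Basis:
  fixes v :: "'a::euclidean_space"
  assumes "linear f"
  shows "f v = (\<Sum>b\<in>Basis. (v \<bullet> b) *\<^sub>R f b)"
proof -
  have "f v = f (\<Sum>b\<in>Basis. (v \<bullet> b) *\<^sub>R b)" by (simp add: euclidean_representation)
  also have "\<dots> = (\<Sum>b\<in>Basis. (v \<bullet> b) *\<^sub>R f b)" by (simp add: linear_sum[OF assms] linear_cmul[OF assms])
  finally show ?thesis .
qed

lemma smooth_on_linear_derivative:
  fixes f :: "'a::euclidean_space \<Rightarrow> 'b::real_normed_vector"
  assumes "smooth_on S f" "open S" "x \<in> S"
  shows "linear (frechet_derivative f (at x))"
  using C1_on_has_derivative[OF smooth_on_C1[OF assms(1,2)] assms(3)] has_derivative_linear by blast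

text \<open>
  By linearity in the direction, the tangent map \<open>(x, v) \<mapsto> Df(x) v\<close> is a finite sum of products of
  coordinates of \<open>v\<close> and functions of \<open>x\<close>, which reduces joint differentiability to
  differentiability in \<open>x\<close>.
\<close>

lemma smooth_on_second_derivative:
  fixes f :: "'a::euclidean_space \<Rightarrow> 'b::euclidean_space"
  assumes f: "smooth_on S f" and S: "open S"
  shows C1_on_tangent_map: "C1_on (S \<times> UNIV) (\<lambda>(x, v). frechet_derivative f (at x) v)"
    and has_derivative_tangent_map: "x \<in> S \<Longrightarrow>
      ((\<lambda>(x, v). frechet_derivative f (at x) v) has_derivative
        (\<lambda>(a, b). frechet_derivative (\<lambda>x. frechet_derivative f (at x) v) (at x) a
                 + frechet_derivative f (at x) b)) (at (x, v))"
proof -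
  define d where "d = (\<lambda>v x. frechet_derivative f (at x) v)"
  have d1: "C1_on S (d v)" for v
    unfolding d_def by (intro smooth_on_C1 smooth_on_derivative f S)
  have lin: "x \<in> S \<Longrightarrow> linear (\<lambda>v. d v x)" for x
    unfolding d_def by (rule smooth_on_linear_derivative[OF f S])
  have exp: "d v x = (\<Sum>b\<in>Basis. (v \<bullet> b) *\<^sub>R d b x)" if "x \<in> S" for x v
    using linear_sum_Basis[OF lin[OF that]] .
  define g where "g = (\<lambda>p. \<Sum>b\<in>Basis. (snd p \<bullet> b) *\<^sub>R d b (fst p))"
  have fst_C1: "C1_on (S \<times> UNIV) (\<lambda>p. d b (fst p))" for b
    by (rule C1_on_compose[OF C1_on_fst d1]) auto
  have "C1_on (S \<times> UNIV) g"
    unfolding g_def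
    by (intro C1_on_sum C1_on_scaleR fst_C1 C1_on_compose[OF C1_on_snd C1_on_inner_left[of UNIV]]) auto
  have der: "((\<lambda>(x, v). d v x) has_derivative
        (\<lambda>(a, b). frechet_derivative (d v) (at x) a + d b x)) (at (x, v))" if x: "x \<in> S" for x v
  proof -
    have d': "(d b has_derivative frechet_derivative (d b) (at x)) (at x)" for b
      using C1_on_has_derivative[OF d1 x] .
    have G: "(g has_derivative (\<lambda>h. \<Sum>b\<in>Basis. (v \<bullet> b) *\<^sub>R frechet_derivative (d b) (at x) (fst h)
          + (snd h \<bullet> b) *\<^sub>R d b x)) (at (x, v))"
      unfolding g_def
    proof (rule has_derivative_sum)
      fix b :: 'a
      have A: "((\<lambda>p. snd p \<bullet> b) has_derivative (\<lambda>h. snd h \<bullet> b)) (at (x, v))"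
        by (intro bounded_linear_imp_has_derivative bounded_linear_intros bounded_linear_snd)
      have B: "((\<lambda>p. d b (fst p)) has_derivative (\<lambda>h. frechet_derivative (d b) (at x) (fst h))) (at (x, v))"
        by (rule has_derivative_compose[OF bounded_linear_imp_has_derivative[OF bounded_linear_fst]])
           (simp add: d')
      show "((\<lambda>p. (snd p \<bullet> b) *\<^sub>R d b (fst p)) has_derivative
          (\<lambda>h. (v \<bullet> b) *\<^sub>R frechet_derivative (d b) (at x) (fst h) + (snd h \<bullet> b) *\<^sub>R d b x)) (at (x, v))"
        using has_derivative_scaleR[OF A B] by simp
    qed
    have "frechet_derivative (d v) (at x) a =
        (\<Sum>b\<in>Basis. (v \<bullet> b) *\<^sub>R frechet_derivative (d b) (at x) a)" for a
    proof -
      have "((\<lambda>x. \<Sum>b\<in>Basis. (v \<bullet> b) *\<^sub>R d b x) has_derivative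
          (\<lambda>a. \<Sum>b\<in>Basis. (v \<bullet> b) *\<^sub>R frechet_derivative (d b) (at x) a)) (at x)"
        by (intro has_derivative_sum has_derivative_scaleR_right d')
      then have "(d v has_derivative
          (\<lambda>a. \<Sum>b\<in>Basis. (v \<bullet> b) *\<^sub>R frechet_derivative (d b) (at x) a)) (at x)"
        by (rule has_derivative_transform_within_open[OF _ S x]) (simp add: exp)
      from fun_cong[OF frechet_derivative_at[OF this], of a] show ?thesis by simp
    qed
    then have rhs: "(\<lambda>h. \<Sum>b\<in>Basis. (v \<bullet> b) *\<^sub>R frechet_derivative (d b) (at x) (fst h)
          + (snd h \<bullet> b) *\<^sub>R d b x) = (\<lambda>(a, b). frechet_derivative (d v) (at x) a + d b x)"
      by (simp add: fun_eq_iff sum.distrib exp[OF x, symmetric])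
    from G have "(g has_derivative
        (\<lambda>(a, b). frechet_derivative (d v) (at x) a + d b x)) (at (x, v))"
      unfolding rhs .
    then show ?thesis
      by (rule has_derivative_transform_within_open[of _ _ _ _ "S \<times> UNIV"])
         (use S x exp in \<open>auto simp: open_Times g_def\<close>)
  qed
  from der show "x \<in> S \<Longrightarrow>
      ((\<lambda>(x, v). frechet_derivative f (at x) v) has_derivative
        (\<lambda>(a, b). frechet_derivative (\<lambda>x. frechet_derivative f (at x) v) (at x) a
                 + frechet_derivative f (at x) b)) (at (x, v))"
    unfolding d_def .
  have "C1_on (S \<times> UNIV) (\<lambda>(x, v). d v x)"
  proof -
    obtain g' where g': "\<And>x. x \<in> S \<times> UNIV \<Longrightarrow> (g has_derivative blinfun_apply (g' x)) (at x)"
      and cg: "continuous_on (S \<times> UNIV) g'"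
      using \<open>C1_on (S \<times> UNIV) g\<close> unfolding C1_on_def by auto
    have "((\<lambda>(x, v). d v x) has_derivative blinfun_apply (g' p)) (at p)" if "p \<in> S \<times> UNIV" for p
      by (rule has_derivative_transform_within_open[OF g'[OF that], of "S \<times> UNIV"])
         (use S that exp in \<open>auto simp: open_Times g_def\<close>)
    with cg show ?thesis unfolding C1_on_def by (intro exI[of _ g'] conjI ballI)
  qed
  then show "C1_on (S \<times> UNIV) (\<lambda>(x, v). frechet_derivative f (at x) v)"
    unfolding d_def .
qed

lemma vector_mean_value:
  fixes f :: "real \<Rightarrow> 'b::real_normed_vector"
  assumes "convex T" "\<And>t. t \<in> T \<Longrightarrow> (f has_vector_derivative f' t) (at t within T)"
    and "\<And>t. t \<in> T \<Longrightarrow> norm (f' t) \<le> B" and "x \<in> T" "y \<in> T"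
  shows "norm (f x - f y) \<le> B * \<bar>x - y\<bar>"
proof -
  have "norm (f x - f y) \<le> B * norm (x - y)"
  proof (rule differentiable_bound[OF assms(1) _ _ assms(4,5)])
    show "(f has_derivative (\<lambda>h. h *\<^sub>R f' t)) (at t within T)" if "t \<in> T" for t
      using assms(2)[OF that] by (simp add: has_vector_derivative_def)
    show "onorm (\<lambda>h. h *\<^sub>R f' t) \<le> B" if "t \<in> T" for t
      by (rule onorm_le) (use assms(3)[OF that] in \<open>simp add: mult.commute[of B] mult_left_mono\<close>)
  qed
  then show ?thesis by simp
qed

lemma C1_on_line_derivative:
  assumes "C1_on S f" "y + t *\<^sub>R v \<in> S"
  shows "((\<lambda>t. f (y + t *\<^sub>R v)) has_vector_derivative
    frechet_derivative f (at (y + t *\<^sub>R v)) v) (at t within T)"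
proof -
  have "((\<lambda>t. y + t *\<^sub>R v) has_vector_derivative v) (at t within T)"
    by (auto intro!: derivative_eq_intros)
  from vector_derivative_diff_chain_within[OF this
      has_derivative_at_withinI[OF C1_on_has_derivative[OF assms]]]
  show ?thesis by (simp add: o_def)
qed

text \<open>
  Both orders of differentiation are limits of the same second difference
  \<open>f(x + hu + hv) - f(x + hu) - f(x + hv) + f(x)\<close>, divided by \<open>h\<^sup>2\<close>.
\<close>

lemma second_difference_bound:
  fixes f :: "'a::euclidean_space \<Rightarrow> 'b::euclidean_space"
  assumes f: "smooth_on S f" and S: "open S" and x: "x \<in> S" and e: "e > 0"
  shows "\<forall>\<^sub>F h in at_right 0. norm (f (x + h *\<^sub>R u + h *\<^sub>R v) - f (x + h *\<^sub>R u) - f (x + h *\<^sub>R v) + f x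
      - (h * h) *\<^sub>R frechet_derivative (\<lambda>x. frechet_derivative f (at x) u) (at x) v) \<le> e * (h * h)"
proof -
  define d where "d = (\<lambda>x. frechet_derivative f (at x) u)"
  define dd where "dd = (\<lambda>x. frechet_derivative d (at x) v)"
  have f1: "C1_on S f" using smooth_on_C1[OF f S] .
  have sd: "smooth_on S d" unfolding d_def by (rule smooth_on_derivative[OF f])
  have d1: "C1_on S d" using smooth_on_C1[OF sd S] .
  have "continuous_on S dd" unfolding dd_def by (rule C1_on_frechet_continuous[OF d1])
  then have "isCont dd x" using S x continuous_on_eq_continuous_at by blast
  then have "\<forall>\<^sub>F y in nhds x. dist (dd y) (dd x) < e"
    using e by (metis continuous_at tendsto_at_iff_tendsto_nhds tendstoD)
  then have "\<forall>\<^sub>F y in nhds x. y \<in> S \<and> dist (dd y) (dd x) < e"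
    using eventually_nhds_in_open[OF S x] by eventually_elim auto
  then obtain r where r: "r > 0" "\<And>y. dist y x < r \<Longrightarrow> y \<in> S \<and> dist (dd y) (dd x) < e"
    unfolding eventually_nhds_metric by blast
  define \<eta> where "\<eta> = r / (norm u + norm v + 1)"
  have pos: "norm u + norm v + 1 > 0" by (smt (verit) norm_ge_zero)
  have \<eta>: "\<eta> > 0" using r(1) pos by (simp add: \<eta>_def)
  have "norm (f (x + h *\<^sub>R u + h *\<^sub>R v) - f (x + h *\<^sub>R u) - f (x + h *\<^sub>R v) + f x
      - (h * h) *\<^sub>R dd x) \<le> e * (h * h)" if h: "0 < h" "h < \<eta>" for h
  proof -
    have near: "dist (x + s *\<^sub>R u + t *\<^sub>R v) x < r" if "s \<in> {0..h}" "t \<in> {0..h}" for s t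
    proof -
      have "norm (s *\<^sub>R u + t *\<^sub>R v) \<le> s * norm u + t * norm v"
        using norm_triangle_ineq[of "s *\<^sub>R u" "t *\<^sub>R v"] that by auto
      also have "\<dots> \<le> h * norm u + h * norm v"
        using that by (intro add_mono mult_right_mono) auto
      also have "\<dots> < h * (norm u + norm v + 1)" using h by (simp add: algebra_simps)
      also have "\<dots> < \<eta> * (norm u + norm v + 1)" using h pos by (intro mult_strict_right_mono) auto
      also have "\<dots> = r" using pos by (simp add: \<eta>_def)
      finally show ?thesis by (simp add: dist_norm add.assoc)
    qed
    note inS = r(2)[OF near, THEN conjunct1] and close = r(2)[OF near, THEN conjunct2]
    have hh: "0 \<in> {0..h}" "h \<in> {0..h}" using h by auto
    have inner: "norm (d (x + s *\<^sub>R u + h *\<^sub>R v) - d (x + s *\<^sub>R u) - h *\<^sub>R dd x) \<le> e * h"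
      if s: "s \<in> {0..h}" for s
    proof -
      define k where "k = (\<lambda>t. d (x + s *\<^sub>R u + t *\<^sub>R v) - t *\<^sub>R dd x)"
      have k': "(k has_vector_derivative dd (x + s *\<^sub>R u + t *\<^sub>R v) - dd x) (at t within {0..h})"
        if "t \<in> {0..h}" for t
        unfolding k_def dd_def using C1_on_line_derivative[OF d1 inS[OF s that]]
        by (auto intro!: derivative_eq_intros)
      have "norm (k h - k 0) \<le> e * \<bar>h - 0\<bar>"
        by (rule vector_mean_value[OF _ k'])
           (use hh close[OF s] in \<open>auto simp: dist_norm less_imp_le\<close>)
      then show ?thesis using h by (simp add: k_def algebra_simps)
    qed
    define m where "m = (\<lambda>s. f (x + s *\<^sub>R u + h *\<^sub>R v) - f (x + s *\<^sub>R u) - (s * h) *\<^sub>R dd x)"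
    have m': "(m has_vector_derivative
        d (x + s *\<^sub>R u + h *\<^sub>R v) - d (x + s *\<^sub>R u) - h *\<^sub>R dd x) (at s within {0..h})"
      if s: "s \<in> {0..h}" for s
    proof -
      have eq: "x + s *\<^sub>R u + h *\<^sub>R v = (x + h *\<^sub>R v) + s *\<^sub>R u" for s by simp
      have "(x + h *\<^sub>R v) + s *\<^sub>R u \<in> S" "x + s *\<^sub>R u \<in> S"
        using inS[OF s hh(2)] inS[OF s hh(1)] by (simp_all add: eq)
      from this[THEN C1_on_line_derivative[OF f1]] show ?thesis
        unfolding m_def d_def eq by (auto intro!: derivative_eq_intros)
    qed
    have "norm (m h - m 0) \<le> (e * h) * \<bar>h - 0\<bar>"
      by (rule vector_mean_value[OF _ m']) (use hh inner in auto)
    then show ?thesis using h by (simp add: m_def algebra_simps)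
  qed
  then show ?thesis
    unfolding eventually_at_right_field using \<eta> by (auto simp: dd_def d_def)
qed

lemma second_derivative_symmetric:
  fixes f :: "'a::euclidean_space \<Rightarrow> 'b::euclidean_space"
  assumes f: "smooth_on S f" and S: "open S" and x: "x \<in> S"
  shows "frechet_derivative (\<lambda>x. frechet_derivative f (at x) u) (at x) v =
    frechet_derivative (\<lambda>x. frechet_derivative f (at x) v) (at x) u" (is "?a = ?b")
proof (rule ccontr)
  assume ne: "?a \<noteq> ?b"
  define e where "e = norm (?a - ?b) / 3"
  have e: "e > 0" using ne by (simp add: e_def)
  have "\<forall>\<^sub>F h::real in at_right 0. norm (?a - ?b) \<le> 2 * e"
    using second_difference_bound[OF f S x e, of u v] second_difference_bound[OF f S x e, of v u]
      eventually_at_right_less[of "0::real"]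
  proof eventually_elim
    case (elim h)
    let ?\<Delta> = "f (x + h *\<^sub>R u + h *\<^sub>R v) - f (x + h *\<^sub>R u) - f (x + h *\<^sub>R v) + f x"
    have "norm (?\<Delta> - (h * h) *\<^sub>R ?a) \<le> e * (h * h)" using elim by simp
    moreover have "norm (?\<Delta> - (h * h) *\<^sub>R ?b) \<le> e * (h * h)"
    proof -
      have "x + h *\<^sub>R v + h *\<^sub>R u = x + h *\<^sub>R u + h *\<^sub>R v" by simp
      then have "f (x + h *\<^sub>R v + h *\<^sub>R u) - f (x + h *\<^sub>R v) - f (x + h *\<^sub>R u) + f x = ?\<Delta>"
        by (simp only: algebra_simps)
      then show ?thesis using elim(2) by (simp only:)
    qed
    ultimately have "norm ((?\<Delta> - (h * h) *\<^sub>R ?b) - (?\<Delta> - (h * h) *\<^sub>R ?a)) \<le> 2 * e * (h * h)"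
      using norm_triangle_ineq4[of "?\<Delta> - (h * h) *\<^sub>R ?b" "?\<Delta> - (h * h) *\<^sub>R ?a"] by linarith
    then have "norm ((h * h) *\<^sub>R (?a - ?b)) \<le> 2 * e * (h * h)"
      by (simp add: algebra_simps)
    then show ?case using elim(3) by simp
  qed
  then have "norm (?a - ?b) \<le> 2 * e" by simp
  then show False using e by (simp add: e_def)
qed


section \<open>Ordinary differential equations\<close>

lemma has_vector_derivative_imp_continuous_on:
  assumes "\<And>t. t \<in> T \<Longrightarrow> (f has_vector_derivative f' t) (at t within T)"
  shows "continuous_on T f"
  unfolding continuous_on_eq_continuous_within
  using has_vector_derivative_continuous[OF assms] by blast

text \<open>
  Over a time so short that \<open>L T \<le> 1/2\<close>, the mean value inequality applied at a point where
  \<open>norm e\<close> is maximal absorbs half of that maximum; this does the work of Gronwall's inequality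
  without exponentials.
\<close>

lemma short_time_bound:
  fixes e :: "real \<Rightarrow> 'a::real_normed_vector"
  assumes T: "T \<ge> 0" and LT: "L * T \<le> 1 / 2" and L: "L \<ge> 0" and K: "K \<ge> 0"
    and e': "\<And>t. t \<in> {-T..T} \<Longrightarrow> (e has_vector_derivative e' t) (at t within {-T..T})"
    and le: "\<And>t. t \<in> {-T..T} \<Longrightarrow> norm (e' t) \<le> L * norm (e t) + K"
    and t: "t \<in> {-T..T}"
  shows "norm (e t) \<le> 2 * (norm (e 0) + T * K)"
proof -
  have "continuous_on {-T..T} (\<lambda>t. norm (e t))"
    by (intro continuous_on_norm has_vector_derivative_imp_continuous_on[OF e'])
  then obtain s where s: "s \<in> {-T..T}" "\<And>t. t \<in> {-T..T} \<Longrightarrow> norm (e t) \<le> norm (e s)"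
    using continuous_attains_sup[of "{-T..T}" "\<lambda>t. norm (e t)"] T by auto
  define m where "m = norm (e s)"
  have "norm (e s - e 0) \<le> (L * m + K) * \<bar>s - 0\<bar>"
  proof (rule vector_mean_value[OF _ e'])
    fix t assume t: "t \<in> {-T..T}"
    show "norm (e' t) \<le> L * m + K"
      using le[OF t] mult_left_mono[OF s(2)[OF t] L] by (simp add: m_def)
  qed (use s T in auto)
  also have "\<dots> \<le> (L * m + K) * T"
    using s(1) L K by (intro mult_left_mono) (auto simp: m_def)
  also have "\<dots> \<le> m / 2 + T * K"
    using mult_right_mono[OF LT, of m] by (simp add: m_def algebra_simps)
  finally have "m \<le> norm (e 0) + m / 2 + T * K"
    using norm_triangle_ineq2[of "e s" "e 0"] by (simp add: m_def)
  then show ?thesis using s(2)[OF t] by (simp add: m_def)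
qed

text \<open>
  The Picard operator is a contraction of the complete space of continuous maps on the line into
  the ball, an argument outside \<open>[-T, T]\<close> being replaced by the nearest point of that interval.
\<close>

lemma picard_lindelof:
  fixes f :: "real \<Rightarrow> 'a::banach \<Rightarrow> 'a"
  assumes T: "T > 0" and r: "r \<ge> 0"
    and cont: "continuous_on ({-T..T} \<times> cball z0 r) (\<lambda>(t, z). f t z)"
    and bnd: "\<And>t z. t \<in> {-T..T} \<Longrightarrow> z \<in> cball z0 r \<Longrightarrow> norm (f t z) \<le> B"
    and lip: "\<And>t z z'. t \<in> {-T..T} \<Longrightarrow> z \<in> cball z0 r \<Longrightarrow> z' \<in> cball z0 r \<Longrightarrow>
      norm (f t z - f t z') \<le> L * norm (z - z')"
    and B: "B \<ge> 0" and L: "L \<ge> 0" and BT: "B * T \<le> r" and LT: "L * T \<le> 1 / 2"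
  obtains z where "z 0 = z0"
    and "\<And>t. t \<in> {-T..T} \<Longrightarrow> z t \<in> cball z0 r"
    and "\<And>t. t \<in> {-T..T} \<Longrightarrow> (z has_vector_derivative f t (z t)) (at t within {-T..T})"
proof -
  define S :: "(real \<Rightarrow>\<^sub>C 'a) set" where "S = PiC UNIV (\<lambda>_. cball z0 r)"
  define J where "J = (\<lambda>(\<phi>::real \<Rightarrow>\<^sub>C 'a) t. z0 + (integral {-T..t} (\<lambda>s. f s (\<phi> s)) - integral {-T..0} (\<lambda>s. f s (\<phi> s))))"
  define cl where "cl = (\<lambda>t::real. max (-T) (min T t))"
  have cl: "cl t \<in> {-T..T}" for t using T by (auto simp: cl_def)
  have clid: "cl t = t" if "t \<in> {-T..T}" for t using that by (auto simp: cl_def)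
  have S_ball: "\<phi> \<in> S \<Longrightarrow> apply_bcontfun \<phi> t \<in> cball z0 r" for \<phi> t
    by (auto simp: S_def mem_PiC_iff)
  have zero: "0 \<in> {-T..T}" using T by simp
  have J': "(J \<phi> has_vector_derivative f t (\<phi> t)) (at t within {-T..T})"
    if "\<phi> \<in> S" "t \<in> {-T..T}" for \<phi> t
  proof -
    have "continuous_on {-T..T} (\<lambda>s. (s, apply_bcontfun \<phi> s))"
      by (intro continuous_intros continuous_on_apply_bcontfun)
    then have "continuous_on {-T..T} (\<lambda>s. f s (\<phi> s))"
      using continuous_on_compose2[OF cont, of "{-T..T}" "\<lambda>s. (s, \<phi> s)"] S_ball[OF that(1)]
      by (simp add: image_subset_iff)
    from integral_has_vector_derivative[OF this that(2)] show ?thesis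
      unfolding J_def by (auto intro!: derivative_eq_intros)
  qed
  have J0: "J \<phi> 0 = z0" for \<phi> by (simp add: J_def)
  have Jball: "J \<phi> t \<in> cball z0 r" if "\<phi> \<in> S" "t \<in> {-T..T}" for \<phi> t
  proof -
    have "norm (J \<phi> t - J \<phi> 0) \<le> B * \<bar>t - 0\<bar>"
      by (rule vector_mean_value[OF _ J'[OF that(1)]])
         (use bnd S_ball[OF that(1)] that zero in auto)
    also have "\<dots> \<le> B * T" using that(2) B by (intro mult_left_mono) auto
    finally show ?thesis using BT by (simp add: J0 dist_norm norm_minus_commute)
  qed
  define P where "P = (\<lambda>\<phi>. Bcontfun (\<lambda>t. J \<phi> (cl t)))"
  have P_apply: "apply_bcontfun (P \<phi>) t = J \<phi> (cl t)" if "\<phi> \<in> S" for \<phi> t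
  proof -
    have "continuous_on {-T..T} (J \<phi>)"
      by (rule has_vector_derivative_imp_continuous_on[OF J'[OF that]])
    then have "continuous_on UNIV (\<lambda>t. J \<phi> (cl t))"
      by (rule continuous_on_compose2) (use cl in \<open>auto simp: cl_def intro!: continuous_intros\<close>)
    moreover have "norm (J \<phi> (cl t)) \<le> norm z0 + r" for t
      using Jball[OF that cl[of t]] norm_triangle_ineq2[of "J \<phi> (cl t)" z0]
      by (simp add: dist_norm norm_minus_commute)
    ultimately have "(\<lambda>t. J \<phi> (cl t)) \<in> bcontfun" by (rule bcontfun_normI)
    then show ?thesis by (simp add: P_def Bcontfun_inverse)
  qed
  have "\<exists>!\<phi>. \<phi> \<in> S \<and> P \<phi> = \<phi>"
  proof (rule Banach_fix)
    show "complete S" unfolding S_def by (simp add: complete_eq_closed closed_PiC)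
    have "const_bcontfun z0 \<in> S" using r by (auto simp: S_def mem_PiC_iff)
    then show "S \<noteq> {}" by auto
    show "P ` S \<subseteq> S" using P_apply Jball cl by (auto simp: S_def mem_PiC_iff)
    show "dist (P \<phi>) (P \<psi>) \<le> 1 / 2 * dist \<phi> \<psi>" if "\<phi> \<in> S" "\<psi> \<in> S" for \<phi> \<psi>
    proof (rule dist_bound)
      fix t
      let ?D = "\<lambda>t. J \<phi> t - J \<psi> t"
      have "norm (?D (cl t) - ?D 0) \<le> (L * dist \<phi> \<psi>) * \<bar>cl t - 0\<bar>"
      proof (rule vector_mean_value)
        fix s assume s: "s \<in> {-T..T}"
        show "(?D has_vector_derivative f s (\<phi> s) - f s (\<psi> s)) (at s within {-T..T})"
          by (intro has_vector_derivative_diff J' that s)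
        have "norm (f s (\<phi> s) - f s (\<psi> s)) \<le> L * norm (\<phi> s - \<psi> s)"
          by (intro lip s S_ball that)
        also have "\<dots> \<le> L * dist \<phi> \<psi>"
          using dist_bounded[of \<phi> s \<psi>] L by (intro mult_left_mono) (auto simp: dist_norm)
        finally show "norm (f s (\<phi> s) - f s (\<psi> s)) \<le> L * dist \<phi> \<psi>" .
      qed (use cl zero in auto)
      also have "\<dots> \<le> (L * dist \<phi> \<psi>) * T"
        using cl[of t] L by (intro mult_left_mono) auto
      also have "\<dots> \<le> 1 / 2 * dist \<phi> \<psi>"
        using mult_right_mono[OF LT zero_le_dist[of \<phi> \<psi>]] by (simp add: algebra_simps)
      finally show "dist (P \<phi> t) (P \<psi> t) \<le> 1 / 2 * dist \<phi> \<psi>"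
        using that by (simp add: P_apply J0 dist_norm)
    qed
  qed auto
  then obtain \<phi> where \<phi>: "\<phi> \<in> S" "P \<phi> = \<phi>" by auto
  have eq: "\<phi> t = J \<phi> t" if "t \<in> {-T..T}" for t
    using P_apply[OF \<phi>(1), of t] \<phi>(2) clid[OF that] by simp
  show thesis
  proof (rule that)
    show "\<phi> 0 = z0" using eq[OF zero] J0 by simp
    show "\<phi> t \<in> cball z0 r" for t by (rule S_ball[OF \<phi>(1)])
    show "(\<phi> has_vector_derivative f t (\<phi> t)) (at t within {-T..T})" if "t \<in> {-T..T}" for t
      by (rule has_vector_derivative_transform[OF that eq J'[OF \<phi>(1) that]])
  qed
qed

text \<open>
  For a linear equation the Lipschitz constant does not depend on the radius of the ball, so radius 1
  will do.
\<close>

lemma linear_ode_exists: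
  fixes A :: "real \<Rightarrow> 'a::banach \<Rightarrow>\<^sub>L 'a"
  assumes T: "T > 0" and A: "continuous_on {-T..T} A" and b: "continuous_on {-T..T} b"
  obtains T' z where "0 < T'" "T' \<le> T" "z 0 = z0"
    and "\<And>t. t \<in> {-T'..T'} \<Longrightarrow> (z has_vector_derivative A t (z t) + b t) (at t within {-T'..T'})"
proof -
  have "bounded (A ` {-T..T})" "bounded (b ` {-T..T})"
    using compact_continuous_image[OF A compact_Icc] compact_continuous_image[OF b compact_Icc]
    by (simp_all add: compact_imp_bounded)
  then obtain K K' where K: "K > 0" "\<And>t. t \<in> {-T..T} \<Longrightarrow> norm (A t) \<le> K"
    and K': "K' > 0" "\<And>t. t \<in> {-T..T} \<Longrightarrow> norm (b t) \<le> K'"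
    unfolding bounded_pos by (metis imageI)
  define B where "B = K * (norm z0 + 1) + K'"
  have "K * (norm z0 + 1) > 0" using K(1) by (simp add: add_nonneg_pos)
  then have B: "B > 0" using K'(1) by (simp add: B_def)
  define T' where "T' = min T (min (1 / B) (1 / (2 * K)))"
  have T': "0 < T'" "T' \<le> T" using T B K(1) by (auto simp: T'_def)
  have "B * T' \<le> B * (1 / B)" "K * T' \<le> K * (1 / (2 * K))"
    unfolding T'_def using B K(1) by (intro mult_left_mono; simp)+
  then have small: "B * T' \<le> 1" "K * T' \<le> 1 / 2" using B K(1) by auto
  have sub: "{-T'..T'} \<subseteq> {-T..T}" using T' by auto
  have cA: "continuous_on {-T'..T'} A" and cb: "continuous_on {-T'..T'} b"
    using continuous_on_subset[OF A sub] continuous_on_subset[OF b sub] .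
  show thesis
  proof (rule picard_lindelof[of T' 1 z0 "\<lambda>t z. A t z + b t" B K])
    have "continuous_on ({-T'..T'} \<times> cball z0 1) (\<lambda>p. A (fst p) (snd p) + b (fst p))"
      by (intro continuous_intros continuous_on_compose2[OF cA continuous_on_fst[OF continuous_on_id]]
          continuous_on_compose2[OF cb continuous_on_fst[OF continuous_on_id]]) auto
    then show "continuous_on ({-T'..T'} \<times> cball z0 1) (\<lambda>(t, z). A t z + b t)"
      by (simp add: case_prod_beta)
    show "norm (A t z + b t) \<le> B" if "t \<in> {-T'..T'}" "z \<in> cball z0 1" for t z
    proof -
      have t: "t \<in> {-T..T}" using that sub by auto
      have "norm z \<le> norm z0 + 1"
        using that(2) norm_triangle_ineq2[of z z0] by (simp add: dist_norm norm_minus_commute)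
      then have "norm (A t) * norm z \<le> K * (norm z0 + 1)"
        using K(1) by (intro mult_mono K(2)[OF t]) auto
      then show ?thesis
        using norm_blinfun[of "A t" z] norm_triangle_ineq[of "A t z" "b t"] K'(2)[OF t]
        by (simp add: B_def)
    qed
    show "norm (A t z + b t - (A t z' + b t)) \<le> K * norm (z - z')"
      if "t \<in> {-T'..T'}" for t z z'
    proof -
      have "norm (A t) * norm (z - z') \<le> K * norm (z - z')"
        using that sub by (intro mult_right_mono K(2)) auto
      then show ?thesis using norm_blinfun[of "A t" "z - z'"] by (simp add: blinfun.diff_right)
    qed
  qed (use T' B K small that in auto)
qed

text \<open>
  Solutions that start at \<open>z0 + s u\<close> exist over a common time interval, and their derivative in \<open>s\<close>
  is the solution \<open>\<zeta>\<close> of the variational equation: the error \<open>Z s - Z 0 - s \<zeta>\<close> satisfies the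
  variational equation up to the linearisation error of \<open>f\<close>, which is \<open>o(s)\<close> because the
  derivative of \<open>f\<close> is uniformly continuous on a compact ball.
\<close>

lemma flow_differentiable_in_initial_value:
  fixes f :: "'a::euclidean_space \<Rightarrow> 'a"
  assumes f: "C1_on S f" and S: "open S" and z0: "z0 \<in> S"
  obtains T \<delta> Z \<zeta> where "T > 0" "\<delta> > 0"
    and "\<And>s. \<bar>s\<bar> < \<delta> \<Longrightarrow> Z s 0 = z0 + s *\<^sub>R u"
    and "\<And>s t. \<bar>s\<bar> < \<delta> \<Longrightarrow> t \<in> {-T..T} \<Longrightarrow> Z s t \<in> S"
    and "\<And>s t. \<bar>s\<bar> < \<delta> \<Longrightarrow> t \<in> {-T..T} \<Longrightarrow>
      (Z s has_vector_derivative f (Z s t)) (at t within {-T..T})"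
    and "\<zeta> 0 = u"
    and "\<And>t. t \<in> {-T..T} \<Longrightarrow>
      (\<zeta> has_vector_derivative frechet_derivative f (at (Z 0 t)) (\<zeta> t)) (at t within {-T..T})"
    and "\<And>t. t \<in> {-T..T} \<Longrightarrow> ((\<lambda>s. Z s t) has_vector_derivative \<zeta> t) (at 0)"
proof -
  obtain f' where f': "\<And>x. x \<in> S \<Longrightarrow> (f has_derivative blinfun_apply (f' x)) (at x)"
    and cf': "continuous_on S f'"
    using f[unfolded C1_on_def] by auto
  have Df: "frechet_derivative f (at x) = blinfun_apply (f' x)" if "x \<in> S" for x
    using frechet_derivative_at[OF f'[OF that]] by simp
  obtain r where r: "r > 0" "cball z0 r \<subseteq> S"
    using S z0 open_contains_cball by blast
  let ?K = "cball z0 r"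
  have cf: "continuous_on ?K f" using C1_on_continuous[OF C1_on_subset[OF f r(2)]] .
  have cf'K: "continuous_on ?K f'" using continuous_on_subset[OF cf' r(2)] .
  have "bounded (f ` ?K)" "bounded (f' ` ?K)"
    using compact_continuous_image[OF cf compact_cball] compact_continuous_image[OF cf'K compact_cball]
    by (simp_all add: compact_imp_bounded)
  then obtain B L where B: "B > 0" "\<And>x. x \<in> ?K \<Longrightarrow> norm (f x) \<le> B"
    and L: "L > 0" "\<And>x. x \<in> ?K \<Longrightarrow> norm (f' x) \<le> L"
    unfolding bounded_pos by (metis imageI)
  have lip: "norm (f x - f y) \<le> L * norm (x - y)" if "x \<in> ?K" "y \<in> ?K" for x y
    by (rule differentiable_bound[OF convex_cball has_derivative_at_withinI[OF f'] _ that])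
       (use L(2) r(2) in \<open>auto simp: norm_blinfun.rep_eq[symmetric]\<close>)
  have linearise: "\<exists>\<rho>>0. \<forall>x\<in>?K. \<forall>y\<in>?K. norm (x - y) \<le> \<rho> \<longrightarrow>
      norm (f x - f y - f' y (x - y)) \<le> \<eta> * norm (x - y)" if \<eta>: "\<eta> > 0" for \<eta>
  proof -
    have "uniformly_continuous_on ?K f'"
      by (rule compact_uniformly_continuous[OF cf'K compact_cball])
    then obtain \<rho> where \<rho>: "\<rho> > 0"
      "\<And>x y. x \<in> ?K \<Longrightarrow> y \<in> ?K \<Longrightarrow> dist x y < \<rho> \<Longrightarrow> dist (f' x) (f' y) < \<eta>"
      unfolding uniformly_continuous_on_def using \<eta> by (metis dist_commute)
    have "norm (f x - f y - f' y (x - y)) \<le> \<eta> * norm (x - y)"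
      if xy: "x \<in> ?K" "y \<in> ?K" "norm (x - y) \<le> \<rho> / 2" for x y
    proof -
      let ?C = "?K \<inter> cball y (\<rho> / 2)"
      have cv: "convex ?C" by (intro convex_Int convex_cball)
      have yC: "y \<in> ?C" and xC: "x \<in> ?C"
        using xy \<rho>(1) by (auto simp: dist_norm norm_minus_commute)
      have "norm (f x - f y - f' y (x - y)) \<le> norm (x - y) * \<eta>"
      proof (rule differentiable_bound_linearization[where S = ?C and f' = "\<lambda>w. blinfun_apply (f' w)"])
        fix t :: real assume t: "t \<in> {0..1}"
        have "y + t *\<^sub>R (x - y) = (1 - t) *\<^sub>R y + t *\<^sub>R x" by (simp add: algebra_simps)
        also have "\<dots> \<in> ?C" using convexD[OF cv yC xC, of "1 - t" t] t by auto
        finally show "y + t *\<^sub>R (x - y) \<in> ?C" .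
      next
        fix w assume w: "w \<in> ?C"
        then have "w \<in> S" using r(2) by auto
        then show "(f has_derivative blinfun_apply (f' w)) (at w within ?C)"
          by (rule has_derivative_at_withinI[OF f'])
        have "dist w y < \<rho>" using w \<rho>(1) by (simp add: dist_commute)
        then have "dist (f' w) (f' y) < \<eta>" using \<rho>(2)[of w y] w xy(2) by auto
        then have "norm (f' w - f' y) \<le> \<eta>" by (simp add: dist_norm)
        moreover have "blinfun_apply (f' w) - blinfun_apply (f' y) = blinfun_apply (f' w - f' y)"
          by (simp add: fun_eq_iff minus_blinfun.rep_eq)
        ultimately show "onorm (blinfun_apply (f' w) - blinfun_apply (f' y)) \<le> \<eta>"
          by (simp add: norm_blinfun.rep_eq)
      qed (rule yC)
      then show ?thesis by (simp add: mult.commute)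
    qed
    then show ?thesis using \<rho>(1) by (intro exI[of _ "\<rho> / 2"]) auto
  qed
  define \<delta> where "\<delta> = r / 2 / (norm u + 1)"
  have \<delta>: "\<delta> > 0" using r(1) by (simp add: \<delta>_def add_nonneg_pos)
  have start: "cball (z0 + s *\<^sub>R u) (r / 2) \<subseteq> ?K" if "\<bar>s\<bar> < \<delta>" for s
  proof -
    have "\<bar>s\<bar> * norm u \<le> \<delta> * (norm u + 1)" using that \<delta> by (intro mult_mono) auto
    also have "\<dots> = r / 2"
      using add_nonneg_pos[OF norm_ge_zero zero_less_one, of u]
      unfolding \<delta>_def by (metis nonzero_eq_divide_eq less_irrefl)
    finally have "dist z0 (z0 + s *\<^sub>R u) \<le> r / 2" by (simp add: dist_norm)
    then show ?thesis
    proof (intro subsetI)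
      fix x assume "x \<in> cball (z0 + s *\<^sub>R u) (r / 2)"
      then have "dist (z0 + s *\<^sub>R u) x \<le> r / 2" by (simp only: mem_cball)
      then show "x \<in> ?K"
        using dist_triangle[of z0 x "z0 + s *\<^sub>R u"] \<open>dist z0 _ \<le> _\<close> unfolding mem_cball by linarith
    qed
  qed
  define T where "T = min (r / 2 / B) (1 / (2 * L))"
  have T: "T > 0" using r(1) B(1) L(1) by (simp add: T_def)
  have "B * T \<le> B * (r / 2 / B)" "L * T \<le> L * (1 / (2 * L))"
    unfolding T_def using B(1) L(1) by (intro mult_left_mono; simp)+
  then have BT: "B * T \<le> r / 2" and LT: "L * T \<le> 1 / 2" using B(1) L(1) by auto
  have "\<exists>z. z 0 = z0 + s *\<^sub>R u \<and> (\<forall>t\<in>{-T..T}. z t \<in> ?K \<and>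
      (z has_vector_derivative f (z t)) (at t within {-T..T}))" if s: "\<bar>s\<bar> < \<delta>" for s
  proof (rule picard_lindelof[of T "r / 2" "z0 + s *\<^sub>R u" "\<lambda>_. f" B L])
    have "continuous_on ({-T..T} \<times> cball (z0 + s *\<^sub>R u) (r / 2)) (\<lambda>p. f (snd p))"
      by (rule continuous_on_compose2[OF cf]) (use start[OF s] in \<open>auto intro: continuous_intros\<close>)
    then show "continuous_on ({-T..T} \<times> cball (z0 + s *\<^sub>R u) (r / 2)) (\<lambda>(t, z). f z)"
      by (simp add: case_prod_beta)
    fix z assume "z 0 = z0 + s *\<^sub>R u"
      "\<And>t. t \<in> {-T..T} \<Longrightarrow> z t \<in> cball (z0 + s *\<^sub>R u) (r / 2)"
      "\<And>t. t \<in> {-T..T} \<Longrightarrow> (z has_vector_derivative f (z t)) (at t within {-T..T})"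
    then show ?thesis using start[OF s] by (intro exI[of _ z]) blast
  qed (use T r(1) B L BT LT start[OF s] lip in \<open>auto simp: subset_iff\<close>)
  then have "\<exists>Z. \<forall>s. \<bar>s\<bar> < \<delta> \<longrightarrow> Z s 0 = z0 + s *\<^sub>R u \<and> (\<forall>t\<in>{-T..T}. Z s t \<in> ?K \<and>
      (Z s has_vector_derivative f (Z s t)) (at t within {-T..T}))"
    by (intro choice allI) blast
  then obtain Z where Z0: "\<And>s. \<bar>s\<bar> < \<delta> \<Longrightarrow> Z s 0 = z0 + s *\<^sub>R u"
    and ZK: "\<And>s t. \<bar>s\<bar> < \<delta> \<Longrightarrow> t \<in> {-T..T} \<Longrightarrow> Z s t \<in> ?K"
    and Z': "\<And>s t. \<bar>s\<bar> < \<delta> \<Longrightarrow> t \<in> {-T..T} \<Longrightarrow>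
      (Z s has_vector_derivative f (Z s t)) (at t within {-T..T})"
    by (elim exE) blast
  have d0: "\<bar>0\<bar> < \<delta>" using \<delta> by simp
  have "continuous_on {-T..T} (Z 0)"
    by (rule has_vector_derivative_imp_continuous_on[OF Z'[OF d0]])
  then have "continuous_on {-T..T} (\<lambda>t. f' (Z 0 t))"
    by (rule continuous_on_compose2[OF cf'K]) (use ZK[OF d0] in blast)
  then obtain T' \<zeta> where T': "0 < T'" "T' \<le> T" and \<zeta>0: "\<zeta> 0 = u"
    and \<zeta>': "\<And>t. t \<in> {-T'..T'} \<Longrightarrow>
      (\<zeta> has_vector_derivative f' (Z 0 t) (\<zeta> t) + 0) (at t within {-T'..T'})"
    using linear_ode_exists[OF T, of "\<lambda>t. f' (Z 0 t)" "\<lambda>_. 0" u] continuous_on_const by blast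
  have sub: "{-T'..T'} \<subseteq> {-T..T}" using T' by auto
  have ZK': "Z s t \<in> ?K" if "\<bar>s\<bar> < \<delta>" "t \<in> {-T'..T'}" for s t
    using ZK[OF that(1)] that(2) sub by blast
  have Z'': "(Z s has_vector_derivative f (Z s t)) (at t within {-T'..T'})"
    if "\<bar>s\<bar> < \<delta>" "t \<in> {-T'..T'}" for s t
    by (rule has_vector_derivative_within_subset[OF Z'[OF that(1)] sub]) (use that sub in blast)
  have LT': "L * T' \<le> 1 / 2" using mult_left_mono[OF T'(2), of L] L(1) LT by linarith
  have close: "norm (Z s t - Z 0 t) \<le> 2 * (\<bar>s\<bar> * norm u)"
    if s: "\<bar>s\<bar> < \<delta>" and t: "t \<in> {-T'..T'}" for s t
  proof -
    have "norm (Z s t - Z 0 t) \<le> 2 * (norm (Z s 0 - Z 0 0) + T' * 0)"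
      by (rule short_time_bound[where L = L and e' = "\<lambda>t. f (Z s t) - f (Z 0 t)"])
         (use T' L(1) LT' t lip ZK'[OF s] ZK'[OF d0] in
           \<open>auto intro!: has_vector_derivative_diff Z'' s d0\<close>)
    then show ?thesis using Z0[OF s] Z0[OF d0] by simp
  qed
  have diff: "((\<lambda>s. Z s t) has_vector_derivative \<zeta> t) (at 0)" if t: "t \<in> {-T'..T'}" for t
    unfolding has_vector_derivative_def has_derivative_at_alt
  proof (intro conjI allI impI)
    show "bounded_linear (\<lambda>x. x *\<^sub>R \<zeta> t)" by (rule bounded_linear_scaleR_left)
    fix e :: real assume e: "e > 0"
    define C where "C = 4 * T' * norm u + 1"
    have C: "C > 0" unfolding C_def using T' by (intro add_nonneg_pos) auto
    define \<eta> where "\<eta> = e / C"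
    have \<eta>: "\<eta> > 0" using e C by (simp add: \<eta>_def)
    obtain \<rho> where \<rho>: "\<rho> > 0" "\<And>x y. x \<in> ?K \<Longrightarrow> y \<in> ?K \<Longrightarrow> norm (x - y) \<le> \<rho> \<Longrightarrow>
        norm (f x - f y - f' y (x - y)) \<le> \<eta> * norm (x - y)"
      using linearise[OF \<eta>] by blast
    define d where "d = min \<delta> (\<rho> / (2 * norm u + 1))"
    have pos: "2 * norm u + 1 > 0" by (intro add_nonneg_pos) auto
    have d: "d > 0" using \<delta> \<rho>(1) pos by (simp add: d_def)
    have "norm (Z s t - Z 0 t - s *\<^sub>R \<zeta> t) \<le> e * \<bar>s\<bar>" if sd: "\<bar>s\<bar> < d" for s
    proof -
      have s: "\<bar>s\<bar> < \<delta>" using sd by (simp add: d_def)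
      have "2 * (\<bar>s\<bar> * norm u) \<le> \<bar>s\<bar> * (2 * norm u + 1)" by (simp add: algebra_simps)
      also have "\<dots> \<le> \<rho> / (2 * norm u + 1) * (2 * norm u + 1)"
        using sd pos by (intro mult_right_mono) (auto simp: d_def)
      finally have small: "2 * (\<bar>s\<bar> * norm u) \<le> \<rho>" using pos by simp
      let ?e = "\<lambda>t. Z s t - Z 0 t - s *\<^sub>R \<zeta> t"
      let ?e' = "\<lambda>t. f (Z s t) - f (Z 0 t) - s *\<^sub>R f' (Z 0 t) (\<zeta> t)"
      have "norm (?e t) \<le> 2 * (norm (?e 0) + T' * (\<eta> * (2 * (\<bar>s\<bar> * norm u))))"
      proof (rule short_time_bound[where L = L and e' = ?e'])
        fix \<tau> assume \<tau>: "\<tau> \<in> {-T'..T'}"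
        have "(\<zeta> has_vector_derivative f' (Z 0 \<tau>) (\<zeta> \<tau>)) (at \<tau> within {-T'..T'})"
          using \<zeta>'[OF \<tau>] by simp
        from has_vector_derivative_diff[OF has_vector_derivative_diff[OF Z''[OF s \<tau>] Z''[OF d0 \<tau>]]
            bounded_linear.has_vector_derivative[OF bounded_linear_scaleR_right[of s] this]]
        show "(?e has_vector_derivative ?e' \<tau>) (at \<tau> within {-T'..T'})" .
        have z: "Z s \<tau> \<in> ?K" "Z 0 \<tau> \<in> ?K" using ZK'[OF s \<tau>] ZK'[OF d0 \<tau>] .
        let ?R = "f (Z s \<tau>) - f (Z 0 \<tau>) - f' (Z 0 \<tau>) (Z s \<tau> - Z 0 \<tau>)"
        have "norm ?R \<le> \<eta> * norm (Z s \<tau> - Z 0 \<tau>)"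
          using close[OF s \<tau>] small by (intro \<rho>(2) z) linarith
        also have "\<dots> \<le> \<eta> * (2 * (\<bar>s\<bar> * norm u))"
          using close[OF s \<tau>] \<eta> by (intro mult_left_mono) auto
        finally have R: "norm ?R \<le> \<eta> * (2 * (\<bar>s\<bar> * norm u))" .
        have "norm (f' (Z 0 \<tau>) (?e \<tau>)) \<le> norm (f' (Z 0 \<tau>)) * norm (?e \<tau>)" by (rule norm_blinfun)
        also have "\<dots> \<le> L * norm (?e \<tau>)" by (intro mult_right_mono L(2) z) auto
        finally have lin: "norm (f' (Z 0 \<tau>) (?e \<tau>)) \<le> L * norm (?e \<tau>)" .
        have eq: "?e' \<tau> = f' (Z 0 \<tau>) (?e \<tau>) + ?R"
          by (simp add: blinfun.diff_right blinfun.scaleR_right)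
        show "norm (?e' \<tau>) \<le> L * norm (?e \<tau>) + \<eta> * (2 * (\<bar>s\<bar> * norm u))"
          unfolding eq using norm_triangle_ineq[of "f' (Z 0 \<tau>) (?e \<tau>)" ?R] R lin by linarith
      qed (use T' L(1) LT' t \<eta> in auto)
      also have "\<dots> = 4 * T' * norm u * (\<eta> * \<bar>s\<bar>)"
        using Z0[OF s] Z0[OF d0] \<zeta>0 by simp
      also have "\<dots> \<le> C * (\<eta> * \<bar>s\<bar>)"
        using \<eta> by (intro mult_right_mono) (auto simp: C_def)
      also have "\<dots> = e * \<bar>s\<bar>" using C by (simp add: \<eta>_def)
      finally show ?thesis .
    qed
    then show "\<exists>d>0. \<forall>y. norm (y - 0) < d \<longrightarrow>
        norm (Z y t - Z 0 t - (y - 0) *\<^sub>R \<zeta> t) \<le> e * norm (y - 0)"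
      using d by (intro exI[of _ d]) auto
  qed
  show thesis
  proof (rule that[of T' \<delta> Z \<zeta>])
    show "(\<zeta> has_vector_derivative frechet_derivative f (at (Z 0 t)) (\<zeta> t)) (at t within {-T'..T'})"
      if "t \<in> {-T'..T'}" for t
      using \<zeta>'[OF that] Df[of "Z 0 t"] ZK'[OF d0 that] r(2) by auto
    show "Z s t \<in> S" if "\<bar>s\<bar> < \<delta>" "t \<in> {-T'..T'}" for s t
      using ZK'[OF that] r(2) by auto
  qed (use T' \<delta> Z0 Z'' \<zeta>0 diff in auto)
qed


section \<open>Charts and tangent vectors\<close>

text \<open>
  Both a manifold and its tangent bundle are atlases with differentiable transition maps, and this
  is all that is needed to compute velocities and directional derivatives in an arbitrary chart.
\<close>

locale differentiable_atlas =
  fixes M :: "('i, 'q, 'e::euclidean_space) atlas"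
  assumes inj: "inj_on (cmap M i) (cdom M i)"
    and open_overlap: "open (cmap M i ` (cdom M i \<inter> cdom M j))"
    and trans_differentiable: "x \<in> cmap M i ` (cdom M i \<inter> cdom M j) \<Longrightarrow>
      (\<lambda>x. cmap M j (cinv M i x)) differentiable (at x)"
begin

definition dtrans :: "'i \<Rightarrow> 'i \<Rightarrow> 'q \<Rightarrow> 'e \<Rightarrow> 'e" where
  "dtrans i j q = frechet_derivative (\<lambda>x. cmap M j (cinv M i x)) (at (cmap M i q))"

lemma cinv_cmap [simp]: "q \<in> cdom M i \<Longrightarrow> cinv M i (cmap M i q) = q"
  by (simp add: cinv_def inj)

lemma cmap_cinv: "x \<in> cmap M i ` cdom M i \<Longrightarrow> cmap M i (cinv M i x) = x"
  by (simp add: cinv_def f_inv_into_f)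

lemma cinv_cdom: "x \<in> cmap M i ` cdom M i \<Longrightarrow> cinv M i x \<in> cdom M i"
  by (simp add: cinv_def inv_into_into)

lemma open_chart: "open (cmap M i ` cdom M i)"
  using open_overlap[of i i] by simp

lemma overlap_cdom:
  "x \<in> cmap M i ` (cdom M i \<inter> cdom M j) \<Longrightarrow> cinv M i x \<in> cdom M i \<inter> cdom M j"
  by auto

lemma in_overlap: "q \<in> cdom M i \<Longrightarrow> cmap M i q \<in> cmap M i ` (cdom M i \<inter> cdom M j) \<longleftrightarrow> q \<in> cdom M j"
  using inj[of i] by (auto simp: inj_on_def)

lemma dtrans_has_derivative:
  assumes "q \<in> cdom M i" "q \<in> cdom M j"
  shows "((\<lambda>x. cmap M j (cinv M i x)) has_derivative dtrans i j q) (at (cmap M i q))"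
  using trans_differentiable[of "cmap M i q" i j] assms
  unfolding dtrans_def by (simp add: in_overlap frechet_derivative_works)

lemma linear_dtrans: "q \<in> cdom M i \<Longrightarrow> q \<in> cdom M j \<Longrightarrow> linear (dtrans i j q)"
  using dtrans_has_derivative has_derivative_linear by blast

lemma dtrans_id:
  assumes "q \<in> cdom M i" shows "dtrans i i q = (\<lambda>v. v)"
proof -
  have "((\<lambda>x. x) has_derivative (\<lambda>v. v)) (at (cmap M i q))" by (rule has_derivative_ident)
  then have "((\<lambda>x. cmap M i (cinv M i x)) has_derivative (\<lambda>v. v)) (at (cmap M i q))"
    by (rule has_derivative_transform_within_open[OF _ open_chart[of i]])
       (use assms in \<open>auto simp: cmap_cinv\<close>)
  then show ?thesis unfolding dtrans_def by (rule frechet_derivative_at[symmetric])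
qed

lemma dtrans_comp:
  assumes "q \<in> cdom M i" "q \<in> cdom M j" "q \<in> cdom M k"
  shows "dtrans j k q (dtrans i j q v) = dtrans i k q v"
proof -
  have "((\<lambda>x. cmap M k (cinv M j (cmap M j (cinv M i x)))) has_derivative
      (\<lambda>v. dtrans j k q (dtrans i j q v))) (at (cmap M i q))"
    by (rule has_derivative_compose[OF dtrans_has_derivative])
       (use assms dtrans_has_derivative[of q j k] in auto)
  then have "((\<lambda>x. cmap M k (cinv M i x)) has_derivative
      (\<lambda>v. dtrans j k q (dtrans i j q v))) (at (cmap M i q))"
    by (rule has_derivative_transform_within_open[OF _ open_overlap[of i j]])
       (use assms in \<open>auto simp: in_overlap\<close>)
  from frechet_derivative_at[OF this] show ?thesis
    unfolding dtrans_def[of i k] by (rule fun_cong)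
qed

lemma tangent_space_iff:
  "v \<in> tangent_space M q \<longleftrightarrow> (\<forall>i. q \<notin> cdom M i \<longrightarrow> v i = 0) \<and>
     (\<forall>i j. q \<in> cdom M i \<longrightarrow> q \<in> cdom M j \<longrightarrow> v j = dtrans i j q (v i))"
  by (auto simp: tangent_space_def dtrans_def)

lemma tangent_outside: "v \<in> tangent_space M q \<Longrightarrow> q \<notin> cdom M i \<Longrightarrow> v i = 0"
  and tangent_trans: "v \<in> tangent_space M q \<Longrightarrow> q \<in> cdom M i \<Longrightarrow> q \<in> cdom M j \<Longrightarrow>
    v j = dtrans i j q (v i)"
  unfolding tangent_space_iff by blast+

lemma tvec_eq: "tvec M i q x j = (if q \<in> cdom M j then dtrans i j q x else 0)"
  by (simp add: tvec_def dtrans_def)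

lemma tvec_tangent: "q \<in> cdom M i \<Longrightarrow> tvec M i q x \<in> tangent_space M q"
  by (auto simp: tangent_space_iff tvec_eq dtrans_comp)

lemma tvec_self [simp]: "q \<in> cdom M i \<Longrightarrow> tvec M i q x i = x"
  by (simp add: tvec_eq dtrans_id)

lemma tangent_eqI:
  assumes "u \<in> tangent_space M q" "v \<in> tangent_space M q" "q \<in> cdom M i" "u i = v i"
  shows "u = v"
proof
  fix j show "u j = v j"
    using tangent_trans[OF assms(1,3), of j] tangent_trans[OF assms(2,3), of j]
      tangent_outside[OF assms(1), of j] tangent_outside[OF assms(2), of j] assms(4)
    by (cases "q \<in> cdom M j") auto
qed

lemma tvec_rep: "v \<in> tangent_space M q \<Longrightarrow> q \<in> cdom M i \<Longrightarrow> tvec M i q (v i) = v"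
  by (rule tangent_eqI[of _ q _ i]) (auto intro: tvec_tangent)

lemma subspace_tangent_space: "subspace (tangent_space M q)"
proof (rule subspaceI)
  show "0 \<in> tangent_space M q"
    by (auto simp: tangent_space_iff linear_0[OF linear_dtrans])
  fix u v :: "'i \<Rightarrow> 'e" and r :: real
  assume u: "u \<in> tangent_space M q"
  show "u + v \<in> tangent_space M q" if v: "v \<in> tangent_space M q"
    unfolding tangent_space_iff
  proof (intro conjI allI impI)
    fix i j assume ij: "q \<in> cdom M i" "q \<in> cdom M j"
    show "(u + v) j = dtrans i j q ((u + v) i)"
      using tangent_trans[OF u ij] tangent_trans[OF v ij] linear_add[OF linear_dtrans[OF ij]]
      by (simp add: plus_fun_def)
  qed (simp add: plus_fun_def tangent_outside[OF u] tangent_outside[OF v])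
  show "r *\<^sub>R u \<in> tangent_space M q"
    unfolding tangent_space_iff
  proof (intro conjI allI impI)
    fix i j assume ij: "q \<in> cdom M i" "q \<in> cdom M j"
    show "(r *\<^sub>R u) j = dtrans i j q ((r *\<^sub>R u) i)"
      using tangent_trans[OF u ij] linear_cmul[OF linear_dtrans[OF ij]]
      by (simp add: scaleR_fun_def)
  qed (simp add: scaleR_fun_def tangent_outside[OF u])
qed

lemma tvec_add: "q \<in> cdom M i \<Longrightarrow> tvec M i q (x + y) = tvec M i q x + tvec M i q y"
  and tvec_scaleR: "q \<in> cdom M i \<Longrightarrow> tvec M i q (r *\<^sub>R x) = r *\<^sub>R tvec M i q x"
  by (auto simp: fun_eq_iff tvec_eq plus_fun_def scaleR_fun_def
      linear_add[OF linear_dtrans] linear_cmul[OF linear_dtrans])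

text \<open>
  It is enough to differentiate a curve in one chart: in any other one the chain rule for the
  transition map applies.
\<close>

lemma has_velocity_chart:
  assumes c: "c t \<in> cdom M i" and ev: "\<forall>\<^sub>F s in nhds t. c s \<in> cdom M i"
    and d: "((\<lambda>s. cmap M i (c s)) has_vector_derivative y) (at t)"
  shows "has_velocity M c t (tvec M i (c t) y)"
  unfolding has_velocity_def
proof (intro conjI allI impI)
  show "c t \<in> points M" using c by (auto simp: points_def)
  show "tvec M i (c t) y \<in> tangent_space M (c t)" by (rule tvec_tangent[OF c])
  fix j assume j: "c t \<in> cdom M j"
  let ?O = "cmap M i ` (cdom M i \<inter> cdom M j)"
  have "isCont (\<lambda>s. cmap M i (c s)) t" by (rule has_vector_derivative_continuous[OF d])
  then have "((\<lambda>s. cmap M i (c s)) \<longlongrightarrow> cmap M i (c t)) (nhds t)"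
    using tendsto_at_iff_tendsto_nhds[of "\<lambda>s. cmap M i (c s)" t] by (simp add: isCont_def)
  then have "\<forall>\<^sub>F s in nhds t. cmap M i (c s) \<in> ?O"
    using topological_tendstoD[OF _ open_overlap[of i j]] c j in_overlap by blast
  with ev have ev2: "\<forall>\<^sub>F s in nhds t. c s \<in> cdom M i \<and> c s \<in> cdom M j"
    by eventually_elim (auto simp: in_overlap)
  then show "\<forall>\<^sub>F s in nhds t. c s \<in> cdom M j" by eventually_elim simp
  have V: "((\<lambda>s. cmap M j (cinv M i (cmap M i (c s)))) has_vector_derivative dtrans i j (c t) y) (at t)"
    using vector_derivative_diff_chain_within[OF d,
        OF has_derivative_at_withinI[OF dtrans_has_derivative[OF c j]]]
    by (simp add: o_def)
  obtain T where T: "open T" "t \<in> T" "\<And>s. s \<in> T \<Longrightarrow> c s \<in> cdom M i \<and> c s \<in> cdom M j"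
    using ev2 unfolding eventually_nhds by blast
  have "((\<lambda>s. cmap M j (c s)) has_vector_derivative dtrans i j (c t) y) (at t)"
    by (rule has_vector_derivative_transform_within_open[OF V T(1,2)]) (simp add: T(3))
  then show "((\<lambda>s. cmap M j (c s)) has_vector_derivative tvec M i (c t) y j) (at t)"
    using j by (simp add: tvec_eq)
qed

lemma velocity_eq:
  assumes "has_velocity M c t v" shows "velocity M c t = v"
proof
  fix i
  show "velocity M c t i = v i"
    using assms tangent_outside[of v "c t" i]
    by (cases "c t \<in> cdom M i") (auto simp: velocity_def has_velocity_def vector_derivative_at)
qed

lemmas velocity_chart = velocity_eq[OF has_velocity_chart]

text \<open>
  The directional derivative is defined in an arbitrarily chosen chart; the transformation rules
  of tangent vectors and of derivatives of functions compensate each other.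
\<close>

lemma tderiv_chart:
  assumes v: "v \<in> tangent_space M q" and q: "q \<in> cdom M i"
    and f: "((\<lambda>x. f (cinv M i x)) has_derivative f') (at (cmap M i q))"
  shows "tderiv M q v f = f' (v i)"
proof -
  define k where "k = (SOME k. q \<in> cdom M k)"
  have k: "q \<in> cdom M k" unfolding k_def using q by (rule someI)
  have "((\<lambda>x. f (cinv M i (cmap M i (cinv M k x)))) has_derivative (\<lambda>w. f' (dtrans k i q w)))
      (at (cmap M k q))"
    by (rule has_derivative_compose[OF dtrans_has_derivative[OF k q]]) (simp add: k f)
  then have "((\<lambda>x. f (cinv M k x)) has_derivative (\<lambda>w. f' (dtrans k i q w))) (at (cmap M k q))"
    by (rule has_derivative_transform_within_open[OF _ open_overlap[of k i]])
       (use k q in \<open>auto simp: in_overlap\<close>)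
  from fun_cong[OF frechet_derivative_at[OF this], of "v k"]
  show ?thesis
    using tangent_trans[OF v k q] by (simp add: tderiv_def Let_def k_def[symmetric])
qed

end


section \<open>The tangent bundle and lifts of vector fields\<close>

locale smooth_atlas =
  fixes M :: "('i, 'q, 'e::euclidean_space) atlas"
  assumes smooth: "smooth_manifold M"
begin

lemma trans_smooth: "smooth_on (cmap M i ` (cdom M i \<inter> cdom M j)) (\<lambda>x. cmap M j (cinv M i x))"
  using smooth by (simp add: smooth_manifold_def)

end

sublocale smooth_atlas \<subseteq> differentiable_atlas M
proof
  show "inj_on (cmap M i) (cdom M i)" for i
    using smooth by (simp add: smooth_manifold_def)
  show op: "open (cmap M i ` (cdom M i \<inter> cdom M j))" for i j
    using smooth by (simp add: smooth_manifold_def)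
  show "(\<lambda>x. cmap M j (cinv M i x)) differentiable (at x)"
    if "x \<in> cmap M i ` (cdom M i \<inter> cdom M j)" for i j x
    using C1_on_has_derivative[OF smooth_on_C1[OF trans_smooth op] that]
    by (auto simp: differentiable_def)
qed

context smooth_atlas
begin

text \<open>
  The second derivative of a transition map. It is the inhomogeneous term in the transformation
  of derivatives of vector fields, of velocities of curves in the tangent bundle and of Christoffel
  symbols, and its symmetry is the reason why complete lifts, brackets and Levi-Civita derivatives are
  tangent vectors.
\<close>

definition ddtrans :: "'i \<Rightarrow> 'i \<Rightarrow> 'q \<Rightarrow> 'e \<Rightarrow> 'e \<Rightarrow> 'e" where
  "ddtrans i j q v w = frechet_derivative
     (\<lambda>x. frechet_derivative (\<lambda>x. cmap M j (cinv M i x)) (at x) v) (at (cmap M i q)) w"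

lemma ddtrans_sym:
  "q \<in> cdom M i \<Longrightarrow> q \<in> cdom M j \<Longrightarrow> ddtrans i j q v w = ddtrans i j q w v"
  unfolding ddtrans_def
  by (rule second_derivative_symmetric[OF trans_smooth open_overlap]) (simp add: in_overlap)

lemma linear_ddtrans:
  assumes "q \<in> cdom M i" "q \<in> cdom M j" shows "linear (ddtrans i j q v)"
proof -
  have "linear (frechet_derivative
      (\<lambda>x. frechet_derivative (\<lambda>x. cmap M j (cinv M i x)) (at x) v) (at (cmap M i q)))"
    by (rule smooth_on_linear_derivative[OF smooth_on_derivative[OF trans_smooth] open_overlap])
       (simp add: assms in_overlap)
  then show ?thesis by (simp add: ddtrans_def[abs_def])
qed

lemma dtrans_map_has_derivative:
  assumes "q \<in> cdom M i" "q \<in> cdom M j"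
  shows "((\<lambda>(x, v). frechet_derivative (\<lambda>x. cmap M j (cinv M i x)) (at x) v) has_derivative
     (\<lambda>(a, b). ddtrans i j q v a + dtrans i j q b)) (at (cmap M i q, v))"
  unfolding ddtrans_def dtrans_def
  by (rule has_derivative_tangent_map[OF trans_smooth open_overlap]) (simp add: assms in_overlap)

lemma dtrans_cinv:
  "x \<in> cmap M i ` cdom M i \<Longrightarrow>
    dtrans i j (cinv M i x) = frechet_derivative (\<lambda>x. cmap M j (cinv M i x)) (at x)"
  by (simp add: dtrans_def cmap_cinv)

lemma cdom_TM: "cdom (tangent_bundle M) i = {(q, v). q \<in> cdom M i \<and> v \<in> tangent_space M q}"
  and cmap_TM [simp]: "cmap (tangent_bundle M) i (q, v) = (cmap M i q, v i)"
  by (simp_all add: tangent_bundle_def)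

lemma overlap_TM:
  "cmap (tangent_bundle M) i ` (cdom (tangent_bundle M) i \<inter> cdom (tangent_bundle M) j) =
   (cmap M i ` (cdom M i \<inter> cdom M j)) \<times> UNIV"
proof (intro equalityI subsetI)
  fix z assume "z \<in> (cmap M i ` (cdom M i \<inter> cdom M j)) \<times> (UNIV :: 'e set)"
  then obtain q y where z: "z = (cmap M i q, y)" "q \<in> cdom M i" "q \<in> cdom M j" by auto
  show "z \<in> cmap (tangent_bundle M) i ` (cdom (tangent_bundle M) i \<inter> cdom (tangent_bundle M) j)"
    by (rule image_eqI[of _ _ "(q, tvec M i q y)"]) (simp_all add: z cdom_TM tvec_tangent)
qed (auto simp: cdom_TM)

lemma inj_TM: "inj_on (cmap (tangent_bundle M) i) (cdom (tangent_bundle M) i)"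
proof (rule inj_onI)
  fix p p' assume "p \<in> cdom (tangent_bundle M) i" "p' \<in> cdom (tangent_bundle M) i"
    and eq: "cmap (tangent_bundle M) i p = cmap (tangent_bundle M) i p'"
  then obtain q v q' v' where p: "p = (q, v)" "p' = (q', v')" "q \<in> cdom M i" "q' \<in> cdom M i"
    "v \<in> tangent_space M q" "v' \<in> tangent_space M q'" by (auto simp: cdom_TM)
  then have "q = q'" using eq inj[of i] by (auto simp: inj_on_def)
  then show "p = p'" using p eq tangent_eqI[of v q v' i] by auto
qed

lemma cinv_TM:
  assumes "x \<in> cmap M i ` cdom M i"
  shows "cinv (tangent_bundle M) i (x, y) = (cinv M i x, tvec M i (cinv M i x) y)"
proof -
  let ?p = "(cinv M i x, tvec M i (cinv M i x) y)"
  have "?p \<in> cdom (tangent_bundle M) i"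
    using cinv_cdom[OF assms] by (simp add: cdom_TM tvec_tangent)
  from inv_into_f_f[OF inj_TM this]
  have "cinv (tangent_bundle M) i (cmap (tangent_bundle M) i ?p) = ?p"
    by (simp only: cinv_def)
  then show ?thesis using assms by (simp add: cmap_cinv cinv_cdom)
qed

lemma trans_TM:
  assumes "x \<in> cmap M i ` (cdom M i \<inter> cdom M j)"
  shows "cmap (tangent_bundle M) j (cinv (tangent_bundle M) i (x, y)) =
    (cmap M j (cinv M i x), frechet_derivative (\<lambda>x. cmap M j (cinv M i x)) (at x) y)"
  using assms overlap_cdom[OF assms] dtrans_cinv[of x i j] cinv_TM[of x i y] by (auto simp: tvec_eq)

lemma trans_TM_has_derivative:
  assumes q: "q \<in> cdom M i" "q \<in> cdom M j"
  shows "((\<lambda>p. cmap (tangent_bundle M) j (cinv (tangent_bundle M) i p)) has_derivative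
    (\<lambda>(a, b). (dtrans i j q a, ddtrans i j q y a + dtrans i j q b))) (at (cmap M i q, y))"
proof -
  let ?\<tau> = "\<lambda>x. cmap M j (cinv M i x)"
  have "((\<lambda>p. ?\<tau> (fst p)) has_derivative (\<lambda>h. dtrans i j q (fst h))) (at (cmap M i q, y))"
    by (rule has_derivative_compose[OF bounded_linear_imp_has_derivative[OF bounded_linear_fst]])
       (simp add: dtrans_has_derivative q)
  from has_derivative_Pair[OF this dtrans_map_has_derivative[OF q]]
  have "((\<lambda>p. (?\<tau> (fst p), (\<lambda>(x, v). frechet_derivative ?\<tau> (at x) v) p)) has_derivative
      (\<lambda>(a, b). (dtrans i j q a, ddtrans i j q y a + dtrans i j q b))) (at (cmap M i q, y))"
    by (simp add: case_prod_beta')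
  then show ?thesis
    by (rule has_derivative_transform_within_open[of _ _ _ _ "(cmap M i ` (cdom M i \<inter> cdom M j)) \<times> UNIV"])
       (use q open_overlap[of i j] in \<open>auto simp: in_overlap open_Times trans_TM\<close>)
qed

end

sublocale smooth_atlas \<subseteq> TM: differentiable_atlas "tangent_bundle M"
proof
  show "inj_on (cmap (tangent_bundle M) i) (cdom (tangent_bundle M) i)" for i
    by (rule inj_TM)
  show "open (cmap (tangent_bundle M) i ` (cdom (tangent_bundle M) i \<inter> cdom (tangent_bundle M) j))"
    for i j
    unfolding overlap_TM by (intro open_Times open_overlap open_UNIV)
  fix i j p assume "p \<in> cmap (tangent_bundle M) i ` (cdom (tangent_bundle M) i \<inter> cdom (tangent_bundle M) j)"
  then obtain q y where "p = (cmap M i q, y)" "q \<in> cdom M i" "q \<in> cdom M j"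
    unfolding overlap_TM by auto
  then show "(\<lambda>x. cmap (tangent_bundle M) j (cinv (tangent_bundle M) i x)) differentiable (at p)"
    unfolding differentiable_def using trans_TM_has_derivative by blast
qed

context smooth_atlas
begin

lemma dtrans_TM:
  assumes "q \<in> cdom M i" "q \<in> cdom M j"
  shows "TM.dtrans i j (q, v) (a, b) = (dtrans i j q a, ddtrans i j q (v i) a + dtrans i j q b)"
  using fun_cong[OF frechet_derivative_at[OF trans_TM_has_derivative[OF assms, of "v i"]], of "(a, b)"]
  by (simp add: TM.dtrans_def)

lemma tangent_TM_I:
  assumes "q \<in> points M" "v \<in> tangent_space M q"
    and "\<And>i. q \<notin> cdom M i \<Longrightarrow> Z i = 0"
    and "\<And>i j. q \<in> cdom M i \<Longrightarrow> q \<in> cdom M j \<Longrightarrow>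
      Z j = (dtrans i j q (fst (Z i)), ddtrans i j q (v i) (fst (Z i)) + dtrans i j q (snd (Z i)))"
  shows "Z \<in> tangent_space (tangent_bundle M) (q, v)"
  unfolding TM.tangent_space_iff
proof (intro conjI allI impI)
  show "Z i = 0" if "(q, v) \<notin> cdom (tangent_bundle M) i" for i
    using that assms(2,3) by (auto simp: cdom_TM)
  fix i j assume "(q, v) \<in> cdom (tangent_bundle M) i" "(q, v) \<in> cdom (tangent_bundle M) j"
  then have ij: "q \<in> cdom M i" "q \<in> cdom M j" by (simp_all add: cdom_TM)
  show "Z j = TM.dtrans i j (q, v) (Z i)"
    using assms(4)[OF ij] dtrans_TM[OF ij, of v "fst (Z i)" "snd (Z i)"] by simp
qed

lemma vector_field_tangent: "vector_field M X \<Longrightarrow> q \<in> points M \<Longrightarrow> X q \<in> tangent_space M q"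
  by (simp add: vector_field_def)

lemma vector_field_smooth:
  "vector_field M X \<Longrightarrow> smooth_on (cmap M i ` cdom M i) (\<lambda>x. X (cinv M i x) i)"
  by (simp add: vector_field_def)

lemma vf_deriv_has_derivative:
  assumes "vector_field M X" "q \<in> cdom M i"
  shows "((\<lambda>x. X (cinv M i x) i) has_derivative vf_deriv M X i q) (at (cmap M i q))"
  using C1_on_has_derivative[OF smooth_on_C1[OF vector_field_smooth[OF assms(1)] open_chart], of "cmap M i q" i]
    assms(2) unfolding vf_deriv_def by simp

lemma points_I: "q \<in> cdom M i \<Longrightarrow> q \<in> points M"
  by (auto simp: points_def)

text \<open>
  The derivative of the identity \<open>X\<^sub>j (\<tau> x) = D\<tau>(x) X\<^sub>i (x)\<close> between the representatives of a vector
  field in two charts with transition map \<open>\<tau>\<close>.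
\<close>

lemma vf_deriv_transition:
  assumes X: "vector_field M X" and q: "q \<in> cdom M i" "q \<in> cdom M j"
  shows "vf_deriv M X j q (dtrans i j q w) =
    ddtrans i j q (X q i) w + dtrans i j q (vf_deriv M X i q w)"
proof -
  let ?\<tau> = "\<lambda>x. cmap M j (cinv M i x)"
  let ?O = "cmap M i ` (cdom M i \<inter> cdom M j)"
  have x: "cmap M i q \<in> ?O" using q by auto
  have "((\<lambda>x. X (cinv M j (?\<tau> x)) j) has_derivative (\<lambda>w. vf_deriv M X j q (dtrans i j q w)))
      (at (cmap M i q))"
    by (rule has_derivative_compose[OF dtrans_has_derivative[OF q]])
       (simp add: q vf_deriv_has_derivative[OF X])
  then have L: "((\<lambda>x. X (cinv M i x) j) has_derivative (\<lambda>w. vf_deriv M X j q (dtrans i j q w)))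
      (at (cmap M i q))"
    by (rule has_derivative_transform_within_open[OF _ open_overlap x]) auto
  have pr: "((\<lambda>x. (x, X (cinv M i x) i)) has_derivative (\<lambda>w. (w, vf_deriv M X i q w))) (at (cmap M i q))"
    by (intro has_derivative_Pair has_derivative_ident vf_deriv_has_derivative[OF X q(1)])
  have "((\<lambda>x. (\<lambda>(x, v). frechet_derivative ?\<tau> (at x) v) (x, X (cinv M i x) i)) has_derivative
      (\<lambda>w. (\<lambda>(a, b). ddtrans i j q (X q i) a + dtrans i j q b) (w, vf_deriv M X i q w))) (at (cmap M i q))"
    by (rule has_derivative_compose[OF pr]) (use dtrans_map_has_derivative[OF q, of "X q i"] q in simp)
  then have "((\<lambda>x. frechet_derivative ?\<tau> (at x) (X (cinv M i x) i)) has_derivative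
      (\<lambda>w. ddtrans i j q (X q i) w + dtrans i j q (vf_deriv M X i q w))) (at (cmap M i q))"
    by simp
  then have R: "((\<lambda>x. X (cinv M i x) j) has_derivative
      (\<lambda>w. ddtrans i j q (X q i) w + dtrans i j q (vf_deriv M X i q w))) (at (cmap M i q))"
  proof (rule has_derivative_transform_within_open[OF _ open_overlap x])
    fix x assume x: "x \<in> ?O"
    then have "cinv M i x \<in> cdom M i" "cinv M i x \<in> cdom M j" using overlap_cdom by blast+
    from tangent_trans[OF vector_field_tangent[OF X points_I[OF this(1)]] this]
    show "frechet_derivative ?\<tau> (at x) (X (cinv M i x) i) = X (cinv M i x) j"
      using x dtrans_cinv[of x i j] by auto
  qed
  show ?thesis using fun_cong[OF has_derivative_unique[OF L R]] .
qed

lemma complete_lift_tangent: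
  assumes X: "vector_field M X" and q: "q \<in> points M" and v: "v \<in> tangent_space M q"
  shows "complete_lift M X (q, v) \<in> tangent_space (tangent_bundle M) (q, v)"
proof (rule tangent_TM_I[OF q v])
  fix i j assume ij: "q \<in> cdom M i" "q \<in> cdom M j"
  have "vf_deriv M X j q (v j) = ddtrans i j q (X q i) (v i) + dtrans i j q (vf_deriv M X i q (v i))"
    using vf_deriv_transition[OF X ij, of "v i"] tangent_trans[OF v ij] by simp
  moreover have "X q j = dtrans i j q (X q i)"
    by (rule tangent_trans[OF vector_field_tangent[OF X q] ij])
  ultimately show "complete_lift M X (q, v) j = (dtrans i j q (fst (complete_lift M X (q, v) i)),
      ddtrans i j q (v i) (fst (complete_lift M X (q, v) i)) + dtrans i j q (snd (complete_lift M X (q, v) i)))"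
    using ij ddtrans_sym[OF ij, of "v i" "X q i"] by (simp add: complete_lift_def)
qed (simp add: complete_lift_def)

lemma vertical_lift_tangent:
  assumes X: "vector_field M X" and q: "q \<in> points M" and v: "v \<in> tangent_space M q"
  shows "vertical_lift M X (q, v) \<in> tangent_space (tangent_bundle M) (q, v)"
proof (rule tangent_TM_I[OF q v])
  fix i j assume ij: "q \<in> cdom M i" "q \<in> cdom M j"
  have 0: "ddtrans i j q (v i) 0 = 0" by (rule linear_0[OF linear_ddtrans[OF ij]])
  have X: "X q j = dtrans i j q (X q i)" by (rule tangent_trans[OF vector_field_tangent[OF X q] ij])
  show "vertical_lift M X (q, v) j = (dtrans i j q (fst (vertical_lift M X (q, v) i)),
      ddtrans i j q (v i) (fst (vertical_lift M X (q, v) i)) + dtrans i j q (snd (vertical_lift M X (q, v) i)))"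
    using ij 0 linear_0[OF linear_dtrans[OF ij]] by (simp add: vertical_lift_def X)
qed (simp add: vertical_lift_def)

lemma lie_bracket_tangent:
  assumes X: "vector_field M X" and Y: "vector_field M Y" and q: "q \<in> points M"
  shows "lie_bracket M X Y q \<in> tangent_space M q"
  unfolding tangent_space_iff
proof (intro conjI allI impI)
  fix i j assume ij: "q \<in> cdom M i" "q \<in> cdom M j"
  note tX = tangent_trans[OF vector_field_tangent[OF X q] ij]
    and tY = tangent_trans[OF vector_field_tangent[OF Y q] ij]
  have "lie_bracket M X Y q j =
      vf_deriv M Y j q (dtrans i j q (X q i)) - vf_deriv M X j q (dtrans i j q (Y q i))"
    using ij(2) by (simp only: lie_bracket_def if_True tX[symmetric] tY[symmetric])
  also have "\<dots> = dtrans i j q (vf_deriv M Y i q (X q i)) - dtrans i j q (vf_deriv M X i q (Y q i))"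
    unfolding vf_deriv_transition[OF X ij] vf_deriv_transition[OF Y ij] ddtrans_sym[OF ij, of "Y q i"]
    by simp
  also have "\<dots> = dtrans i j q (lie_bracket M X Y q i)"
    using ij(1) by (simp add: lie_bracket_def linear_diff[OF linear_dtrans[OF ij]])
  finally show "lie_bracket M X Y q j = dtrans i j q (lie_bracket M X Y q i)" .
qed (simp add: lie_bracket_def)

text \<open>This turns a solution of a second-order equation in one chart into an integral curve on the tangent bundle.\<close>

lemma has_velocity_TM:
  assumes x: "\<And>s. s \<in> I \<Longrightarrow> x s \<in> cmap M i ` cdom M i" and I: "open I" "t \<in> I"
    and x': "(x has_vector_derivative y t) (at t)" and y': "(y has_vector_derivative a) (at t)"
    and Z: "Z \<in> tangent_space (tangent_bundle M) (cinv M i (x t), tvec M i (cinv M i (x t)) (y t))"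
    and Zi: "Z i = (y t, a)"
  shows "has_velocity (tangent_bundle M) (\<lambda>s. (cinv M i (x s), tvec M i (cinv M i (x s)) (y s))) t Z"
proof -
  let ?c = "\<lambda>s. (cinv M i (x s), tvec M i (cinv M i (x s)) (y s))"
  have c: "?c s \<in> cdom (tangent_bundle M) i" if "s \<in> I" for s
    using cinv_cdom[OF x[OF that]] tvec_tangent by (auto simp: cdom_TM)
  have ct: "?c t \<in> cdom (tangent_bundle M) i" using c[OF I(2)] .
  have "((\<lambda>s. (x s, y s)) has_vector_derivative (y t, a)) (at t)"
    by (intro has_vector_derivative_Pair x' y')
  then have "((\<lambda>s. cmap (tangent_bundle M) i (?c s)) has_vector_derivative (y t, a)) (at t)"
    by (rule has_vector_derivative_transform_within_open[OF _ I])
       (use x cinv_cdom in \<open>auto simp: cmap_cinv\<close>)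
  moreover have "\<forall>\<^sub>F s in nhds t. ?c s \<in> cdom (tangent_bundle M) i"
    using eventually_nhds_in_open[OF I] by eventually_elim (rule c)
  ultimately have "has_velocity (tangent_bundle M) ?c t (tvec (tangent_bundle M) i (?c t) (y t, a))"
    by (intro TM.has_velocity_chart ct)
  then show ?thesis using TM.tvec_rep[OF Z ct] Zi by simp
qed

end


section \<open>Riemannian metrics and the Levi-Civita connection in charts\<close>

locale riemannian_atlas = smooth_atlas M
  for M :: "('i, 'q, 'e::euclidean_space) atlas" +
  fixes g :: "'q \<Rightarrow> ('i \<Rightarrow> 'e) \<Rightarrow> ('i \<Rightarrow> 'e) \<Rightarrow> real"
  assumes metric: "riemannian_metric M g"
begin

abbreviation chart_image :: "'i \<Rightarrow> 'e set" where
  "chart_image i \<equiv> cmap M i ` cdom M i"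

abbreviation met :: "'i \<Rightarrow> 'e \<Rightarrow> 'e \<Rightarrow> 'e \<Rightarrow> real" where
  "met \<equiv> metric_rep M g"

definition dmet :: "'i \<Rightarrow> 'e \<Rightarrow> 'e \<Rightarrow> 'e \<Rightarrow> 'e \<Rightarrow> real" where
  "dmet i x a v w = frechet_derivative (\<lambda>x. met i x v w) (at x) a"

lemma
  assumes "q \<in> points M" "u \<in> tangent_space M q" "v \<in> tangent_space M q"
  shows g_sym: "g q u v = g q v u"
    and g_add_right: "w \<in> tangent_space M q \<Longrightarrow> g q u (v + w) = g q u v + g q u w"
    and g_scaleR_right: "g q u (r *\<^sub>R v) = r * g q u v"
    and g_pos: "u \<noteq> 0 \<Longrightarrow> g q u u > 0"
  using metric assms unfolding riemannian_metric_def linear_on_tangent_def by blast+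

lemma met_eq:
  assumes "q \<in> cdom M i" "u \<in> tangent_space M q" "v \<in> tangent_space M q"
  shows "met i (cmap M i q) (u i) (v i) = g q u v"
  using assms by (simp add: metric_rep_def tvec_rep)

lemma met_sym: "x \<in> chart_image i \<Longrightarrow> met i x v w = met i x w v"
  unfolding metric_rep_def
  using g_sym[OF points_I[OF cinv_cdom] tvec_tangent[OF cinv_cdom] tvec_tangent[OF cinv_cdom]] by blast

lemma linear_met_right:
  assumes "x \<in> chart_image i" shows "linear (met i x v)"
proof (rule linearI)
  note q = cinv_cdom[OF assms]
  note t = points_I[OF q] tvec_tangent[OF q]
  show "met i x v (w + w') = met i x v w + met i x v w'" for w w'
    by (simp add: metric_rep_def tvec_add[OF q] g_add_right t)
  show "met i x v (r *\<^sub>R w) = r *\<^sub>R met i x v w" for r w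
    by (simp add: metric_rep_def tvec_scaleR[OF q] g_scaleR_right t)
qed

lemma linear_met_left: "x \<in> chart_image i \<Longrightarrow> linear (\<lambda>v. met i x v w)"
  using linear_met_right[of x i w] by (simp add: met_sym[of x i _ w])

lemma met_pos:
  assumes x: "x \<in> chart_image i" and v: "v \<noteq> 0" shows "met i x v v > 0"
proof -
  note q = cinv_cdom[OF x]
  have "tvec M i (cinv M i x) v \<noteq> 0" using v tvec_self[OF q, of v] by (auto simp del: tvec_self)
  then show ?thesis
    unfolding metric_rep_def by (rule g_pos[OF points_I[OF q] tvec_tangent[OF q] tvec_tangent[OF q]])
qed

lemma met_nondegenerate:
  assumes "x \<in> chart_image i" "\<And>y. met i x v y = met i x w y" shows "v = w"
proof (rule ccontr)
  assume "v \<noteq> w"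
  then have "met i x (v - w) (v - w) > 0" using met_pos[OF assms(1), of "v - w"] by simp
  then show False
    using linear_diff[OF linear_met_left[OF assms(1)], of v w "v - w"] assms(2)[of "v - w"] by simp
qed

lemma met_C1: "C1_on (chart_image i) (\<lambda>x. met i x v w)"
  using metric[unfolded riemannian_metric_def, THEN conjunct2] by (intro smooth_on_C1 open_chart) simp

lemma met_has_derivative:
  "x \<in> chart_image i \<Longrightarrow> ((\<lambda>x. met i x v w) has_derivative (\<lambda>a. dmet i x a v w)) (at x)"
  using C1_on_has_derivative[OF met_C1, of x i v w] by (simp add: dmet_def[abs_def])

lemma dmet_eqI:
  assumes x: "x \<in> chart_image i"
    and eq: "\<And>x. x \<in> chart_image i \<Longrightarrow> f x = met i x v w"
    and f: "(f has_derivative f') (at x)"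
  shows "dmet i x a v w = f' a"
proof -
  have "((\<lambda>x. met i x v w) has_derivative f') (at x)"
    by (rule has_derivative_transform_within_open[OF f open_chart x]) (rule eq)
  from fun_cong[OF has_derivative_unique[OF met_has_derivative[OF x] this]] show ?thesis .
qed

lemma linear_dmet_dir: "x \<in> chart_image i \<Longrightarrow> linear (\<lambda>a. dmet i x a v w)"
  by (rule has_derivative_linear[OF met_has_derivative])

lemma dmet_sym: "x \<in> chart_image i \<Longrightarrow> dmet i x a v w = dmet i x a w v"
  by (rule dmet_eqI[OF _ _ met_has_derivative]) (auto simp: met_sym)

lemma linear_dmet_right:
  assumes x: "x \<in> chart_image i" shows "linear (dmet i x a v)"
proof (rule linearI)
  show "dmet i x a v (w + w') = dmet i x a v w + dmet i x a v w'" for w w'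
    by (rule dmet_eqI[OF x _ has_derivative_add[OF met_has_derivative[OF x] met_has_derivative[OF x]]])
       (simp add: linear_add[OF linear_met_right])
  show "dmet i x a v (r *\<^sub>R w) = r *\<^sub>R dmet i x a v w" for r w
    by (rule dmet_eqI[OF x _ has_derivative_scaleR_right[OF met_has_derivative[OF x]]])
       (simp add: linear_cmul[OF linear_met_right])
qed

lemma linear_dmet_left: "x \<in> chart_image i \<Longrightarrow> linear (\<lambda>v. dmet i x a v w)"
  using linear_dmet_right[of x i a w] by (simp add: dmet_sym[of x i a _ w])

lemma bilinear_expansion:
  fixes b :: "'e \<Rightarrow> 'e \<Rightarrow> real"
  assumes "\<And>v. linear (b v)" "\<And>w. linear (\<lambda>v. b v w)"
  shows "b v w = (\<Sum>k\<in>Basis. \<Sum>l\<in>Basis. (v \<bullet> k) * ((w \<bullet> l) * b k l))"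
proof -
  have "b v w = (\<Sum>k\<in>Basis. (v \<bullet> k) *\<^sub>R b k w)" by (rule linear_sum_Basis[OF assms(2)])
  also have "\<dots> = (\<Sum>k\<in>Basis. (v \<bullet> k) *\<^sub>R (\<Sum>l\<in>Basis. (w \<bullet> l) *\<^sub>R b k l))"
    by (simp only: linear_sum_Basis[OF assms(1), of _ w, symmetric])
  finally show ?thesis by (simp add: sum_distrib_left)
qed

lemma met_expansion:
  "x \<in> chart_image i \<Longrightarrow>
    met i x v w = (\<Sum>k\<in>Basis. \<Sum>l\<in>Basis. (v \<bullet> k) * ((w \<bullet> l) * met i x k l))"
  by (rule bilinear_expansion) (auto intro: linear_met_right linear_met_left)

lemma dmet_expansion:
  "x \<in> chart_image i \<Longrightarrow>
    dmet i x a v w = (\<Sum>k\<in>Basis. \<Sum>l\<in>Basis. (v \<bullet> k) * ((w \<bullet> l) * dmet i x a k l))"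
  by (rule bilinear_expansion) (auto intro: linear_dmet_right linear_dmet_left)

text \<open>
  The product rule for \<open>met i (X p) (V p) (W p)\<close>. Expansion in a basis reduces it to the differentiability
  of the finitely many components of the metric.
\<close>

lemma has_derivative_met:
  fixes X :: "'p::real_normed_vector \<Rightarrow> 'e"
  assumes x: "X p \<in> chart_image i"
    and X: "(X has_derivative X') (at p)" and V: "(V has_derivative V') (at p)"
    and W: "(W has_derivative W') (at p)"
  shows "((\<lambda>p. met i (X p) (V p) (W p)) has_derivative
    (\<lambda>h. dmet i (X p) (X' h) (V p) (W p) + met i (X p) (V' h) (W p) + met i (X p) (V p) (W' h))) (at p)"
proof -
  let ?f = "\<lambda>p. \<Sum>k\<in>Basis. \<Sum>l\<in>Basis. (V p \<bullet> k) * ((W p \<bullet> l) * met i (X p) k l)"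
  let ?f' = "\<lambda>h. \<Sum>k\<in>Basis. \<Sum>l\<in>Basis. (V p \<bullet> k) * ((W p \<bullet> l) * dmet i (X p) (X' h) k l
      + (W' h \<bullet> l) * met i (X p) k l) + (V' h \<bullet> k) * ((W p \<bullet> l) * met i (X p) k l)"
  have "(?f has_derivative ?f') (at p)"
    by (intro has_derivative_sum has_derivative_mult has_derivative_inner_left V W
        has_derivative_compose[OF X met_has_derivative[OF x]])
  moreover have "?f' = (\<lambda>h. dmet i (X p) (X' h) (V p) (W p) + met i (X p) (V' h) (W p)
      + met i (X p) (V p) (W' h))"
    by (simp add: fun_eq_iff met_expansion[OF x, of "V' _"] met_expansion[OF x, of _ "W' _"]
        dmet_expansion[OF x, of _ "V p"] distrib_left sum.distrib)
  ultimately have f: "(?f has_derivative (\<lambda>h. dmet i (X p) (X' h) (V p) (W p)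
      + met i (X p) (V' h) (W p) + met i (X p) (V p) (W' h))) (at p)"
    by simp
  have "\<exists>U. open U \<and> p \<in> U \<and> (\<forall>p\<in>U. X p \<in> chart_image i)"
    using has_derivative_continuous[OF X, unfolded continuous_at_open, rule_format, OF conjI[OF open_chart x]] .
  then obtain U where U: "open U" "p \<in> U" "\<And>p. p \<in> U \<Longrightarrow> X p \<in> chart_image i"
    by (elim exE conjE) blast
  show ?thesis
    by (rule has_derivative_transform_within_open[OF f U(1,2)]) (simp add: met_expansion[OF U(3)])
qed

lemma has_vector_derivative_met:
  assumes x: "x t \<in> chart_image i"
    and X: "(x has_vector_derivative x') (at t)" and V: "(v has_vector_derivative v') (at t)"
    and W: "(w has_vector_derivative w') (at t)"
  shows "((\<lambda>t. met i (x t) (v t) (w t)) has_vector_derivative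
    dmet i (x t) x' (v t) (w t) + met i (x t) v' (w t) + met i (x t) (v t) w') (at t)"
proof -
  let ?f' = "\<lambda>h. dmet i (x t) (h *\<^sub>R x') (v t) (w t) + met i (x t) (h *\<^sub>R v') (w t)
    + met i (x t) (v t) (h *\<^sub>R w')"
  have "((\<lambda>t. met i (x t) (v t) (w t)) has_derivative ?f') (at t)"
    by (rule has_derivative_met[where X = x and V = v and W = w, OF x
          X[unfolded has_vector_derivative_def] V[unfolded has_vector_derivative_def]
          W[unfolded has_vector_derivative_def]])
  moreover have "?f' = (\<lambda>h. h *\<^sub>R (dmet i (x t) x' (v t) (w t) + met i (x t) v' (w t) + met i (x t) (v t) w'))"
    by (simp add: linear_cmul[OF linear_dmet_dir[OF x]] linear_cmul[OF linear_met_left[OF x]]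
      linear_cmul[OF linear_met_right[OF x]] distrib_left)
  ultimately show ?thesis unfolding has_vector_derivative_def by (simp only:)
qed

lemma continuous_on_met:
  assumes x: "\<And>t. t \<in> T \<Longrightarrow> x t \<in> chart_image i"
    and c: "continuous_on T x" "continuous_on T v" "continuous_on T w"
  shows "continuous_on T (\<lambda>t. met i (x t) (v t) (w t))"
proof -
  have "continuous_on T (\<lambda>t. \<Sum>k\<in>Basis. \<Sum>l\<in>Basis. (v t \<bullet> k) * ((w t \<bullet> l) * met i (x t) k l))"
    by (intro continuous_intros c continuous_on_compose2[OF C1_on_continuous[OF met_C1] c(1)])
       (use x in auto)
  then show ?thesis by (rule continuous_on_eq) (simp add: met_expansion[OF x])
qed

lemma continuous_on_dmet:
  assumes x: "\<And>t. t \<in> T \<Longrightarrow> x t \<in> chart_image i"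
    and c: "continuous_on T x" "continuous_on T a" "continuous_on T v" "continuous_on T w"
  shows "continuous_on T (\<lambda>t. dmet i (x t) (a t) (v t) (w t))"
proof -
  have d: "continuous_on T (\<lambda>t. dmet i (x t) d k l)" for d k l
    unfolding dmet_def
    by (rule continuous_on_compose2[OF C1_on_frechet_continuous[OF met_C1] c(1)]) (use x in auto)
  have "continuous_on T (\<lambda>t. \<Sum>k\<in>Basis. \<Sum>l\<in>Basis. (v t \<bullet> k) * ((w t \<bullet> l) *
      (\<Sum>d\<in>Basis. (a t \<bullet> d) * dmet i (x t) d k l)))"
    by (intro continuous_intros c d)
  then show ?thesis
  proof (rule continuous_on_eq)
    fix t assume t: "t \<in> T"
    have "dmet i (x t) (a t) k l = (\<Sum>d\<in>Basis. (a t \<bullet> d) * dmet i (x t) d k l)" for k l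
      using linear_sum_Basis[OF linear_dmet_dir[OF x[OF t], of k l], of "a t"] by simp
    then show "(\<Sum>k\<in>Basis. \<Sum>l\<in>Basis. (v t \<bullet> k) * ((w t \<bullet> l) *
        (\<Sum>d\<in>Basis. (a t \<bullet> d) * dmet i (x t) d k l))) = dmet i (x t) (a t) (v t) (w t)"
      using dmet_expansion[OF x[OF t], of "a t" "v t" "w t"] by simp
  qed
qed

text \<open>The Christoffel symbols of the first kind.\<close>

definition christoffel1 :: "'i \<Rightarrow> 'e \<Rightarrow> 'e \<Rightarrow> 'e \<Rightarrow> 'e \<Rightarrow> real" where
  "christoffel1 i x v w y = (dmet i x v w y + dmet i x w v y - dmet i x y v w) / 2"

lemma christoffel_eqI:
  assumes x: "x \<in> chart_image i" and z: "\<And>y. met i x z y = christoffel1 i x v w y"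
  shows "christoffel M g i x v w = z"
  unfolding christoffel_def
proof (rule the_equality)
  show "\<forall>y. met i x z y = (frechet_derivative (\<lambda>x. met i x w y) (at x) v
    + frechet_derivative (\<lambda>x. met i x v y) (at x) w - frechet_derivative (\<lambda>x. met i x v w) (at x) y) / 2"
    using z by (simp add: christoffel1_def dmet_def)
  fix z' assume "\<forall>y. met i x z' y = (frechet_derivative (\<lambda>x. met i x w y) (at x) v
    + frechet_derivative (\<lambda>x. met i x v y) (at x) w - frechet_derivative (\<lambda>x. met i x v w) (at x) y) / 2"
  then show "z' = z"
    by (intro met_nondegenerate[OF x]) (simp add: z christoffel1_def dmet_def)
qed

text \<open>
  Riesz representation: \<open>z \<mapsto> met i x z\<close> is injective since the metric is positive definite, hence onto
  for reasons of dimension.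
\<close>

lemma met_represents:
  assumes x: "x \<in> chart_image i" and f: "linear f"
  obtains z where "\<And>y. met i x z y = f y"
proof -
  define A where "A = (\<lambda>z. \<Sum>b\<in>Basis. met i x z b *\<^sub>R b)"
  have A_inner: "A z \<bullet> b = met i x z b" if "b \<in> Basis" for z b
    using that by (simp add: A_def inner_sum_left inner_Basis if_distrib sum.delta cong: if_cong)
  have lin: "linear A"
    by (rule linearI)
       (auto simp: A_def linear_add[OF linear_met_left[OF x]] linear_cmul[OF linear_met_left[OF x]]
         scaleR_add_left sum.distrib scaleR_sum_right)
  have expand: "met i x z y = (\<Sum>b\<in>Basis. (y \<bullet> b) * (A z \<bullet> b))" for z y
    using linear_sum_Basis[OF linear_met_right[OF x, of z], of y] by (simp add: A_inner)
  have "inj A"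
    by (rule injI) (rule met_nondegenerate[OF x], simp add: expand)
  then have "surj A" using lin linear_injective_imp_surjective by blast
  then obtain z where z: "(\<Sum>b\<in>Basis. f b *\<^sub>R b) = A z" by (metis surjD)
  have "met i x z y = f y" for y
  proof -
    have "met i x z y = (\<Sum>b\<in>Basis. (y \<bullet> b) * ((\<Sum>b\<in>Basis. f b *\<^sub>R b) \<bullet> b))"
      unfolding z by (rule expand)
    also have "\<dots> = (\<Sum>b\<in>Basis. (y \<bullet> b) *\<^sub>R f b)"
      by (intro sum.cong) (auto simp: inner_sum_left inner_Basis if_distrib sum.delta cong: if_cong)
    also have "\<dots> = f y" by (rule linear_sum_Basis[OF f, symmetric])
    finally show ?thesis .
  qed
  then show thesis by (rule that)
qed

lemma met_christoffel:
  assumes x: "x \<in> chart_image i"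
  shows "met i x (christoffel M g i x v w) y = christoffel1 i x v w y"
proof -
  have "linear (christoffel1 i x v w)"
    by (rule linearI)
       (simp_all add: christoffel1_def linear_add[OF linear_dmet_right[OF x]]
         linear_add[OF linear_dmet_dir[OF x]] linear_cmul[OF linear_dmet_right[OF x]]
         linear_cmul[OF linear_dmet_dir[OF x]] field_simps)
  from met_represents[OF x this] obtain z where "\<And>y. met i x z y = christoffel1 i x v w y" by blast
  with christoffel_eqI[OF x this] show ?thesis by simp
qed

lemma christoffel_zero:
  assumes x: "x \<in> chart_image i" and "v = 0 \<or> w = 0"
  shows "christoffel M g i x v w = 0"
  by (rule christoffel_eqI[OF x])
     (use assms(2) in \<open>auto simp: christoffel1_def linear_0[OF linear_met_left[OF x]]
       linear_0[OF linear_dmet_left[OF x]] linear_0[OF linear_dmet_right[OF x]]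
       linear_0[OF linear_dmet_dir[OF x]]\<close>)

lemma tvec_trans: "q \<in> cdom M i \<Longrightarrow> q \<in> cdom M j \<Longrightarrow> tvec M j q (dtrans i j q v) = tvec M i q v"
  by (auto simp: fun_eq_iff tvec_eq dtrans_comp)

text \<open>
  The derivative of the transformation law of the metric, \<open>g\<^sub>i(x) (v, w) = g\<^sub>j(\<tau> x) (D\<tau> v, D\<tau> w)\<close>.
\<close>

lemma dmet_transition:
  assumes q: "q \<in> cdom M i" "q \<in> cdom M j"
  shows "dmet i (cmap M i q) a v w =
    dmet j (cmap M j q) (dtrans i j q a) (dtrans i j q v) (dtrans i j q w)
    + met j (cmap M j q) (ddtrans i j q v a) (dtrans i j q w)
    + met j (cmap M j q) (dtrans i j q v) (ddtrans i j q w a)"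
proof -
  let ?\<tau> = "\<lambda>x. cmap M j (cinv M i x)"
  let ?O = "cmap M i ` (cdom M i \<inter> cdom M j)"
  have d: "((\<lambda>x. frechet_derivative ?\<tau> (at x) v) has_derivative (\<lambda>a. ddtrans i j q v a)) (at (cmap M i q))"
    for v
    unfolding ddtrans_def
    using C1_on_has_derivative[OF smooth_on_C1[OF smooth_on_derivative[OF trans_smooth] open_overlap]] q
    by (simp add: in_overlap)
  have base: "frechet_derivative ?\<tau> (at (cmap M i q)) = dtrans i j q"
    by (simp add: dtrans_def)
  have "((\<lambda>x. met j (?\<tau> x) (frechet_derivative ?\<tau> (at x) v) (frechet_derivative ?\<tau> (at x) w)) has_derivative
    (\<lambda>a. dmet j (cmap M j q) (dtrans i j q a) (dtrans i j q v) (dtrans i j q w)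
      + met j (cmap M j q) (ddtrans i j q v a) (dtrans i j q w)
      + met j (cmap M j q) (dtrans i j q v) (ddtrans i j q w a))) (at (cmap M i q))"
    using has_derivative_met[OF _ dtrans_has_derivative[OF q] d[of v] d[of w], of j] q
    by (simp add: base)
  then have "((\<lambda>x. met i x v w) has_derivative
    (\<lambda>a. dmet j (cmap M j q) (dtrans i j q a) (dtrans i j q v) (dtrans i j q w)
      + met j (cmap M j q) (ddtrans i j q v a) (dtrans i j q w)
      + met j (cmap M j q) (dtrans i j q v) (ddtrans i j q w a))) (at (cmap M i q))"
  proof (rule has_derivative_transform_within_open[OF _ open_overlap])
    show "cmap M i q \<in> ?O" using q by simp
    fix x assume "x \<in> ?O"
    then obtain p where p: "x = cmap M i p" "p \<in> cdom M i" "p \<in> cdom M j" by auto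
    then have "frechet_derivative ?\<tau> (at x) = dtrans i j p" by (simp add: dtrans_def)
    then show "met j (?\<tau> x) (frechet_derivative ?\<tau> (at x) v) (frechet_derivative ?\<tau> (at x) w) = met i x v w"
      using p by (simp add: metric_rep_def tvec_trans)
  qed
  from fun_cong[OF has_derivative_unique[OF met_has_derivative this]] show ?thesis using q by simp
qed

text \<open>
  The transformation law of the Christoffel symbols. Its inhomogeneous term cancels the one in the
  transformation law of the derivative of a vector field.
\<close>

lemma christoffel_transition:
  assumes q: "q \<in> cdom M i" "q \<in> cdom M j"
  shows "dtrans i j q (christoffel M g i (cmap M i q) v w) =
    christoffel M g j (cmap M j q) (dtrans i j q v) (dtrans i j q w) + ddtrans i j q v w"
proof -
  let ?D = "dtrans i j q" and ?x = "cmap M i q" and ?y = "cmap M j q"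
  have x: "?x \<in> chart_image i" and y: "?y \<in> chart_image j" using q by auto
  have "met j ?y (?D (christoffel M g i ?x v w) - ddtrans i j q v w) z = christoffel1 j ?y (?D v) (?D w) z"
    for z
  proof -
    define u where "u = dtrans j i q z"
    have z: "z = ?D u" using dtrans_comp[OF q(2) q(1) q(2), of z] dtrans_id[OF q(2)] by (simp add: u_def)
    have "met i ?x (christoffel M g i ?x v w) u = met j ?y (?D (christoffel M g i ?x v w)) z"
      using q by (simp add: metric_rep_def tvec_trans z)
    then have "met j ?y (?D (christoffel M g i ?x v w)) z = christoffel1 i ?x v w u"
      by (simp add: met_christoffel[OF x])
    also have "\<dots> = christoffel1 j ?y (?D v) (?D w) z + met j ?y (ddtrans i j q v w) z"
      unfolding christoffel1_def dmet_transition[OF q] z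
      using ddtrans_sym[OF q, of w v] ddtrans_sym[OF q, of u v] ddtrans_sym[OF q, of u w]
        met_sym[OF y, of "?D v" "ddtrans i j q w u"] met_sym[OF y, of "?D w" "ddtrans i j q v u"]
      by (simp add: field_simps)
    finally show ?thesis by (simp add: linear_diff[OF linear_met_left[OF y]])
  qed
  from christoffel_eqI[OF y this] show ?thesis by simp
qed

lemma levi_civita_tangent:
  assumes X: "vector_field M X" and Y: "vector_field M Y" and q: "q \<in> points M"
  shows "levi_civita M g X Y q \<in> tangent_space M q"
  unfolding tangent_space_iff
proof (intro conjI allI impI)
  fix i j assume ij: "q \<in> cdom M i" "q \<in> cdom M j"
  note tX = tangent_trans[OF vector_field_tangent[OF X q] ij]
    and tY = tangent_trans[OF vector_field_tangent[OF Y q] ij]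
  have "levi_civita M g X Y q j = vf_deriv M Y j q (dtrans i j q (X q i))
      + christoffel M g j (cmap M j q) (dtrans i j q (X q i)) (dtrans i j q (Y q i))"
    using ij(2) by (simp only: levi_civita_def if_True tX[symmetric] tY[symmetric])
  also have "\<dots> = dtrans i j q (vf_deriv M Y i q (X q i))
      + dtrans i j q (christoffel M g i (cmap M i q) (X q i) (Y q i))"
    unfolding vf_deriv_transition[OF Y ij] christoffel_transition[OF ij] ddtrans_sym[OF ij, of "X q i"]
    by simp
  also have "\<dots> = dtrans i j q (levi_civita M g X Y q i)"
    using ij(1) by (simp add: levi_civita_def linear_add[OF linear_dtrans[OF ij]])
  finally show "levi_civita M g X Y q j = dtrans i j q (levi_civita M g X Y q i)" .
qed (simp add: levi_civita_def)

end


section \<open>The frame, the orthogonal projections and the connection\<close>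

lemma sum_apply: "(\<Sum>k\<in>K. f k) x = (\<Sum>k\<in>K. f k x)"
  by (induction K rule: infinite_finite_induct) (auto simp: plus_fun_def)

lemma scaleR_apply [simp]: "(r *\<^sub>R f) x = r *\<^sub>R f x"
  by (simp add: scaleR_fun_def)

lemma frechet_derivative_cong_open:
  assumes "open S" "x \<in> S" "\<And>y. y \<in> S \<Longrightarrow> f y = f' y"
  shows "frechet_derivative f (at x) = frechet_derivative f' (at x)"
proof -
  have "(f has_derivative D) (at x) \<longleftrightarrow> (f' has_derivative D) (at x)" for D
    using has_derivative_transform_within_open[OF _ assms(1,2), of f D UNIV f']
      has_derivative_transform_within_open[OF _ assms(1,2), of f' D UNIV f] assms(3)
    by auto
  then show ?thesis unfolding frechet_derivative_def by simp
qed

text \<open>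
  The projection of a frame field is again a frame field or zero, but only at points of the
  manifold; its unspecified values elsewhere do not influence derivatives.
\<close>

lemma (in smooth_atlas) vf_deriv_cong:
  assumes "\<And>p. p \<in> points M \<Longrightarrow> X p = Y p" "q \<in> cdom M i"
  shows "vf_deriv M X i q = vf_deriv M Y i q"
proof -
  have "frechet_derivative (\<lambda>x. X (cinv M i x) i) (at (cmap M i q)) =
      frechet_derivative (\<lambda>x. Y (cinv M i x) i) (at (cmap M i q))"
    by (rule frechet_derivative_cong_open[OF open_chart])
       (use assms points_I in auto)
  then show ?thesis by (simp add: vf_deriv_def[abs_def])
qed

lemma (in smooth_atlas) vf_deriv_zero: "vf_deriv M (\<lambda>_. 0) i q = (\<lambda>_. 0)"
  unfolding vf_deriv_def[abs_def] by (simp add: frechet_derivative_const)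

lemma (in smooth_atlas) lie_bracket_cong:
  assumes "\<And>p. p \<in> points M \<Longrightarrow> X p = X' p" "\<And>p. p \<in> points M \<Longrightarrow> Y p = Y' p" "q \<in> points M"
  shows "lie_bracket M X Y q = lie_bracket M X' Y' q"
  using vf_deriv_cong[OF assms(1)] vf_deriv_cong[OF assms(2)] assms
  by (auto simp: lie_bracket_def fun_eq_iff)

lemma (in smooth_atlas) lie_bracket_zero:
  assumes "vector_field M X"
  shows "lie_bracket M X (\<lambda>_. 0) q = 0" "lie_bracket M (\<lambda>_. 0) X q = 0"
  using linear_0[OF has_derivative_linear[OF vf_deriv_has_derivative[OF assms]]]
  by (auto simp: lie_bracket_def fun_eq_iff vf_deriv_zero)

lemma (in riemannian_atlas) levi_civita_cong:
  assumes "\<And>p. p \<in> points M \<Longrightarrow> X p = X' p" "\<And>p. p \<in> points M \<Longrightarrow> Y p = Y' p" "q \<in> points M"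
  shows "levi_civita M g X Y q = levi_civita M g X' Y' q"
  using vf_deriv_cong[OF assms(2)] assms by (auto simp: levi_civita_def fun_eq_iff)

lemma (in riemannian_atlas) levi_civita_zero:
  assumes "vector_field M X"
  shows "levi_civita M g X (\<lambda>_. 0) q = 0" "levi_civita M g (\<lambda>_. 0) X q = 0"
  using linear_0[OF has_derivative_linear[OF vf_deriv_has_derivative[OF assms]]]
  by (auto simp: levi_civita_def fun_eq_iff vf_deriv_zero christoffel_zero)

lemma (in riemannian_atlas) orth_proj_eqI:
  assumes q: "q \<in> points M" and S: "subspace (S q)" "S q \<subseteq> tangent_space M q"
    and v: "X q \<in> tangent_space M q" and u: "u \<in> S q" and orth: "\<And>s. s \<in> S q \<Longrightarrow> g q (X q - u) s = 0"
  shows "orth_proj g S X q = u"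
  unfolding orth_proj_def
proof (rule the_equality)
  show "u \<in> S q \<and> (\<forall>s\<in>S q. g q (X q - u) s = 0)" using u orth by blast
  fix u' assume u': "u' \<in> S q \<and> (\<forall>s\<in>S q. g q (X q - u') s = 0)"
  note sub = subspace_tangent_space[of q]
  have mem: "u' - u \<in> S q" using u u' by (simp add: subspace_diff[OF S(1)])
  then have t: "u' - u \<in> tangent_space M q" using S(2) by blast
  have t1: "X q - u \<in> tangent_space M q" "X q - u' \<in> tangent_space M q"
    using u u' S(2) v subspace_diff[OF sub] by blast+
  have "g q (u' - u) (X q - u) = 0"
    using g_sym[OF q t t1(1)] orth[OF mem] by simp
  moreover have "g q (u' - u) (- 1 *\<^sub>R (X q - u')) = 0"
    using g_sym[OF q t t1(2)] u' mem g_scaleR_right[OF q t t1(2), of "- 1"] by simp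
  ultimately have "g q (u' - u) ((X q - u) + (- 1 *\<^sub>R (X q - u'))) = 0"
    by (simp only: g_add_right[OF q t t1(1) subspace_scale[OF sub t1(2)]] add_0)
  moreover have "(X q - u) + (- 1 *\<^sub>R (X q - u')) = u' - u" by simp
  ultimately have "g q (u' - u) (u' - u) = 0" by (simp only:)
  then show "u' = u" using g_pos[OF q t t] by force
qed

locale nonholonomic_system = riemannian_atlas M g
  for M :: "('i, 'q, real^'n) atlas"
    and g :: "'q \<Rightarrow> ('i \<Rightarrow> real^'n) \<Rightarrow> ('i \<Rightarrow> real^'n) \<Rightarrow> real" +
  fixes D :: "'q \<Rightarrow> ('i \<Rightarrow> real^'n) set"
    and E :: "'n \<Rightarrow> 'q \<Rightarrow> 'i \<Rightarrow> real^'n"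
    and A :: "'n set"
    and \<Gamma> :: "'q \<times> ('i \<Rightarrow> real^'n) \<Rightarrow> 'i \<Rightarrow> (real^'n) \<times> (real^'n)"
  assumes frame: "adapted_frame M g D E A"
    and nonholonomic: "nonholonomic_field M D E A (kinetic g) \<Gamma>"
begin

lemma E_field: "vector_field M (E \<alpha>)"
  using frame by (simp add: adapted_frame_def)

abbreviation coeff :: "'q \<Rightarrow> ('i \<Rightarrow> real^'n) \<Rightarrow> 'n \<Rightarrow> real" where
  "coeff \<equiv> frame_coeff E"

lemma
  assumes "q \<in> points M"
  shows frame_inj: "inj (\<lambda>\<alpha>. E \<alpha> q)"
    and frame_independent: "independent (range (\<lambda>\<alpha>. E \<alpha> q))"
    and frame_span: "tangent_space M q = span (range (\<lambda>\<alpha>. E \<alpha> q))"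
    and D_span: "D q = span ((\<lambda>\<alpha>. E \<alpha> q) ` A)"
    and D_orth_span: "orth_compl M g D q = span ((\<lambda>\<alpha>. E \<alpha> q) ` (- A))"
  using frame assms by (simp_all add: adapted_frame_def)

lemma frame_combination_unique:
  assumes q: "q \<in> points M" and eq: "(\<Sum>\<alpha>\<in>UNIV. c \<alpha> *\<^sub>R E \<alpha> q) = (\<Sum>\<alpha>\<in>UNIV. c' \<alpha> *\<^sub>R E \<alpha> q)"
  shows "c = c'"
proof
  fix \<alpha>
  let ?e = "\<lambda>\<alpha>. E \<alpha> q"
  let ?d = "\<lambda>v. c (inv ?e v) - c' (inv ?e v)"
  have "(\<Sum>v\<in>range ?e. ?d v *\<^sub>R v) = (\<Sum>\<alpha>\<in>UNIV. (c \<alpha> - c' \<alpha>) *\<^sub>R E \<alpha> q)"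
    by (subst sum.reindex[OF frame_inj[OF q]]) (simp add: inv_f_f[OF frame_inj[OF q]])
  also have "\<dots> = 0" using eq by (simp add: scaleR_left_diff_distrib sum_subtractf)
  finally have "?d (?e \<alpha>) = 0"
    by (intro independentD[OF frame_independent[OF q], of "range ?e"]) auto
  then show "c \<alpha> = c' \<alpha>" by (simp add: inv_f_f[OF frame_inj[OF q]])
qed

lemma span_frame:
  assumes q: "q \<in> points M" and v: "v \<in> span ((\<lambda>\<alpha>. E \<alpha> q) ` B)"
  obtains c where "v = (\<Sum>\<alpha>\<in>UNIV. c \<alpha> *\<^sub>R E \<alpha> q)" "\<And>\<alpha>. \<alpha> \<notin> B \<Longrightarrow> c \<alpha> = 0"
proof -
  let ?e = "\<lambda>\<alpha>. E \<alpha> q"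
  obtain u where "v = (\<Sum>w\<in>?e ` B. u w *\<^sub>R w)"
    using v span_finite[of "?e ` B"] by auto
  also have "\<dots> = (\<Sum>\<alpha>\<in>B. u (E \<alpha> q) *\<^sub>R E \<alpha> q)"
    by (subst sum.reindex) (auto intro: inj_on_subset[OF frame_inj[OF q]])
  also have "\<dots> = (\<Sum>\<alpha>\<in>UNIV. (if \<alpha> \<in> B then u (E \<alpha> q) else 0) *\<^sub>R E \<alpha> q)"
    by (rule sum.mono_neutral_cong_left) auto
  finally show thesis by (rule that) simp
qed

lemma coeff_eqI:
  assumes "q \<in> points M" "v = (\<Sum>\<alpha>\<in>UNIV. c \<alpha> *\<^sub>R E \<alpha> q)" shows "coeff q v = c"
  unfolding frame_coeff_def using assms frame_combination_unique[OF assms(1)]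
  by (intro the_equality) auto

lemma coeff_expansion:
  assumes q: "q \<in> points M" and v: "v \<in> tangent_space M q"
  shows "(\<Sum>\<alpha>\<in>UNIV. coeff q v \<alpha> *\<^sub>R E \<alpha> q) = v"
proof -
  have "v \<in> span ((\<lambda>\<alpha>. E \<alpha> q) ` UNIV)" using v frame_span[OF q] by simp
  then obtain c where "v = (\<Sum>\<alpha>\<in>UNIV. c \<alpha> *\<^sub>R E \<alpha> q)" by (rule span_frame[OF q])
  then show ?thesis using coeff_eqI[OF q] by simp
qed

lemma frame_combination_span:
  "(\<And>\<alpha>. \<alpha> \<notin> B \<Longrightarrow> c \<alpha> = 0) \<Longrightarrow> (\<Sum>\<alpha>\<in>UNIV. c \<alpha> *\<^sub>R E \<alpha> q) \<in> span ((\<lambda>\<alpha>. E \<alpha> q) ` B)"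
proof (rule span_sum)
  fix \<alpha> assume "\<And>\<alpha>. \<alpha> \<notin> B \<Longrightarrow> c \<alpha> = 0"
  then show "c \<alpha> *\<^sub>R E \<alpha> q \<in> span ((\<lambda>\<alpha>. E \<alpha> q) ` B)"
    by (cases "\<alpha> \<in> B") (auto intro: span_scale span_base span_zero)
qed

lemma frame_combination_tangent:
  "q \<in> points M \<Longrightarrow> (\<Sum>\<alpha>\<in>UNIV. c \<alpha> *\<^sub>R E \<alpha> q) \<in> tangent_space M q"
  using frame_combination_span[of UNIV c q] by (simp add: frame_span)

lemma coeff_combination: "q \<in> points M \<Longrightarrow> coeff q (\<Sum>\<alpha>\<in>UNIV. c \<alpha> *\<^sub>R E \<alpha> q) = c"
  by (rule coeff_eqI) auto

lemma coeff_linear: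
  assumes q: "q \<in> points M" and u: "u \<in> tangent_space M q"
  shows "v \<in> tangent_space M q \<Longrightarrow> coeff q (u + v) \<alpha> = coeff q u \<alpha> + coeff q v \<alpha>"
    and "coeff q (r *\<^sub>R u) \<alpha> = r * coeff q u \<alpha>"
proof -
  assume v: "v \<in> tangent_space M q"
  have "u + v = (\<Sum>\<alpha>\<in>UNIV. (coeff q u \<alpha> + coeff q v \<alpha>) *\<^sub>R E \<alpha> q)"
    by (simp add: scaleR_add_left sum.distrib coeff_expansion[OF q u] coeff_expansion[OF q v])
  from coeff_eqI[OF q this] show "coeff q (u + v) \<alpha> = coeff q u \<alpha> + coeff q v \<alpha>" by simp
next
  have "r *\<^sub>R u = (\<Sum>\<alpha>\<in>UNIV. (r * coeff q u \<alpha>) *\<^sub>R E \<alpha> q)"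
    by (simp add: scaleR_sum_right[symmetric] scaleR_scaleR[symmetric] coeff_expansion[OF q u]
        del: scaleR_scaleR)
  from coeff_eqI[OF q this] show "coeff q (r *\<^sub>R u) \<alpha> = r * coeff q u \<alpha>" by simp
qed

lemma span_frame_iff:
  assumes q: "q \<in> points M"
  shows "v \<in> span ((\<lambda>\<alpha>. E \<alpha> q) ` B) \<longleftrightarrow>
    v \<in> tangent_space M q \<and> (\<forall>\<alpha>. \<alpha> \<notin> B \<longrightarrow> coeff q v \<alpha> = 0)" (is "?l \<longleftrightarrow> ?r")
proof
  assume ?l
  then obtain c where c: "v = (\<Sum>\<alpha>\<in>UNIV. c \<alpha> *\<^sub>R E \<alpha> q)" "\<And>\<alpha>. \<alpha> \<notin> B \<Longrightarrow> c \<alpha> = 0"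
    by (rule span_frame[OF q]) blast
  then show ?r using frame_combination_tangent[OF q, of c] coeff_combination[OF q, of c] by simp
next
  assume r: ?r
  then have "(\<Sum>\<alpha>\<in>UNIV. coeff q v \<alpha> *\<^sub>R E \<alpha> q) \<in> span ((\<lambda>\<alpha>. E \<alpha> q) ` B)"
    by (intro frame_combination_span) simp
  then show ?l using r coeff_expansion[OF q] by simp
qed

lemma D_iff: "q \<in> points M \<Longrightarrow>
    v \<in> D q \<longleftrightarrow> v \<in> tangent_space M q \<and> (\<forall>\<alpha>. \<alpha> \<notin> A \<longrightarrow> coeff q v \<alpha> = 0)"
  and D_orth_iff: "q \<in> points M \<Longrightarrow>
    v \<in> orth_compl M g D q \<longleftrightarrow> v \<in> tangent_space M q \<and> (\<forall>\<alpha>. \<alpha> \<in> A \<longrightarrow> coeff q v \<alpha> = 0)"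
  using span_frame_iff[of q v A] span_frame_iff[of q v "- A"] by (simp_all add: D_span D_orth_span)

lemma D_tangent: "q \<in> points M \<Longrightarrow> v \<in> D q \<Longrightarrow> v \<in> tangent_space M q"
  and D_orth_tangent: "q \<in> points M \<Longrightarrow> v \<in> orth_compl M g D q \<Longrightarrow> v \<in> tangent_space M q"
  by (simp_all add: D_iff D_orth_iff)

lemma subspace_D: "q \<in> points M \<Longrightarrow> subspace (D q)"
  and subspace_D_orth: "q \<in> points M \<Longrightarrow> subspace (orth_compl M g D q)"
  by (simp_all add: D_span D_orth_span)

lemma E_in_D: "q \<in> points M \<Longrightarrow> a \<in> A \<Longrightarrow> E a q \<in> D q"
  and E_in_D_orth: "q \<in> points M \<Longrightarrow> k \<notin> A \<Longrightarrow> E k q \<in> orth_compl M g D q"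
  by (simp_all add: D_span D_orth_span span_base)

lemma g_D_orth: "q \<in> points M \<Longrightarrow> u \<in> D q \<Longrightarrow> w \<in> orth_compl M g D q \<Longrightarrow> g q u w = 0"
  by (simp add: orth_compl_def)

lemma orth_decomposition:
  assumes q: "q \<in> points M" and v: "v \<in> tangent_space M q"
  obtains u w where "u \<in> D q" "w \<in> orth_compl M g D q" "v = u + w"
    and "w = (\<Sum>\<alpha>\<in>UNIV. (if \<alpha> \<in> A then 0 else coeff q v \<alpha>) *\<^sub>R E \<alpha> q)"
proof -
  let ?u = "\<Sum>\<alpha>\<in>UNIV. (if \<alpha> \<in> A then coeff q v \<alpha> else 0) *\<^sub>R E \<alpha> q"
  let ?w = "\<Sum>\<alpha>\<in>UNIV. (if \<alpha> \<in> A then 0 else coeff q v \<alpha>) *\<^sub>R E \<alpha> q"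
  have "?u + ?w = (\<Sum>\<alpha>\<in>UNIV. coeff q v \<alpha> *\<^sub>R E \<alpha> q)"
    by (simp add: sum.distrib[symmetric] if_distrib[where f = "\<lambda>r. r *\<^sub>R _"] cong: if_cong)
       (intro sum.cong, auto)
  then have "v = ?u + ?w" using coeff_expansion[OF q v] by simp
  moreover have "?u \<in> D q" unfolding D_span[OF q] by (rule frame_combination_span) simp
  moreover have "?w \<in> orth_compl M g D q"
    unfolding D_orth_span[OF q] by (rule frame_combination_span) simp
  ultimately show thesis using that by blast
qed

lemma
  assumes q: "q \<in> points M" and X: "X q = u + w" and u: "u \<in> D q" and w: "w \<in> orth_compl M g D q"
  shows orth_proj_D: "orth_proj g D X q = u"
    and orth_proj_D_orth: "orth_proj g (orth_compl M g D) X q = w"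
proof -
  note tu = D_tangent[OF q u] and tw = D_orth_tangent[OF q w]
  have t: "X q \<in> tangent_space M q" using tu tw by (simp add: X subspace_add[OF subspace_tangent_space])
  show "orth_proj g D X q = u"
  proof (rule orth_proj_eqI[of q D X u, OF q subspace_D[OF q] _ t u])
    show "D q \<subseteq> tangent_space M q" using D_tangent[OF q] by blast
    show "g q (X q - u) s = 0" if "s \<in> D q" for s
      using g_sym[OF q tw D_tangent[OF q that]] g_D_orth[OF q that w] by (simp add: X)
  qed
  show "orth_proj g (orth_compl M g D) X q = w"
  proof (rule orth_proj_eqI[of q "orth_compl M g D" X w, OF q subspace_D_orth[OF q] _ t w])
    show "orth_compl M g D q \<subseteq> tangent_space M q" using D_orth_tangent[OF q] by blast
    show "g q (X q - w) s = 0" if "s \<in> orth_compl M g D q" for s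
      using g_D_orth[OF q u that] by (simp add: X)
  qed
qed

lemma zero_in_D: "q \<in> points M \<Longrightarrow> 0 \<in> D q" and zero_in_D_orth: "q \<in> points M \<Longrightarrow> 0 \<in> orth_compl M g D q"
  by (simp_all add: subspace_0[OF subspace_D] subspace_0[OF subspace_D_orth])

lemma vector_field_zero: "vector_field M (\<lambda>_. 0)"
proof -
  have "Ck_on k S (\<lambda>_. 0 :: real^'n)" for k and S :: "(real^'n) set"
    by (induction k) (auto simp: frechet_derivative_const)
  then show ?thesis
    by (simp add: vector_field_def smooth_on_def subspace_0[OF subspace_tangent_space])
qed

text \<open>
  For \<open>X\<close> in \<open>D\<close> only the first and the last of the four terms of the connection survive, and of
  these the first is all there is for \<open>Y\<close> in \<open>D\<close>, the last all there is for \<open>Y\<close> orthogonal to \<open>D\<close>.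
\<close>

lemma nabla_bar_frame:
  assumes q: "q \<in> points M" and b: "b \<in> A"
  shows nabla_bar_D: "k \<in> A \<Longrightarrow> nabla_bar M g D (E b) (E k) q \<in> D q"
    and nabla_bar_D_orth: "k \<notin> A \<Longrightarrow> nabla_bar M g D (E b) (E k) q =
      (\<Sum>\<alpha>\<in>UNIV. (if \<alpha> \<in> A then 0 else coeff q (lie_bracket M (E b) (E k) q) \<alpha>) *\<^sub>R E \<alpha> q)"
proof -
  let ?P = "orth_proj g D" and ?Q = "orth_proj g (orth_compl M g D)"
  have P0: "?P Z q = 0" and Q0: "?Q Z q = 0" if "Z q = 0" for Z
    using orth_proj_D[OF q, of Z 0 0] orth_proj_D_orth[OF q, of Z 0 0] that zero_in_D[OF q] zero_in_D_orth[OF q]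
    by simp_all
  have PA: "?P (E a) p = E a p" "?Q (E a) p = 0" if "a \<in> A" "p \<in> points M" for a p
    using orth_proj_D[OF that(2), of "E a" "E a p" 0] orth_proj_D_orth[OF that(2), of "E a" "E a p" 0]
      E_in_D[OF that(2,1)] zero_in_D_orth[OF that(2)] by simp_all
  have QA: "?P (E k) p = 0" "?Q (E k) p = E k p" if "k \<notin> A" "p \<in> points M" for k p
    using orth_proj_D[OF that(2), of "E k" 0 "E k p"] orth_proj_D_orth[OF that(2), of "E k" 0 "E k p"]
      E_in_D_orth[OF that(2,1)] zero_in_D[OF that(2)] by simp_all
  note lc = levi_civita_cong[OF _ _ q] and lb = lie_bracket_cong[OF _ _ q]
  note zero = levi_civita_zero[OF E_field] levi_civita_zero[OF vector_field_zero]
    lie_bracket_zero[OF E_field] lie_bracket_zero[OF vector_field_zero]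
  {
    assume k: "k \<in> A"
    have "levi_civita M g (?P (E b)) (?P (E k)) q = levi_civita M g (E b) (E k) q"
      by (rule lc) (simp_all add: PA b k)
    then have t: "levi_civita M g (?P (E b)) (?P (E k)) q \<in> tangent_space M q"
      using levi_civita_tangent[OF E_field E_field q] by simp
    have "lie_bracket M (?Q (E b)) (?P (E k)) q = lie_bracket M (\<lambda>_. 0) (E k) q"
      by (rule lb) (simp_all add: PA b k)
    moreover have "levi_civita M g (?Q (E b)) (?Q (E k)) q = levi_civita M g (\<lambda>_. 0) (\<lambda>_. 0) q"
      by (rule lc) (simp_all add: PA b k)
    moreover have "lie_bracket M (?P (E b)) (?Q (E k)) q = lie_bracket M (E b) (\<lambda>_. 0) q"
      by (rule lb) (simp_all add: PA b k)
    ultimately have "nabla_bar M g D (E b) (E k) q = ?P (levi_civita M g (?P (E b)) (?P (E k))) q"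
      by (simp add: nabla_bar_def Let_def plus_fun_def P0 Q0 zero)
    also have "\<dots> \<in> D q"
    proof -
      obtain u w where uw: "u \<in> D q" "w \<in> orth_compl M g D q"
        "levi_civita M g (?P (E b)) (?P (E k)) q = u + w"
        by (rule orth_decomposition[OF q t])
      from orth_proj_D[of q "levi_civita M g (?P (E b)) (?P (E k))" u w, OF q uw(3,1,2)] uw(1)
      show ?thesis by simp
    qed
    finally show "nabla_bar M g D (E b) (E k) q \<in> D q" .
  next
    assume k: "k \<notin> A"
    have "levi_civita M g (?P (E b)) (?P (E k)) q = levi_civita M g (E b) (\<lambda>_. 0) q"
      by (rule lc) (simp_all add: PA QA b k)
    moreover have "lie_bracket M (?Q (E b)) (?P (E k)) q = lie_bracket M (\<lambda>_. 0) (\<lambda>_. 0) q"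
      by (rule lb) (simp_all add: PA QA b k)
    moreover have "levi_civita M g (?Q (E b)) (?Q (E k)) q = levi_civita M g (\<lambda>_. 0) (E k) q"
      by (rule lc) (simp_all add: PA QA b k)
    ultimately have "nabla_bar M g D (E b) (E k) q = ?Q (lie_bracket M (?P (E b)) (?Q (E k))) q"
      by (simp add: nabla_bar_def Let_def plus_fun_def P0 Q0 zero)
    moreover have "lie_bracket M (?P (E b)) (?Q (E k)) q = lie_bracket M (E b) (E k) q"
      by (rule lb) (simp_all add: PA QA b k)
    moreover obtain u w where uw: "u \<in> D q" "w \<in> orth_compl M g D q"
      "lie_bracket M (E b) (E k) q = u + w"
      and w: "w = (\<Sum>\<alpha>\<in>UNIV. (if \<alpha> \<in> A then 0 else coeff q (lie_bracket M (E b) (E k) q) \<alpha>) *\<^sub>R E \<alpha> q)"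
      by (rule orth_decomposition[OF q lie_bracket_tangent[OF E_field E_field q, of b k]])
    ultimately have "nabla_bar M g D (E b) (E k) q = w"
      using orth_proj_D_orth[of q "lie_bracket M (?P (E b)) (?Q (E k))" u w, OF q _ uw(1,2)] by simp
    then show "nabla_bar M g D (E b) (E k) q =
      (\<Sum>\<alpha>\<in>UNIV. (if \<alpha> \<in> A then 0 else coeff q (lie_bracket M (E b) (E k) q) \<alpha>) *\<^sub>R E \<alpha> q)"
      using w by (simp only:)
  }
qed

end


section \<open>The nonholonomic vector field in a chart\<close>

context nonholonomic_system
begin

text \<open>
  The coefficients of the vertical lifts in the nonholonomic field, extended smoothly to the whole
  tangent bundle. The extension is not unique; any one serves to make the equations of motion smooth in
  an open set.
\<close>

definition force :: "'n \<Rightarrow> 'q \<times> ('i \<Rightarrow> real^'n) \<Rightarrow> real" where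
  "force = (SOME F. (\<forall>a\<in>A. smooth_fun (tangent_bundle M) (F a)) \<and>
     (\<forall>p\<in>constraint_mfd M D. \<Gamma> p = (\<Sum>a\<in>A. coeff (fst p) (snd p) a *\<^sub>R complete_lift M (E a) p
        + F a p *\<^sub>R vertical_lift M (E a) p)))"

lemma force_smooth: "a \<in> A \<Longrightarrow> smooth_fun (tangent_bundle M) (force a)"
  and \<Gamma>_lifts: "q \<in> points M \<Longrightarrow> v \<in> D q \<Longrightarrow> \<Gamma> (q, v) =
    (\<Sum>a\<in>A. coeff q v a *\<^sub>R complete_lift M (E a) (q, v) + force a (q, v) *\<^sub>R vertical_lift M (E a) (q, v))"
proof -
  have "\<exists>F. (\<forall>a\<in>A. smooth_fun (tangent_bundle M) (F a)) \<and>
     (\<forall>p\<in>constraint_mfd M D. \<Gamma> p = (\<Sum>a\<in>A. coeff (fst p) (snd p) a *\<^sub>R complete_lift M (E a) p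
        + F a p *\<^sub>R vertical_lift M (E a) p))"
    using nonholonomic unfolding nonholonomic_field_def by (rule conjunct1)
  note F = someI_ex[OF this, folded force_def]
  show "a \<in> A \<Longrightarrow> smooth_fun (tangent_bundle M) (force a)" using F by blast
  assume "q \<in> points M" "v \<in> D q"
  then have "(q, v) \<in> constraint_mfd M D" by (simp add: constraint_mfd_def)
  from F[THEN conjunct2, rule_format, OF this] show "\<Gamma> (q, v) =
    (\<Sum>a\<in>A. coeff q v a *\<^sub>R complete_lift M (E a) (q, v) + force a (q, v) *\<^sub>R vertical_lift M (E a) (q, v))"
    by simp
qed

lemma D_expansion:
  assumes q: "q \<in> points M" and v: "v \<in> D q"
  shows "v = (\<Sum>a\<in>A. coeff q v a *\<^sub>R E a q)"
proof -
  have "v = (\<Sum>\<alpha>\<in>UNIV. coeff q v \<alpha> *\<^sub>R E \<alpha> q)" using coeff_expansion[OF q D_tangent[OF q v]] by simp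
  also have "\<dots> = (\<Sum>a\<in>A. coeff q v a *\<^sub>R E a q)"
    using v by (intro sum.mono_neutral_right) (auto simp: D_iff[OF q])
  finally show ?thesis .
qed

lemma \<Gamma>_tangent:
  assumes q: "q \<in> points M" and v: "v \<in> D q"
  shows "\<Gamma> (q, v) \<in> tangent_space (tangent_bundle M) (q, v)"
  unfolding \<Gamma>_lifts[OF assms]
  by (intro subspace_sum subspace_add subspace_scale TM.subspace_tangent_space
      complete_lift_tangent vertical_lift_tangent E_field q D_tangent[OF q v])

definition acceleration :: "'i \<Rightarrow> 'q \<Rightarrow> ('i \<Rightarrow> real^'n) \<Rightarrow> real^'n" where
  "acceleration i q v = (\<Sum>a\<in>A. coeff q v a *\<^sub>R vf_deriv M (E a) i q (v i) + force a (q, v) *\<^sub>R E a q i)"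

lemma \<Gamma>_chart:
  assumes q: "q \<in> cdom M i" and v: "v \<in> D q"
  shows "\<Gamma> (q, v) i = (v i, acceleration i q v)"
proof -
  have p: "q \<in> points M" by (rule points_I[OF q])
  have "\<Gamma> (q, v) i = (\<Sum>a\<in>A. (coeff q v a *\<^sub>R E a q i,
      coeff q v a *\<^sub>R vf_deriv M (E a) i q (v i) + force a (q, v) *\<^sub>R E a q i))"
    unfolding \<Gamma>_lifts[OF p v]
    by (simp add: sum_apply plus_fun_def complete_lift_def vertical_lift_def q)
  also have "\<dots> = (\<Sum>a\<in>A. coeff q v a *\<^sub>R E a q i, acceleration i q v)"
    by (simp add: acceleration_def sum_prod)
  also have "(\<Sum>a\<in>A. coeff q v a *\<^sub>R E a q i) = v i"
    using arg_cong[OF D_expansion[OF p v], of "\<lambda>v. v i"] by (simp add: sum_apply)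
  finally show ?thesis .
qed

lemma \<Gamma>_outside: "q \<in> points M \<Longrightarrow> v \<in> D q \<Longrightarrow> q \<notin> cdom M i \<Longrightarrow> \<Gamma> (q, v) i = 0"
  using TM.tangent_outside[OF \<Gamma>_tangent, of q v i] by (simp add: cdom_TM)

lemma kinetic_has_derivative:
  assumes x: "x \<in> chart_image i"
  shows "((\<lambda>z. kinetic g (cinv (tangent_bundle M) i z)) has_derivative
    (\<lambda>h. dmet i x (fst h) y y / 2 + met i x y (snd h))) (at (x, y))"
proof -
  have "((\<lambda>z. met i (fst z) (snd z) (snd z)) has_derivative
    (\<lambda>h. dmet i x (fst h) y y + met i x (snd h) y + met i x y (snd h))) (at (x, y))"
    using has_derivative_met[of fst "(x, y)" i fst snd snd snd snd] x
    by (simp add: bounded_linear_fst bounded_linear_snd bounded_linear_imp_has_derivative)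
  from has_derivative_scaleR_right[OF this, of "1 / 2"]
  have "((\<lambda>z. met i (fst z) (snd z) (snd z) / 2) has_derivative
    (\<lambda>h. (1 / 2) *\<^sub>R (dmet i x (fst h) y y + met i x (snd h) y + met i x y (snd h)))) (at (x, y))"
    by simp
  moreover have "(\<lambda>h. (1 / 2) *\<^sub>R (dmet i x (fst h) y y + met i x (snd h) y + met i x y (snd h))) =
      (\<lambda>h. dmet i x (fst h) y y / 2 + met i x y (snd h))"
    by (simp add: fun_eq_iff met_sym[OF x, of _ y])
  ultimately have "((\<lambda>z. met i (fst z) (snd z) (snd z) / 2) has_derivative
    (\<lambda>h. dmet i x (fst h) y y / 2 + met i x y (snd h))) (at (x, y))"
    by (simp only:)
  then show ?thesis
    by (rule has_derivative_transform_within_open[of _ _ _ _ "chart_image i \<times> UNIV"])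
       (use x open_chart[of i] in \<open>auto simp: open_Times cinv_TM kinetic_def metric_rep_def\<close>)
qed

text \<open>
  The Legendre transformation of the kinetic energy.
\<close>

lemma vertical_derivative_kinetic:
  assumes X: "vector_field M X" and q: "q \<in> points M" and v: "v \<in> tangent_space M q"
  shows "tderiv (tangent_bundle M) (q, v) (vertical_lift M X (q, v)) (kinetic g) = g q v (X q)"
proof -
  obtain i where i: "q \<in> cdom M i" using q by (auto simp: points_def)
  have x: "cmap M i q \<in> chart_image i" using i by simp
  have "tderiv (tangent_bundle M) (q, v) (vertical_lift M X (q, v)) (kinetic g) =
      (\<lambda>h. dmet i (cmap M i q) (fst h) (v i) (v i) / 2 + met i (cmap M i q) (v i) (snd h)) (vertical_lift M X (q, v) i)"
    by (rule TM.tderiv_chart[OF vertical_lift_tangent[OF X q v]])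
       (use i v kinetic_has_derivative[OF x, of "v i"] in \<open>auto simp: cdom_TM\<close>)
  also have "\<dots> = met i (cmap M i q) (v i) (X q i)"
    using i by (simp add: vertical_lift_def linear_0[OF linear_dmet_dir[OF x]])
  also have "\<dots> = g q v (X q)" by (rule met_eq[OF i v vector_field_tangent[OF X q]])
  finally show ?thesis .
qed

text \<open>
  The Euler-Lagrange expression of the kinetic energy along \<open>X\<close> is the inner product of \<open>X\<close>
  with the covariant acceleration; in particular it depends on \<open>X\<close> only through its value.
\<close>

lemma euler_lagrange_chart:
  assumes X: "vector_field M X" and q: "q \<in> cdom M i" and v: "v \<in> D q"
  shows "euler_lagrange M (kinetic g) \<Gamma> X (q, v) =
    met i (cmap M i q) (acceleration i q v) (X q i) + christoffel1 i (cmap M i q) (v i) (v i) (X q i)"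
proof -
  note p = points_I[OF q] and tv = D_tangent[OF points_I[OF q] v]
  let ?x = "cmap M i q" and ?y = "v i" and ?a = "acceleration i q v"
  have x: "?x \<in> chart_image i" using q by simp
  have c: "(q, v) \<in> cdom (tangent_bundle M) i" using q tv by (simp add: cdom_TM)
  have base: "cmap (tangent_bundle M) i (q, v) = (?x, ?y)" by simp
  define f where "f = (\<lambda>p'. tderiv (tangent_bundle M) p' (vertical_lift M X p') (kinetic g))"
  have Xd: "((\<lambda>z. X (cinv M i (fst z)) i) has_derivative (\<lambda>h. vf_deriv M X i q (fst h))) (at (?x, ?y))"
    by (rule has_derivative_compose[OF bounded_linear_imp_has_derivative[OF bounded_linear_fst]])
       (simp add: vf_deriv_has_derivative[OF X q])
  have "((\<lambda>z. met i (fst z) (snd z) (X (cinv M i (fst z)) i)) has_derivative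
      (\<lambda>h. dmet i ?x (fst h) ?y (X q i) + met i ?x (snd h) (X q i) + met i ?x ?y (vf_deriv M X i q (fst h))))
      (at (?x, ?y))"
    using has_derivative_met[of fst "(?x, ?y)" i fst snd snd, OF _ _ _ Xd] x q
    by (simp add: bounded_linear_fst bounded_linear_snd bounded_linear_imp_has_derivative)
  then have df: "((\<lambda>z. f (cinv (tangent_bundle M) i z)) has_derivative
      (\<lambda>h. dmet i ?x (fst h) ?y (X q i) + met i ?x (snd h) (X q i) + met i ?x ?y (vf_deriv M X i q (fst h))))
      (at (?x, ?y))"
  proof (rule has_derivative_transform_within_open[of _ _ _ _ "chart_image i \<times> UNIV"])
    show "open (chart_image i \<times> (UNIV :: (real^'n) set))" by (intro open_Times open_chart open_UNIV)
    show "(?x, ?y) \<in> chart_image i \<times> UNIV" using x by simp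
    fix z :: "(real^'n) \<times> (real^'n)" assume "z \<in> chart_image i \<times> UNIV"
    then obtain q' y' where z: "z = (cmap M i q', y')" "q' \<in> cdom M i" by auto
    then have "f (cinv (tangent_bundle M) i z) = g q' (tvec M i q' y') (X q')"
      by (simp add: f_def cinv_TM vertical_derivative_kinetic[OF X points_I tvec_tangent])
    also have "\<dots> = met i (cmap M i q') y' (X q' i)"
      using z(2) by (simp add: metric_rep_def tvec_rep vector_field_tangent[OF X points_I])
    finally show "met i (fst z) (snd z) (X (cinv M i (fst z)) i) = f (cinv (tangent_bundle M) i z)"
      using z by simp
  qed
  have "tderiv (tangent_bundle M) (q, v) (\<Gamma> (q, v)) f =
      dmet i ?x ?y ?y (X q i) + met i ?x ?a (X q i) + met i ?x ?y (vf_deriv M X i q ?y)"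
    using TM.tderiv_chart[OF \<Gamma>_tangent[OF p v] c, unfolded base, OF df] by (simp add: \<Gamma>_chart[OF q v])
  moreover have "tderiv (tangent_bundle M) (q, v) (complete_lift M X (q, v)) (kinetic g) =
      dmet i ?x (X q i) ?y ?y / 2 + met i ?x ?y (vf_deriv M X i q ?y)"
    using TM.tderiv_chart[OF complete_lift_tangent[OF X p tv] c, unfolded base, OF kinetic_has_derivative[OF x]] q
    by (simp add: complete_lift_def)
  ultimately show ?thesis
    by (simp add: euler_lagrange_def f_def christoffel1_def field_simps)
qed

text \<open>
  The Lagrange-d'Alembert equations: the constraint forces do no work along \<open>D\<close>.
\<close>

lemma lagrange_dalembert:
  assumes q: "q \<in> cdom M i" and v: "v \<in> D q" and a: "a \<in> A"
  shows "met i (cmap M i q) (acceleration i q v) (E a q i) = - christoffel1 i (cmap M i q) (v i) (v i) (E a q i)"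
proof -
  have "section_of M D (E a)" using E_field E_in_D[OF _ a] by (simp add: section_of_def)
  moreover have "(q, v) \<in> constraint_mfd M D" using points_I[OF q] v by (simp add: constraint_mfd_def)
  ultimately have "euler_lagrange M (kinetic g) \<Gamma> (E a) (q, v) = 0"
    using nonholonomic unfolding nonholonomic_field_def by blast
  then show ?thesis using euler_lagrange_chart[OF E_field q v] by simp
qed

text \<open>
  The equations of motion determine the component of the acceleration in \<open>D\<close> as a quadratic
  function of the velocity; the remaining component is quadratic by the form of \<open>\<Gamma>\<close>.
\<close>

lemma acceleration_homogeneous:
  assumes q: "q \<in> cdom M i" and v: "v \<in> D q"
  shows "acceleration i q (r *\<^sub>R v) = (r * r) *\<^sub>R acceleration i q v"
proof -
  have p: "q \<in> points M" by (rule points_I[OF q])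
  have x: "cmap M i q \<in> chart_image i" using q by simp
  have rv: "r *\<^sub>R v \<in> D q" by (rule subspace_scale[OF subspace_D[OF p] v])
  define c where "c = (\<lambda>a. force a (q, r *\<^sub>R v) - (r * r) * force a (q, v))"
  define d where "d = (\<Sum>a\<in>A. c a *\<^sub>R E a q i)"
  note lin = has_derivative_linear[OF vf_deriv_has_derivative[OF E_field q]]
  have split: "acceleration i q (r *\<^sub>R v) = (r * r) *\<^sub>R acceleration i q v + d"
    unfolding acceleration_def d_def c_def
    by (simp add: coeff_linear(2)[OF p D_tangent[OF p v]] linear_cmul[OF lin] scaleR_sum_right
        sum.distrib[symmetric] algebra_simps)
  have "met i (cmap M i q) d (E a q i) = 0" if a: "a \<in> A" for a
  proof -
    have "met i (cmap M i q) (acceleration i q (r *\<^sub>R v)) (E a q i) =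
        (r * r) * met i (cmap M i q) (acceleration i q v) (E a q i)"
      unfolding lagrange_dalembert[OF q v a] lagrange_dalembert[OF q rv a]
      by (simp add: christoffel1_def linear_cmul[OF linear_dmet_dir[OF x]] linear_cmul[OF linear_dmet_left[OF x]]
          linear_cmul[OF linear_dmet_right[OF x]] field_simps)
    then show ?thesis
      unfolding split by (simp add: linear_add[OF linear_met_left[OF x]] linear_cmul[OF linear_met_left[OF x]])
  qed
  then have "met i (cmap M i q) d (\<Sum>a\<in>A. c a *\<^sub>R E a q i) = 0"
    by (simp add: linear_sum[OF linear_met_right[OF x]] linear_cmul[OF linear_met_right[OF x]])
  then have "met i (cmap M i q) d d = 0" by (simp add: d_def)
  then have "d = 0" using met_pos[OF x, of d] by (cases "d = 0") auto
  then show ?thesis using split by simp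
qed


section \<open>The frame coefficients in a chart\<close>

abbreviation frame_rep :: "'i \<Rightarrow> 'n \<Rightarrow> real^'n \<Rightarrow> real^'n" where
  "frame_rep i \<alpha> x \<equiv> E \<alpha> (cinv M i x) i"

definition frame_map :: "'i \<Rightarrow> real^'n \<Rightarrow> real^'n \<Rightarrow> real^'n" where
  "frame_map i x w = (\<Sum>\<alpha>\<in>UNIV. (w $ \<alpha>) *\<^sub>R frame_rep i \<alpha> x)"

lemma frame_rep_smooth: "smooth_on (chart_image i) (frame_rep i \<alpha>)"
  by (rule vector_field_smooth[OF E_field])

lemma frame_rep_C1: "C1_on (chart_image i) (frame_rep i \<alpha>)"
  by (rule smooth_on_C1[OF frame_rep_smooth open_chart])

lemma linear_frame_map: "linear (frame_map i x)"
  by (rule linearI) (simp_all add: frame_map_def scaleR_add_left sum.distrib scaleR_sum_right)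

lemma frame_map_coeff:
  assumes "q \<in> cdom M i" "v \<in> tangent_space M q"
  shows "frame_map i (cmap M i q) (\<chi> \<alpha>. coeff q v \<alpha>) = v i"
  using arg_cong[OF coeff_expansion[OF points_I[OF assms(1)] assms(2)], of "\<lambda>v. v i"] assms(1)
  by (simp add: frame_map_def sum_apply)

lemma tvec_frame_map:
  assumes x: "x \<in> chart_image i"
  shows "tvec M i (cinv M i x) (frame_map i x w) = (\<Sum>\<alpha>\<in>UNIV. (w $ \<alpha>) *\<^sub>R E \<alpha> (cinv M i x))"
proof -
  note q = cinv_cdom[OF x]
  show ?thesis
    by (rule tangent_eqI[OF tvec_tangent[OF q] frame_combination_tangent[OF points_I[OF q]] q])
       (simp add: q frame_map_def sum_apply)
qed

lemma inj_frame_map: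
  assumes x: "x \<in> chart_image i" shows "inj (frame_map i x)"
proof (rule injI)
  fix w w' assume "frame_map i x w = frame_map i x w'"
  then have "(\<Sum>\<alpha>\<in>UNIV. (w $ \<alpha>) *\<^sub>R E \<alpha> (cinv M i x)) = (\<Sum>\<alpha>\<in>UNIV. (w' $ \<alpha>) *\<^sub>R E \<alpha> (cinv M i x))"
    by (simp only: tvec_frame_map[OF x, symmetric])
  from frame_combination_unique[OF points_I[OF cinv_cdom[OF x]] this]
  show "w = w'" by (simp add: vec_eq_iff fun_eq_iff)
qed

text \<open>
  The frame coefficients are locally Lipschitz in point and vector: this follows from a lower bound
  for the frame map, so that no formula for the inverse of its matrix is needed.
\<close>

lemma frame_map_bounds:
  assumes x0: "x0 \<in> chart_image i"
  obtains r c C where "r > 0" "c > 0" "C \<ge> 0" "cball x0 r \<subseteq> chart_image i"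
    and "\<And>x x' w w'. x \<in> cball x0 r \<Longrightarrow> x' \<in> cball x0 r \<Longrightarrow>
      c * norm (w - w') \<le> norm (frame_map i x w - frame_map i x' w') + C * norm (x - x') * norm w'"
proof -
  obtain r0 where r0: "r0 > 0" "cball x0 r0 \<subseteq> chart_image i"
    using open_chart[of i] x0 open_contains_cball by blast
  have "\<exists>L>0. \<forall>x\<in>cball x0 r0. \<forall>y\<in>cball x0 r0. norm (frame_rep i \<alpha> x - frame_rep i \<alpha> y) \<le> L * norm (x - y)"
    for \<alpha>
    by (rule C1_on_lipschitz[OF C1_on_subset[OF frame_rep_C1 r0(2), of \<alpha>] compact_cball convex_cball]) blast
  then obtain L where L: "\<And>\<alpha>. L \<alpha> > 0" "\<And>\<alpha> x y. x \<in> cball x0 r0 \<Longrightarrow> y \<in> cball x0 r0 \<Longrightarrow>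
      norm (frame_rep i \<alpha> x - frame_rep i \<alpha> y) \<le> L \<alpha> * norm (x - y)"
    by metis
  define C where "C = (\<Sum>\<alpha>\<in>UNIV. L \<alpha>)"
  have C: "C \<ge> 0" unfolding C_def using L(1) by (intro sum_nonneg) (simp add: less_imp_le)
  have lip: "norm (frame_map i x w - frame_map i x' w) \<le> C * norm (x - x') * norm w"
    if "x \<in> cball x0 r0" "x' \<in> cball x0 r0" for x x' w
  proof -
    have "norm (frame_map i x w - frame_map i x' w) =
        norm (\<Sum>\<alpha>\<in>UNIV. (w $ \<alpha>) *\<^sub>R (frame_rep i \<alpha> x - frame_rep i \<alpha> x'))"
      by (simp add: frame_map_def sum_subtractf scaleR_diff_right)
    also have "\<dots> \<le> (\<Sum>\<alpha>\<in>UNIV. norm w * (L \<alpha> * norm (x - x')))"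
    proof (rule sum_norm_le)
      fix \<alpha>
      show "norm ((w $ \<alpha>) *\<^sub>R (frame_rep i \<alpha> x - frame_rep i \<alpha> x')) \<le> norm w * (L \<alpha> * norm (x - x'))"
        using component_le_norm_cart[of w \<alpha>] L(2)[OF that, of \<alpha>] by (simp add: mult_mono)
    qed
    also have "\<dots> = C * norm (x - x') * norm w"
      by (simp add: C_def sum_distrib_left sum_distrib_right mult_ac)
    finally show ?thesis .
  qed
  obtain B where B: "B > 0" "\<And>w. B * norm w \<le> norm (frame_map i x0 w)"
    using linear_inj_bounded_below_pos[OF linear_frame_map inj_frame_map[OF x0]] by blast
  define r where "r = min r0 (B / (2 * (C + 1)))"
  have r: "r > 0" "r \<le> r0" using r0(1) B(1) C by (auto simp: r_def)
  have "C * r \<le> (C + 1) * (B / (2 * (C + 1)))"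
    using C B(1) r(1) by (intro mult_mono) (auto simp: r_def)
  also have "\<dots> = B / 2" using C by (simp add: field_simps)
  finally have Cr: "C * r \<le> B / 2" .
  have low: "B / 2 * norm w \<le> norm (frame_map i x w)" if x: "x \<in> cball x0 r" for x w
  proof -
    have xs: "x \<in> cball x0 r0" "x0 \<in> cball x0 r0" using x r r0(1) by auto
    have "norm (x0 - x) \<le> r" using x by (simp add: dist_norm)
    then have "C * norm (x0 - x) * norm w \<le> C * r * norm w"
      using C by (intro mult_right_mono mult_left_mono) auto
    also have "\<dots> \<le> B / 2 * norm w" using Cr by (intro mult_right_mono) auto
    finally have "norm (frame_map i x0 w - frame_map i x w) \<le> B / 2 * norm w"
      using lip[OF xs(2,1), of w] by linarith
    then show ?thesis
      using B(2)[of w] norm_triangle_ineq2[of "frame_map i x0 w" "frame_map i x w"] by (simp add: field_simps)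
  qed
  show thesis
  proof (rule that[of r "B / 2" C])
    show "cball x0 r \<subseteq> chart_image i" using r0(2) subset_cball[OF r(2), of x0] by blast
    fix x x' w w' assume x: "x \<in> cball x0 r" "x' \<in> cball x0 r"
    then have xs: "x \<in> cball x0 r0" "x' \<in> cball x0 r0" using r by auto
    have "frame_map i x (w - w') =
        (frame_map i x w - frame_map i x' w') + (frame_map i x' w' - frame_map i x w')"
      by (simp add: linear_diff[OF linear_frame_map])
    then have "norm (frame_map i x (w - w')) \<le>
        norm (frame_map i x w - frame_map i x' w') + norm (frame_map i x' w' - frame_map i x w')"
      using norm_triangle_ineq by metis
    then show "B / 2 * norm (w - w') \<le> norm (frame_map i x w - frame_map i x' w') + C * norm (x - x') * norm w'"
      using low[OF x(1), of "w - w'"] lip[OF xs(2,1), of w'] by (simp add: norm_minus_commute)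
  qed (use r B C in auto)
qed

lemma continuous_on_frame_coefficients:
  assumes x: "\<And>t. t \<in> T \<Longrightarrow> x t \<in> chart_image i" and cx: "continuous_on T x"
    and cy: "continuous_on T (\<lambda>t. frame_map i (x t) (w t))"
  shows "continuous_on T w"
  unfolding continuous_on_def
proof
  fix t0 assume t0: "t0 \<in> T"
  obtain r c C where b: "r > 0" "c > 0" "C \<ge> 0" and "cball (x t0) r \<subseteq> chart_image i"
    and bound: "\<And>y y' w w'. y \<in> cball (x t0) r \<Longrightarrow> y' \<in> cball (x t0) r \<Longrightarrow>
      c * norm (w - w') \<le> norm (frame_map i y w - frame_map i y' w') + C * norm (y - y') * norm w'"
    by (rule frame_map_bounds[OF x[OF t0]]) blast
  let ?b = "\<lambda>t. (norm (frame_map i (x t) (w t) - frame_map i (x t0) (w t0)) + C * norm (x t - x t0) * norm (w t0)) / c"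
  have lx: "(x \<longlongrightarrow> x t0) (at t0 within T)" using cx t0 by (simp add: continuous_on_def)
  have "((\<lambda>t. frame_map i (x t) (w t)) \<longlongrightarrow> frame_map i (x t0) (w t0)) (at t0 within T)"
    using cy t0 by (simp add: continuous_on_def)
  then have "(?b \<longlongrightarrow> (norm (frame_map i (x t0) (w t0) - frame_map i (x t0) (w t0))
      + C * norm (x t0 - x t0) * norm (w t0)) / c) (at t0 within T)"
    using lx b(2) by (intro tendsto_intros) auto
  then have lim: "(?b \<longlongrightarrow> 0) (at t0 within T)" by simp
  have "\<forall>\<^sub>F t in at t0 within T. dist (x t) (x t0) < r" by (rule tendstoD[OF lx b(1)])
  then have "\<forall>\<^sub>F t in at t0 within T. norm (w t - w t0) \<le> ?b t"
  proof eventually_elim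
    case (elim t)
    then have "norm (w t - w t0) * c \<le>
        norm (frame_map i (x t) (w t) - frame_map i (x t0) (w t0)) + C * norm (x t - x t0) * norm (w t0)"
      using bound[of "x t" "x t0" "w t" "w t0"] b(1) by (simp add: dist_commute mult.commute[of c])
    then show ?case by (simp only: pos_le_divide_eq[OF b(2)])
  qed
  then have "((\<lambda>t. w t - w t0) \<longlongrightarrow> 0) (at t0 within T)"
    by (rule Lim_null_comparison[OF _ lim])
  then show "(w \<longlongrightarrow> w t0) (at t0 within T)" by (simp add: LIM_zero_iff)
qed

end


section \<open>Uniqueness of nonholonomic motions\<close>

context nonholonomic_system
begin

text \<open>
  The acceleration as a function of position, velocity and frame coefficients, taken as independent
  variables: in this form it is continuously differentiable on an open set.
\<close>

definition accel_rep :: "'i \<Rightarrow> (real^'n) \<times> (real^'n) \<times> (real^'n) \<Rightarrow> real^'n" where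
  "accel_rep i p = (\<Sum>a\<in>A. (snd (snd p) $ a) *\<^sub>R frechet_derivative (frame_rep i a) (at (fst p)) (fst (snd p))
     + force a (cinv (tangent_bundle M) i (fst p, fst (snd p))) *\<^sub>R frame_rep i a (fst p))"

lemma force_C1: "a \<in> A \<Longrightarrow> C1_on (chart_image i \<times> UNIV) (\<lambda>z. force a (cinv (tangent_bundle M) i z))"
proof -
  assume a: "a \<in> A"
  have "cmap (tangent_bundle M) i ` cdom (tangent_bundle M) i = chart_image i \<times> UNIV"
    using overlap_TM[of i i] by simp
  then have "smooth_on (chart_image i \<times> UNIV) (\<lambda>z. force a (cinv (tangent_bundle M) i z))"
    using force_smooth[OF a] unfolding smooth_fun_def by metis
  then show ?thesis by (rule smooth_on_C1) (intro open_Times open_chart open_UNIV)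
qed

lemma accel_rep_C1: "C1_on (chart_image i \<times> UNIV) (accel_rep i)"
proof -
  let ?S = "chart_image i \<times> (UNIV :: ((real^'n) \<times> (real^'n)) set)"
  have f: "C1_on ?S fst" by (rule C1_on_fst)
  have y: "C1_on ?S (\<lambda>p. fst (snd p))" by (rule C1_on_compose[OF C1_on_snd C1_on_fst[of UNIV]]) simp
  have w: "C1_on ?S (\<lambda>p. snd (snd p) $ a)" for a
    by (rule C1_on_bounded_linear) (intro bounded_linear_compose[OF bounded_linear_vec_nth]
        bounded_linear_compose[OF bounded_linear_snd] bounded_linear_snd)
  have e: "C1_on ?S (\<lambda>p. frame_rep i a (fst p))" for a
    by (rule C1_on_compose[OF f frame_rep_C1]) auto
  have de: "C1_on ?S (\<lambda>p. frechet_derivative (frame_rep i a) (at (fst p)) (fst (snd p)))" for a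
    using C1_on_compose[OF C1_on_Pair[OF f y] C1_on_tangent_map[OF frame_rep_smooth[of i a] open_chart]]
    by (simp add: image_subset_iff)
  have fo: "C1_on ?S (\<lambda>p. force a (cinv (tangent_bundle M) i (fst p, fst (snd p))))" if "a \<in> A" for a
    by (rule C1_on_compose[OF C1_on_Pair[OF f y] force_C1[OF that]]) auto
  have "C1_on ?S (\<lambda>p. \<Sum>a\<in>A. (snd (snd p) $ a) *\<^sub>R frechet_derivative (frame_rep i a) (at (fst p)) (fst (snd p))
     + force a (cinv (tangent_bundle M) i (fst p, fst (snd p))) *\<^sub>R frame_rep i a (fst p))"
    by (intro C1_on_sum C1_on_add C1_on_scaleR w de fo e)
  then show ?thesis by (simp add: accel_rep_def[abs_def])
qed

lemma acceleration_accel_rep: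
  assumes q: "q \<in> cdom M i" and v: "v \<in> tangent_space M q"
  shows "acceleration i q v = accel_rep i (cmap M i q, v i, \<chi> \<alpha>. coeff q v \<alpha>)"
proof -
  have "(q, v) \<in> cdom (tangent_bundle M) i" using q v by (simp add: cdom_TM)
  from TM.cinv_cmap[OF this] have "cinv (tangent_bundle M) i (cmap M i q, v i) = (q, v)" by simp
  then show ?thesis using q by (simp add: acceleration_def accel_rep_def vf_deriv_def)
qed

abbreviation motion :: "real set \<Rightarrow> (real \<Rightarrow> 'q \<times> ('i \<Rightarrow> real^'n)) \<Rightarrow> bool" where
  "motion \<equiv> integral_curve (tangent_bundle M) (constraint_mfd M D) \<Gamma>"

lemma motion_chart:
  assumes c: "motion I c" and t: "t \<in> I" and i: "c t \<in> cdom (tangent_bundle M) i"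
  shows motion_eventually_cdom: "\<forall>\<^sub>F s in nhds t. c s \<in> cdom (tangent_bundle M) i"
    and motion_has_derivative: "((\<lambda>s. cmap (tangent_bundle M) i (c s)) has_vector_derivative \<Gamma> (c t) i) (at t)"
    and motion_constraint: "c t \<in> constraint_mfd M D"
    and motion_tendsto: "((\<lambda>s. cmap (tangent_bundle M) i (c s)) \<longlongrightarrow> cmap (tangent_bundle M) i (c t)) (nhds t)"
proof -
  show "\<forall>\<^sub>F s in nhds t. c s \<in> cdom (tangent_bundle M) i"
    and d: "((\<lambda>s. cmap (tangent_bundle M) i (c s)) has_vector_derivative \<Gamma> (c t) i) (at t)"
    and "c t \<in> constraint_mfd M D"
    using c t i unfolding integral_curve_def has_velocity_def by simp_all
  show "((\<lambda>s. cmap (tangent_bundle M) i (c s)) \<longlongrightarrow> cmap (tangent_bundle M) i (c t)) (nhds t)"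
    using has_vector_derivative_continuous[OF d]
      tendsto_at_iff_tendsto_nhds[of "\<lambda>s. cmap (tangent_bundle M) i (c s)" t]
    by (simp add: isCont_def)
qed

lemma motion_chart_ode:
  assumes c: "motion I c" and t: "t \<in> I" and i: "c t \<in> cdom (tangent_bundle M) i"
  obtains x y w where "cmap (tangent_bundle M) i (c t) = (x, y)" "y = frame_map i x w"
    and "((\<lambda>s. cmap (tangent_bundle M) i (c s)) has_vector_derivative (y, accel_rep i (x, y, w))) (at t)"
proof -
  obtain q v where p: "c t = (q, v)" by (cases "c t")
  have q: "q \<in> cdom M i" and v: "v \<in> tangent_space M q" using i by (simp_all add: p cdom_TM)
  have "v \<in> D q" using motion_constraint[OF c t i] by (simp add: p constraint_mfd_def)
  from \<Gamma>_chart[OF q this] have "\<Gamma> (c t) i = (v i, accel_rep i (cmap M i q, v i, \<chi> \<alpha>. coeff q v \<alpha>))"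
    by (simp add: p acceleration_accel_rep[OF q v])
  with motion_has_derivative[OF c t i] show thesis
    by (intro that[of "cmap M i q" "v i" "\<chi> \<alpha>. coeff q v \<alpha>"])
       (simp_all add: p frame_map_coeff[OF q v])
qed

text \<open>
  In a chart, position, velocity and frame coefficients of a motion satisfy \<open>y' = accel_rep (x, y, w)\<close>
  with a locally Lipschitz right-hand side, and \<open>w\<close> is itself a locally Lipschitz function of
  \<open>(x, y)\<close>. So the difference \<open>e\<close> of two motions satisfies \<open>norm e' \<le> \<Lambda> norm e\<close>.
\<close>

lemma motions_agree_locally:
  assumes c: "motion I c" "motion I' c'" and I: "open I" "open I'" and t0: "t0 \<in> I" "t0 \<in> I'"
    and eq: "c t0 = c' t0"
  shows "\<forall>\<^sub>F t in nhds t0. c t = c' t"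
proof -
  have "c t0 \<in> points (tangent_bundle M)"
    using c(1) t0(1) by (auto simp: integral_curve_def has_velocity_def)
  then obtain i where i: "c t0 \<in> cdom (tangent_bundle M) i" by (auto simp: points_def)
  then have i': "c' t0 \<in> cdom (tangent_bundle M) i" by (simp add: eq)
  define z where "z = (\<lambda>s. cmap (tangent_bundle M) i (c s))"
  define z' where "z' = (\<lambda>s. cmap (tangent_bundle M) i (c' s))"
  obtain x0 y0 where z0: "z t0 = (x0, y0)" by (cases "z t0")
  have x0: "x0 \<in> chart_image i" using i z0 by (auto simp: z_def cdom_TM)
  obtain r \<kappa> C where b: "r > 0" "\<kappa> > 0" "C \<ge> 0" and sub: "cball x0 r \<subseteq> chart_image i"
    and bound: "\<And>x x' w w'. x \<in> cball x0 r \<Longrightarrow> x' \<in> cball x0 r \<Longrightarrow>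
      \<kappa> * norm (w - w') \<le> norm (frame_map i x w - frame_map i x' w') + C * norm (x - x') * norm w'"
    by (rule frame_map_bounds[OF x0]) blast
  let ?N = "ball x0 r \<times> ball y0 1"
  have N: "open ?N" "(x0, y0) \<in> ?N" using b(1) by (auto intro: open_Times)
  have ev: "\<forall>\<^sub>F s in nhds t0. s \<in> I \<and> s \<in> I' \<and> c s \<in> cdom (tangent_bundle M) i \<and>
      c' s \<in> cdom (tangent_bundle M) i \<and> z s \<in> ?N \<and> z' s \<in> ?N"
    using eventually_nhds_in_open[OF I(1) t0(1)] eventually_nhds_in_open[OF I(2) t0(2)]
      motion_eventually_cdom[OF c(1) t0(1) i] motion_eventually_cdom[OF c(2) t0(2) i']
      topological_tendstoD[OF motion_tendsto[OF c(1) t0(1) i] N(1)]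
      topological_tendstoD[OF motion_tendsto[OF c(2) t0(2) i'] N(1)] N(2) z0 eq
    by (simp add: z_def z'_def eventually_conj_iff)
  then obtain \<epsilon> where \<epsilon>: "\<epsilon> > 0" "\<And>s. dist s t0 < \<epsilon> \<Longrightarrow> s \<in> I \<and> s \<in> I' \<and> c s \<in> cdom (tangent_bundle M) i \<and>
      c' s \<in> cdom (tangent_bundle M) i \<and> z s \<in> ?N \<and> z' s \<in> ?N"
    unfolding eventually_nhds_metric by blast
  define R where "R = (norm y0 + 1) / \<kappa>"
  have R: "R \<ge> 0" using b(2) by (simp add: R_def)
  let ?K = "cball x0 r \<times> cball y0 1 \<times> cball (0 :: real^'n) R"
  have "C1_on ?K (accel_rep i)" by (rule C1_on_subset[OF accel_rep_C1]) (use sub in auto)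
  moreover have "compact ?K" "convex ?K" by (intro compact_Times compact_cball) (intro convex_Times convex_cball)
  ultimately obtain L where L: "L > 0"
    "\<And>p p'. p \<in> ?K \<Longrightarrow> p' \<in> ?K \<Longrightarrow> norm (accel_rep i p - accel_rep i p') \<le> L * norm (p - p')"
    by (rule C1_on_lipschitz) blast
  define \<Lambda> where "\<Lambda> = 1 + L * (2 + (1 + C * R) / \<kappa>)"
  have \<Lambda>: "\<Lambda> > 0" using L(1) b R by (auto simp: \<Lambda>_def intro!: add_pos_nonneg mult_nonneg_nonneg divide_nonneg_nonneg)
  have in_K: "(x, y, w) \<in> ?K" if "(x, y) \<in> ?N" "y = frame_map i x w" for x y w
  proof -
    have "\<kappa> * norm (w - 0) \<le> norm (frame_map i x w - frame_map i x 0) + C * norm (x - x) * norm (0 :: real^'n)"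
      by (rule bound) (use that(1) in auto)
    then have "\<kappa> * norm w \<le> norm y" using that(2) by (simp add: linear_0[OF linear_frame_map])
    also have "\<dots> \<le> norm y0 + 1"
      using that(1) norm_triangle_ineq2[of y y0] by (auto simp: dist_norm norm_minus_commute)
    finally have "norm w \<le> R" using b(2) by (simp add: R_def pos_le_divide_eq mult.commute)
    then show ?thesis using that(1) by auto
  qed
  have lip: "norm ((y, accel_rep i (x, y, w)) - (y', accel_rep i (x', y', w'))) \<le> \<Lambda> * norm ((x, y) - (x', y'))"
    if p: "(x, y) \<in> ?N" "y = frame_map i x w" and p': "(x', y') \<in> ?N" "y' = frame_map i x' w'" for x y w x' y' w'
  proof -
    let ?n = "norm ((x, y) - (x', y'))"
    have nx: "norm (x - x') \<le> ?n" using norm_fst_le[of "(x - x')" "(y - y')"] by simp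
    have ny: "norm (y - y') \<le> ?n" using norm_snd_le[of "(y - y')" "(x - x')"] by simp
    have "norm w' \<le> R" using in_K[OF p'] by auto
    then have "C * norm (x - x') * norm w' \<le> C * ?n * R"
      using nx b(3) by (intro mult_mono) auto
    moreover have "\<kappa> * norm (w - w') \<le> norm (y - y') + C * norm (x - x') * norm w'"
      unfolding p(2) p'(2) by (rule bound) (use p(1) p'(1) in auto)
    ultimately have "norm (w - w') * \<kappa> \<le> (1 + C * R) * ?n" using ny by (simp add: algebra_simps)
    then have nw: "norm (w - w') \<le> (1 + C * R) / \<kappa> * ?n"
      using b(2) by (simp add: pos_le_divide_eq)
    have "norm ((x, y, w) - (x', y', w')) \<le> norm (x - x') + (norm (y - y') + norm (w - w'))"
      using norm_Pair_le[of "x - x'" "(y - y', w - w')"] norm_Pair_le[of "y - y'" "w - w'"] by simp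
    also have "\<dots> \<le> (2 + (1 + C * R) / \<kappa>) * ?n" using nx ny nw by (simp add: algebra_simps)
    finally have "L * norm ((x, y, w) - (x', y', w')) \<le> L * ((2 + (1 + C * R) / \<kappa>) * ?n)"
      using L(1) by (intro mult_left_mono) auto
    with L(2)[OF in_K[OF p] in_K[OF p']]
    have "norm (accel_rep i (x, y, w) - accel_rep i (x', y', w')) \<le> L * (2 + (1 + C * R) / \<kappa>) * ?n"
      by (simp only: mult.assoc)
    then show ?thesis
      using ny norm_Pair_le[of "y - y'" "accel_rep i (x, y, w) - accel_rep i (x', y', w')"]
      by (simp add: \<Lambda>_def distrib_right)
  qed
  define T where "T = min (\<epsilon> / 2) (1 / (2 * \<Lambda>))"
  have T: "T > 0" "T < \<epsilon>" using \<epsilon>(1) \<Lambda> by (auto simp: T_def)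
  have "\<Lambda> * T \<le> \<Lambda> * (1 / (2 * \<Lambda>))" unfolding T_def using \<Lambda> by (intro mult_left_mono; simp)
  then have \<Lambda>T: "\<Lambda> * T \<le> 1 / 2" using \<Lambda> by simp
  define e where "e = (\<lambda>\<tau>. z (t0 + \<tau>) - z' (t0 + \<tau>))"
  have "\<exists>d. (e has_vector_derivative d) (at \<tau> within {-T..T}) \<and> norm d \<le> \<Lambda> * norm (e \<tau>) + 0"
    if "\<tau> \<in> {-T..T}" for \<tau>
  proof -
    have "dist (t0 + \<tau>) t0 < \<epsilon>" using that T by (auto simp: dist_norm)
    note s = \<epsilon>(2)[OF this]
    have sI: "t0 + \<tau> \<in> I" "t0 + \<tau> \<in> I'" "c (t0 + \<tau>) \<in> cdom (tangent_bundle M) i"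
      "c' (t0 + \<tau>) \<in> cdom (tangent_bundle M) i" using s by auto
    obtain x y w where p: "z (t0 + \<tau>) = (x, y)" "y = frame_map i x w"
      and d: "(z has_vector_derivative (y, accel_rep i (x, y, w))) (at (t0 + \<tau>))"
      unfolding z_def by (rule motion_chart_ode[OF c(1) sI(1,3)])
    obtain x' y' w' where p': "z' (t0 + \<tau>) = (x', y')" "y' = frame_map i x' w'"
      and d': "(z' has_vector_derivative (y', accel_rep i (x', y', w'))) (at (t0 + \<tau>))"
      unfolding z'_def by (rule motion_chart_ode[OF c(2) sI(2,4)])
    have sh: "((\<lambda>\<tau>. t0 + \<tau>) has_vector_derivative 1) (at \<tau>)"
      by (auto intro!: derivative_eq_intros)
    from vector_diff_chain_at[OF sh d] vector_diff_chain_at[OF sh d']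
    have "(e has_vector_derivative (y, accel_rep i (x, y, w)) - (y', accel_rep i (x', y', w'))) (at \<tau>)"
      unfolding e_def o_def by (intro has_vector_derivative_diff) simp_all
    moreover have "norm ((y, accel_rep i (x, y, w)) - (y', accel_rep i (x', y', w'))) \<le> \<Lambda> * norm (e \<tau>) + 0"
      using lip[OF _ p(2) _ p'(2)] s by (simp add: e_def p(1) p'(1))
    ultimately show ?thesis using has_vector_derivative_at_within by blast
  qed
  then have "\<exists>e'. \<forall>\<tau>\<in>{-T..T}. (e has_vector_derivative e' \<tau>) (at \<tau> within {-T..T}) \<and> norm (e' \<tau>) \<le> \<Lambda> * norm (e \<tau>) + 0"
    by (intro bchoice ballI)
  then obtain e' where e': "\<And>\<tau>. \<tau> \<in> {-T..T} \<Longrightarrow> (e has_vector_derivative e' \<tau>) (at \<tau> within {-T..T})"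
    "\<And>\<tau>. \<tau> \<in> {-T..T} \<Longrightarrow> norm (e' \<tau>) \<le> \<Lambda> * norm (e \<tau>) + 0"
    by (elim exE) blast
  have e0: "e 0 = 0" by (simp add: e_def z_def z'_def eq)
  have "c s = c' s" if s: "dist s t0 < T" for s
  proof -
    have "norm (e (s - t0)) \<le> 2 * (norm (e 0) + T * 0)"
      by (rule short_time_bound[OF _ \<Lambda>T _ _ e']) (use T \<Lambda> s in \<open>auto simp: dist_norm\<close>)
    then have "z s = z' s" by (simp add: e0) (simp add: e_def)
    moreover have "c s \<in> cdom (tangent_bundle M) i" "c' s \<in> cdom (tangent_bundle M) i"
      using \<epsilon>(2)[of s] s T by auto
    ultimately show ?thesis using TM.inj[of i] by (auto simp: z_def z'_def inj_on_def)
  qed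
  then show ?thesis unfolding eventually_nhds_metric using T(1) by blast
qed

lemma motion_base_continuous:
  assumes c: "motion I c" and t: "t \<in> I" and U: "openin (manifold_topology M) U" "fst (c t) \<in> U"
  shows "\<forall>\<^sub>F s in nhds t. fst (c s) \<in> U"
proof -
  have "c t \<in> points (tangent_bundle M)"
    using c t by (auto simp: integral_curve_def has_velocity_def)
  then obtain i where i: "c t \<in> cdom (tangent_bundle M) i" by (auto simp: points_def)
  have op: "open (cmap M i ` (U \<inter> cdom M i))"
    using U(1) by (simp add: openin_manifold_topology[OF smooth])
  have fst_cmap: "fst (cmap (tangent_bundle M) i p) = cmap M i (fst p)" for p by (cases p) simp
  have "((\<lambda>s. cmap M i (fst (c s))) \<longlongrightarrow> cmap M i (fst (c t))) (nhds t)"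
    using tendsto_fst[OF motion_tendsto[OF c t i]] by (simp add: fst_cmap)
  moreover have ci: "fst (c t) \<in> cdom M i" using i by (auto simp: cdom_TM)
  ultimately have "\<forall>\<^sub>F s in nhds t. cmap M i (fst (c s)) \<in> cmap M i ` (U \<inter> cdom M i)"
    using topological_tendstoD[OF _ op] U(2) by blast
  with motion_eventually_cdom[OF c t i] show ?thesis
  proof eventually_elim
    case (elim s)
    then have "fst (c s) \<in> cdom M i" by (auto simp: cdom_TM)
    with elim(2) show ?case using inj[of i] by (auto simp: inj_on_def)
  qed
qed

lemma topspace_manifold: "topspace (manifold_topology M) = points M"
proof
  have "openin (manifold_topology M) (points M)"
  proof -
    have "points M \<inter> cdom M i = cdom M i" for i by (auto simp: points_def)
    then show ?thesis using open_chart by (simp add: openin_manifold_topology[OF smooth])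
  qed
  then show "points M \<subseteq> topspace (manifold_topology M)" by (rule openin_subset)
  have "openin (manifold_topology M) (topspace (manifold_topology M))" by simp
  then show "topspace (manifold_topology M) \<subseteq> points M"
    unfolding openin_manifold_topology[OF smooth] by (rule conjunct1)
qed

text \<open>
  The times at which two motions agree form a closed set because the manifold is a Hausdorff
  space, and an open one by local uniqueness.
\<close>

lemma motions_disagree_locally:
  assumes c: "motion I c" "motion I' c'" and t: "t \<in> I" "t \<in> I'" and ne: "c t \<noteq> c' t"
  shows "\<forall>\<^sub>F s in nhds t. c s \<noteq> c' s"
proof (cases "fst (c t) = fst (c' t)")
  case False
  have pt: "fst (c t) \<in> points M" "fst (c' t) \<in> points M"
    using c t by (auto simp: integral_curve_def constraint_mfd_def)
  have "Hausdorff_space (manifold_topology M)"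
    using smooth by (simp add: smooth_manifold_def)
  then obtain U V where UV: "openin (manifold_topology M) U" "openin (manifold_topology M) V"
    "fst (c t) \<in> U" "fst (c' t) \<in> V" "disjnt U V"
    using pt False unfolding Hausdorff_space_def topspace_manifold by blast
  show ?thesis
    using motion_base_continuous[OF c(1) t(1) UV(1,3)] motion_base_continuous[OF c(2) t(2) UV(2,4)]
    by eventually_elim (use UV(5) in \<open>auto simp: disjnt_iff\<close>)
next
  case True
  have "c t \<in> points (tangent_bundle M)" and t': "c' t \<in> points (tangent_bundle M)"
    using c t by (auto simp: integral_curve_def has_velocity_def)
  then obtain i where i: "c t \<in> cdom (tangent_bundle M) i" by (auto simp: points_def)
  have i': "c' t \<in> cdom (tangent_bundle M) i" using i t' True by (auto simp: cdom_TM points_def)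
  have "cmap (tangent_bundle M) i (c t) \<noteq> cmap (tangent_bundle M) i (c' t)"
    using ne i i' TM.inj[of i] by (auto simp: inj_on_def)
  then have "\<forall>\<^sub>F s in nhds t. cmap (tangent_bundle M) i (c s) - cmap (tangent_bundle M) i (c' s) \<noteq> 0"
    using tendsto_diff[OF motion_tendsto[OF c(1) t(1) i] motion_tendsto[OF c(2) t(2) i']]
    by (intro tendsto_imp_eventually_ne) auto
  then show ?thesis by eventually_elim auto
qed

lemma motion_unique:
  assumes c: "motion I c" "motion I' c'" and I: "open_interval_about_0 I" "open_interval_about_0 I'"
    and eq: "c 0 = c' 0" and t: "t \<in> I" "t \<in> I'"
  shows "c t = c' t"
proof -
  let ?J = "I \<inter> I'"
  have op: "open I" "open I'" and J: "is_interval ?J" "0 \<in> ?J"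
    using I by (auto simp: open_interval_about_0_def intro: is_interval_Int)
  let ?U = "{t \<in> ?J. c t = c' t}" and ?V = "{t \<in> ?J. c t \<noteq> c' t}"
  have "open ?U"
  proof (subst open_subopen, rule ballI)
    fix s assume s: "s \<in> ?U"
    have "\<forall>\<^sub>F r in nhds s. r \<in> ?U"
      using motions_agree_locally[OF c op, of s] s
        eventually_nhds_in_open[OF op(1), of s] eventually_nhds_in_open[OF op(2), of s]
      by (auto simp: eventually_conj_iff)
    then show "\<exists>T. open T \<and> s \<in> T \<and> T \<subseteq> ?U" unfolding eventually_nhds by blast
  qed
  moreover have "open ?V"
  proof (subst open_subopen, rule ballI)
    fix s assume s: "s \<in> ?V"
    have "\<forall>\<^sub>F r in nhds s. r \<in> ?V"
      using motions_disagree_locally[OF c, of s] s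
        eventually_nhds_in_open[OF op(1), of s] eventually_nhds_in_open[OF op(2), of s]
      by (auto simp: eventually_conj_iff)
    then show "\<exists>T. open T \<and> s \<in> T \<and> T \<subseteq> ?V" unfolding eventually_nhds by blast
  qed
  moreover have "connected ?J" using J(1) is_interval_connected_1 by blast
  moreover have "0 \<in> ?U" using J(2) eq by simp
  ultimately have "?V \<inter> ?J = {}"
    using connectedD[of ?J ?U ?V] by blast
  then show ?thesis using t by blast
qed

lemma nh_exp_motion:
  assumes c: "motion I c" and I: "open_interval_about_0 I" "1 \<in> I" and c0: "c 0 = (q, v)"
  shows "v \<in> nh_exp_dom M D \<Gamma> q" and "nh_exp M D \<Gamma> q v = fst (c 1)"
proof -
  have "(q, v) \<in> constraint_mfd M D"
    using c I(1) c0 by (auto simp: integral_curve_def open_interval_about_0_def)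
  then show "v \<in> nh_exp_dom M D \<Gamma> q"
    using c I c0 by (auto simp: nh_exp_dom_def flow_dom_def constraint_mfd_def)
  have "flow (tangent_bundle M) (constraint_mfd M D) \<Gamma> 1 (q, v) = c 1"
    unfolding flow_def
  proof (rule the_equality)
    show "\<exists>I' c'. open_interval_about_0 I' \<and> 1 \<in> I' \<and> motion I' c' \<and> c' 0 = (q, v) \<and> c' 1 = c 1"
      using c I c0 by blast
    show "p' = c 1" if "\<exists>I' c'. open_interval_about_0 I' \<and> 1 \<in> I' \<and> motion I' c' \<and> c' 0 = (q, v) \<and> c' 1 = p'" for p'
      using that motion_unique[OF _ c _ I(1) _ _ I(2)] c0 by auto
  qed
  then show "nh_exp M D \<Gamma> q v = fst (c 1)" by (simp add: nh_exp_def)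
qed

end


section \<open>Nonholonomic trajectories in a chart\<close>

context nonholonomic_system
begin

text \<open>
  In position and frame coefficients the constraint is the vanishing of some of the coefficients,
  which this differential equation preserves.
\<close>

definition motion_ode :: "'i \<Rightarrow> (real^'n) \<times> (real^'n) \<Rightarrow> (real^'n) \<times> (real^'n)" where
  "motion_ode i z = (frame_map i (fst z) (snd z),
     \<Sum>a\<in>A. force a (cinv (tangent_bundle M) i (fst z, frame_map i (fst z) (snd z))) *\<^sub>R axis a 1)"

lemma frame_map_C1: "C1_on (chart_image i \<times> UNIV) (\<lambda>z. frame_map i (fst z) (snd z))"
proof -
  have w: "C1_on (chart_image i \<times> UNIV) (\<lambda>z. snd z $ \<alpha>)" for \<alpha>
    by (rule C1_on_bounded_linear) (intro bounded_linear_compose[OF bounded_linear_vec_nth] bounded_linear_snd)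
  have e: "C1_on (chart_image i \<times> UNIV) (\<lambda>z. frame_rep i \<alpha> (fst z))" for \<alpha>
    by (rule C1_on_compose[OF C1_on_fst frame_rep_C1]) auto
  show ?thesis unfolding frame_map_def by (intro C1_on_sum C1_on_scaleR w e)
qed

lemma motion_ode_C1: "C1_on (chart_image i \<times> UNIV) (motion_ode i)"
proof -
  let ?S = "chart_image i \<times> (UNIV :: (real^'n) set)"
  have f: "C1_on ?S (\<lambda>z. force a (cinv (tangent_bundle M) i (fst z, frame_map i (fst z) (snd z))))"
    if "a \<in> A" for a
    by (rule C1_on_compose[OF C1_on_Pair[OF C1_on_fst frame_map_C1] force_C1[OF that]]) auto
  have "C1_on ?S (\<lambda>z. (frame_map i (fst z) (snd z),
     \<Sum>a\<in>A. force a (cinv (tangent_bundle M) i (fst z, frame_map i (fst z) (snd z))) *\<^sub>R (axis a 1 :: real^'n)))"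
    by (intro C1_on_Pair frame_map_C1 C1_on_sum C1_on_scaleR[OF f C1_on_const])
  then show ?thesis by (simp add: motion_ode_def[abs_def])
qed

lemma sum_axis_component:
  "(\<Sum>a\<in>A. h a *\<^sub>R (axis a 1 :: real^'n)) $ \<alpha> = (if \<alpha> \<in> A then h \<alpha> else 0)"
  by (simp add: axis_def if_distrib sum.delta cong: if_cong)

lemma coeff_tvec_frame_map:
  assumes x: "x \<in> chart_image i"
  shows "coeff (cinv M i x) (tvec M i (cinv M i x) (frame_map i x w)) = ($) w"
  unfolding tvec_frame_map[OF x] by (rule coeff_combination[OF points_I[OF cinv_cdom[OF x]]])

text \<open>
  The coefficients outside \<open>A\<close> have derivative 0 and start at 0, so they stay 0 and the velocity stays in
  \<open>D\<close>. Its derivative in the chart is then given by the product rule, in which the derivatives of the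
  frame contribute the complete lifts and the derivatives of the coefficients the vertical lifts.
\<close>

lemma motion_ode_solution:
  assumes z: "\<And>t. \<bar>t\<bar> < T \<Longrightarrow> (z has_vector_derivative motion_ode i (z t)) (at t)"
    and S: "\<And>t. \<bar>t\<bar> < T \<Longrightarrow> z t \<in> chart_image i \<times> UNIV"
    and z0: "\<And>\<alpha>. \<alpha> \<notin> A \<Longrightarrow> snd (z 0) $ \<alpha> = 0"
    and t: "\<bar>t\<bar> < T"
  defines "x \<equiv> \<lambda>t. fst (z t)" and "w \<equiv> \<lambda>t. snd (z t)"
  defines "y \<equiv> \<lambda>t. frame_map i (x t) (w t)"
  shows "(x has_vector_derivative y t) (at t)"
    and "(y has_vector_derivative accel_rep i (x t, y t, w t)) (at t)"
    and "tvec M i (cinv M i (x t)) (y t) \<in> D (cinv M i (x t))"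
    and "acceleration i (cinv M i (x t)) (tvec M i (cinv M i (x t)) (y t)) = accel_rep i (x t, y t, w t)"
proof -
  define f where "f = (\<lambda>t a. force a (cinv (tangent_bundle M) i (x t, y t)))"
  have ode: "motion_ode i (z t) = (y t, \<Sum>a\<in>A. f t a *\<^sub>R axis a 1)" for t
    by (simp add: motion_ode_def y_def x_def w_def f_def)
  have x': "(x has_vector_derivative y t) (at t)" if "\<bar>t\<bar> < T" for t
    using bounded_linear.has_vector_derivative[OF bounded_linear_fst z[OF that]] by (simp add: ode x_def)
  have w': "(w has_vector_derivative (\<Sum>a\<in>A. f t a *\<^sub>R axis a 1)) (at t)" if "\<bar>t\<bar> < T" for t
    using bounded_linear.has_vector_derivative[OF bounded_linear_snd z[OF that]] by (simp add: ode w_def)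
  have w\<alpha>': "((\<lambda>t. w t $ \<alpha>) has_vector_derivative (if \<alpha> \<in> A then f t \<alpha> else 0)) (at t)" if "\<bar>t\<bar> < T" for t \<alpha>
    using bounded_linear.has_vector_derivative[OF bounded_linear_vec_nth w'[OF that], of \<alpha>]
    unfolding sum_axis_component .
  have xS: "x t \<in> chart_image i" using S[OF t] by (simp add: x_def mem_Times_iff)
  note q = cinv_cdom[OF xS]
  have w0: "w t $ \<alpha> = 0" if "\<alpha> \<notin> A" for \<alpha>
  proof -
    have "norm (w t $ \<alpha> - w 0 $ \<alpha>) \<le> 0 * \<bar>t - 0\<bar>"
    proof (rule vector_mean_value[where f' = "\<lambda>_. 0"])
      show "convex {-T<..<T}" by simp
      show "((\<lambda>t. w t $ \<alpha>) has_vector_derivative 0) (at s within {-T<..<T})" if "s \<in> {-T<..<T}" for s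
        using w\<alpha>'[of s \<alpha>] that \<open>\<alpha> \<notin> A\<close> by (simp add: has_vector_derivative_at_within abs_less_iff)
    qed (use t in auto)
    then show ?thesis using z0[OF that] by (simp add: w_def)
  qed
  show "(x has_vector_derivative y t) (at t)" by (rule x'[OF t])
  have e': "((\<lambda>t. frame_rep i \<alpha> (x t)) has_vector_derivative frechet_derivative (frame_rep i \<alpha>) (at (x t)) (y t)) (at t)"
    for \<alpha>
    using vector_derivative_diff_chain_within[OF x'[OF t]
        has_derivative_at_withinI[OF C1_on_has_derivative[OF frame_rep_C1 xS]]]
    by (simp add: o_def)
  have "(y has_vector_derivative (\<Sum>\<alpha>\<in>UNIV. w t $ \<alpha> *\<^sub>R frechet_derivative (frame_rep i \<alpha>) (at (x t)) (y t)
      + (if \<alpha> \<in> A then f t \<alpha> else 0) *\<^sub>R frame_rep i \<alpha> (x t))) (at t)"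
    unfolding y_def frame_map_def
    by (intro has_vector_derivative_sum has_vector_derivative_scaleR)
       (use w\<alpha>'[OF t] e' in \<open>simp_all add: has_real_derivative_iff_has_vector_derivative y_def frame_map_def\<close>)
  also have "(\<Sum>\<alpha>\<in>UNIV. w t $ \<alpha> *\<^sub>R frechet_derivative (frame_rep i \<alpha>) (at (x t)) (y t)
      + (if \<alpha> \<in> A then f t \<alpha> else 0) *\<^sub>R frame_rep i \<alpha> (x t)) = accel_rep i (x t, y t, w t)"
    unfolding accel_rep_def f_def by (rule sum.mono_neutral_cong_right) (auto simp: w0)
  finally show "(y has_vector_derivative accel_rep i (x t, y t, w t)) (at t)" .
  have tv: "tvec M i (cinv M i (x t)) (y t) \<in> tangent_space M (cinv M i (x t))" by (rule tvec_tangent[OF q])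
  then show "tvec M i (cinv M i (x t)) (y t) \<in> D (cinv M i (x t))"
    by (simp add: D_iff[OF points_I[OF q]] y_def coeff_tvec_frame_map[OF xS] w0)
  show "acceleration i (cinv M i (x t)) (tvec M i (cinv M i (x t)) (y t)) = accel_rep i (x t, y t, w t)"
    unfolding acceleration_accel_rep[OF q tv]
    by (simp add: y_def coeff_tvec_frame_map[OF xS] cmap_cinv[OF xS] tvec_self[OF q])
qed

text \<open>
  By homogeneity of the acceleration, \<open>c (t \<tau>)\<close> is the trajectory with initial velocity \<open>t v\<close> if
  \<open>c\<close> is the one with initial velocity \<open>v\<close>; at \<open>\<tau> = 1\<close> this computes the exponential map.
\<close>

lemma nh_exp_trajectory:
  assumes q: "q \<in> cdom M i" and v: "v \<in> D q"
    and x: "\<And>t. \<bar>t\<bar> < T \<Longrightarrow> x t \<in> chart_image i"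
    and x': "\<And>t. \<bar>t\<bar> < T \<Longrightarrow> (x has_vector_derivative y t) (at t)"
    and y': "\<And>t. \<bar>t\<bar> < T \<Longrightarrow>
      (y has_vector_derivative acceleration i (cinv M i (x t)) (tvec M i (cinv M i (x t)) (y t))) (at t)"
    and yD: "\<And>t. \<bar>t\<bar> < T \<Longrightarrow> tvec M i (cinv M i (x t)) (y t) \<in> D (cinv M i (x t))"
    and x0: "x 0 = cmap M i q" and y0: "y 0 = v i" and t: "\<bar>t\<bar> < T"
  shows "t *\<^sub>R v \<in> nh_exp_dom M D \<Gamma> q" and "nh_exp M D \<Gamma> q (t *\<^sub>R v) = cinv M i (x t)"
proof -
  define I where "I = {\<tau>. \<bar>t * \<tau>\<bar> < T}"
  define c where "c = (\<lambda>\<tau>. (cinv M i (x (t * \<tau>)), tvec M i (cinv M i (x (t * \<tau>))) (t *\<^sub>R y (t * \<tau>))))"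
  have T: "T > 0" using t by linarith
  have "open I" unfolding I_def by (intro open_Collect_less continuous_intros)
  moreover have "is_interval I"
  proof -
    have "convex I"
    proof (rule convexI)
      fix \<tau> \<sigma> \<mu> \<nu> :: real assume h: "\<tau> \<in> I" "\<sigma> \<in> I" "0 \<le> \<mu>" "0 \<le> \<nu>" "\<mu> + \<nu> = 1"
      have "t * \<tau> \<in> {-T<..<T}" "t * \<sigma> \<in> {-T<..<T}" using h(1,2) by (auto simp: I_def)
      then have "\<mu> *\<^sub>R (t * \<tau>) + \<nu> *\<^sub>R (t * \<sigma>) \<in> {-T<..<T}"
        using h(3-5) by (intro convexD) auto
      then show "\<mu> *\<^sub>R \<tau> + \<nu> *\<^sub>R \<sigma> \<in> I" by (auto simp: I_def algebra_simps)
    qed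
    then show ?thesis using is_interval_convex_1 by blast
  qed
  ultimately have I: "open_interval_about_0 I" "1 \<in> I" "open I"
    using T t by (auto simp: open_interval_about_0_def I_def)
  have "c \<tau> \<in> constraint_mfd M D \<and> has_velocity (tangent_bundle M) c \<tau> (\<Gamma> (c \<tau>))" if \<tau>: "\<tau> \<in> I" for \<tau>
  proof
    have \<tau>': "\<bar>t * \<tau>\<bar> < T" using \<tau> by (simp add: I_def)
    note xS = x[OF \<tau>'] note p = cinv_cdom[OF xS]
    have cD: "tvec M i (cinv M i (x (t * \<tau>))) (t *\<^sub>R y (t * \<tau>)) \<in> D (cinv M i (x (t * \<tau>)))"
      unfolding tvec_scaleR[OF p] by (rule subspace_scale[OF subspace_D[OF points_I[OF p]] yD[OF \<tau>']])
    then show "c \<tau> \<in> constraint_mfd M D" by (simp add: c_def constraint_mfd_def points_I[OF p])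
    have lin: "((\<lambda>\<tau>. t * \<tau>) has_vector_derivative t) (at \<tau>)"
      by (auto intro!: derivative_eq_intros simp: has_vector_derivative_def)
    let ?a = "acceleration i (cinv M i (x (t * \<tau>))) (tvec M i (cinv M i (x (t * \<tau>))) (y (t * \<tau>)))"
    show "has_velocity (tangent_bundle M) c \<tau> (\<Gamma> (c \<tau>))"
      unfolding c_def
    proof (rule has_velocity_TM[where I = I and a = "(t * t) *\<^sub>R ?a"])
      show "x (t * s) \<in> chart_image i" if "s \<in> I" for s using that by (intro x) (simp add: I_def)
      show "((\<lambda>\<tau>. x (t * \<tau>)) has_vector_derivative t *\<^sub>R y (t * \<tau>)) (at \<tau>)"
        using vector_diff_chain_at[OF lin x'[OF \<tau>']] by (simp add: o_def)
      have "((\<lambda>\<tau>. y (t * \<tau>)) has_vector_derivative t *\<^sub>R ?a) (at \<tau>)"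
        using vector_diff_chain_at[OF lin y'[OF \<tau>']] by (simp add: o_def)
      from bounded_linear.has_vector_derivative[OF bounded_linear_scaleR_right[of t] this]
      show "((\<lambda>\<tau>. t *\<^sub>R y (t * \<tau>)) has_vector_derivative (t * t) *\<^sub>R ?a) (at \<tau>)" by simp
      show "\<Gamma> (cinv M i (x (t * \<tau>)), tvec M i (cinv M i (x (t * \<tau>))) (t *\<^sub>R y (t * \<tau>)))
          \<in> tangent_space (tangent_bundle M) (cinv M i (x (t * \<tau>)), tvec M i (cinv M i (x (t * \<tau>))) (t *\<^sub>R y (t * \<tau>)))"
        by (rule \<Gamma>_tangent[OF points_I[OF p] cD])
      show "\<Gamma> (cinv M i (x (t * \<tau>)), tvec M i (cinv M i (x (t * \<tau>))) (t *\<^sub>R y (t * \<tau>))) i =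
          (t *\<^sub>R y (t * \<tau>), (t * t) *\<^sub>R ?a)"
        unfolding \<Gamma>_chart[OF p cD] tvec_self[OF p]
        by (simp only: tvec_scaleR[OF p] acceleration_homogeneous[OF p yD[OF \<tau>']])
    qed (use \<tau> I(3) in auto)
  qed
  then have c: "motion I c" unfolding integral_curve_def by blast
  have c0: "c 0 = (q, t *\<^sub>R v)"
    using q tvec_rep[OF D_tangent[OF points_I[OF q] v] q] by (simp add: c_def x0 y0 tvec_scaleR)
  show "t *\<^sub>R v \<in> nh_exp_dom M D \<Gamma> q" by (rule nh_exp_motion(1)[OF c I(1,2) c0])
  have "fst (c 1) = cinv M i (x t)" by (simp add: c_def)
  with nh_exp_motion(2)[OF c I(1,2) c0] show "nh_exp M D \<Gamma> q (t *\<^sub>R v) = cinv M i (x t)"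
    by (simp only:)
qed

text \<open>
  The trajectories with initial velocities \<open>v + s u\<close>. The variation field \<open>\<xi>\<close>, the derivative
  of the position in \<open>s\<close>, has the derivative \<open>\<eta>\<close> of the velocity in \<open>s\<close> as its derivative in \<open>t\<close>.
\<close>

lemma local_trajectories:
  assumes q: "q \<in> cdom M i" and v: "v \<in> D q" and u: "u \<in> D q"
  obtains T \<delta> x w \<xi> \<eta> y a where "T > 0" "\<delta> > 0"
    and "\<And>s t. y s t = frame_map i (x s t) (w s t)"
    and "\<And>s t. \<bar>s\<bar> < \<delta> \<Longrightarrow> \<bar>t\<bar> < T \<Longrightarrow> x s t \<in> chart_image i"
    and "\<And>s t. \<bar>s\<bar> < \<delta> \<Longrightarrow> \<bar>t\<bar> < T \<Longrightarrow> (x s has_vector_derivative y s t) (at t)"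
    and "\<And>s t. \<bar>s\<bar> < \<delta> \<Longrightarrow> \<bar>t\<bar> < T \<Longrightarrow> (y s has_vector_derivative a s t) (at t)"
    and "\<And>s t. \<bar>s\<bar> < \<delta> \<Longrightarrow> \<bar>t\<bar> < T \<Longrightarrow> tvec M i (cinv M i (x s t)) (y s t) \<in> D (cinv M i (x s t))"
    and "\<And>s t. \<bar>s\<bar> < \<delta> \<Longrightarrow> \<bar>t\<bar> < T \<Longrightarrow>
      acceleration i (cinv M i (x s t)) (tvec M i (cinv M i (x s t)) (y s t)) = a s t"
    and "\<And>s. \<bar>s\<bar> < \<delta> \<Longrightarrow> x s 0 = cmap M i q" and "\<And>s. \<bar>s\<bar> < \<delta> \<Longrightarrow> y s 0 = (v + s *\<^sub>R u) i"
    and "continuous_on {-T<..<T} (a 0)" and "continuous_on {-T<..<T} (w 0)"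
    and "\<And>t. \<bar>t\<bar> < T \<Longrightarrow> ((\<lambda>s. x s t) has_vector_derivative \<xi> t) (at 0)"
    and "\<And>t. \<bar>t\<bar> < T \<Longrightarrow> ((\<lambda>s. y s t) has_vector_derivative \<eta> t) (at 0)"
    and "\<And>t. \<bar>t\<bar> < T \<Longrightarrow> (\<xi> has_vector_derivative \<eta> t) (at t)"
    and "\<xi> 0 = 0" and "\<eta> 0 = u i"
    and "\<And>s t. \<bar>s\<bar> < \<delta> \<Longrightarrow> \<bar>t\<bar> < T \<Longrightarrow> t *\<^sub>R (v + s *\<^sub>R u) \<in> nh_exp_dom M D \<Gamma> q"
    and "\<And>s t. \<bar>s\<bar> < \<delta> \<Longrightarrow> \<bar>t\<bar> < T \<Longrightarrow> nh_exp M D \<Gamma> q (t *\<^sub>R (v + s *\<^sub>R u)) = cinv M i (x s t)"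
proof -
  note p = points_I[OF q]
  define W where "W = (\<lambda>v. \<chi> \<alpha>. coeff q v \<alpha>)"
  have vs: "v + s *\<^sub>R u \<in> D q" for s
    by (intro subspace_add[OF subspace_D[OF p]] subspace_scale[OF subspace_D[OF p]] v u)
  have W_lin: "W v + s *\<^sub>R W u = W (v + s *\<^sub>R u)" for s
    using coeff_linear(1)[OF p D_tangent[OF p v] subspace_scale[OF subspace_tangent_space D_tangent[OF p u]]]
      coeff_linear(2)[OF p D_tangent[OF p u]]
    by (simp add: W_def vec_eq_iff)
  have W_rep: "frame_map i (cmap M i q) (W v) = v i" if "v \<in> D q" for v
    unfolding W_def by (rule frame_map_coeff[OF q D_tangent[OF p that]])
  let ?S = "chart_image i \<times> (UNIV :: (real^'n) set)"
  have S: "open ?S" by (intro open_Times open_chart open_UNIV)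
  have z0: "(cmap M i q, W v) \<in> ?S" using q by simp
  obtain T \<delta> Z \<zeta> where T: "T > 0" and \<delta>: "\<delta> > 0"
    and Z0: "\<And>s. \<bar>s\<bar> < \<delta> \<Longrightarrow> Z s 0 = (cmap M i q, W v) + s *\<^sub>R (0, W u)"
    and ZS: "\<And>s t. \<bar>s\<bar> < \<delta> \<Longrightarrow> t \<in> {-T..T} \<Longrightarrow> Z s t \<in> ?S"
    and Z': "\<And>s t. \<bar>s\<bar> < \<delta> \<Longrightarrow> t \<in> {-T..T} \<Longrightarrow>
      (Z s has_vector_derivative motion_ode i (Z s t)) (at t within {-T..T})"
    and \<zeta>0: "\<zeta> 0 = (0, W u)"
    and \<zeta>': "\<And>t. t \<in> {-T..T} \<Longrightarrow>
      (\<zeta> has_vector_derivative frechet_derivative (motion_ode i) (at (Z 0 t)) (\<zeta> t)) (at t within {-T..T})"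
    and Zs: "\<And>t. t \<in> {-T..T} \<Longrightarrow> ((\<lambda>s. Z s t) has_vector_derivative \<zeta> t) (at 0)"
    by (rule flow_differentiable_in_initial_value[OF motion_ode_C1 S z0, of "(0, W u)"]) blast
  have inner: "at t within {-T..T} = at t" if "\<bar>t\<bar> < T" for t
    using that by (intro at_within_Icc_at) auto
  have Zat: "(Z s has_vector_derivative motion_ode i (Z s t)) (at t)" if "\<bar>s\<bar> < \<delta>" "\<bar>t\<bar> < T" for s t
  proof -
    have "t \<in> {-T..T}" using that(2) by auto
    from Z'[OF that(1) this] show ?thesis by (simp only: inner[OF that(2)])
  qed
  have ZSat: "Z s t \<in> ?S" if "\<bar>s\<bar> < \<delta>" "\<bar>t\<bar> < T" for s t
    using that by (intro ZS) auto
  have Z00: "snd (Z s 0) $ \<alpha> = 0" if "\<bar>s\<bar> < \<delta>" "\<alpha> \<notin> A" for s \<alpha>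
    using vs[of s] that by (simp add: Z0 W_lin) (simp add: W_def D_iff[OF p])
  define x where "x = (\<lambda>s t. fst (Z s t))"
  define w where "w = (\<lambda>s t. snd (Z s t))"
  define y where "y = (\<lambda>s t. frame_map i (x s t) (w s t))"
  define a where "a = (\<lambda>s t. accel_rep i (x s t, y s t, w s t))"
  have sol1: "(x s has_vector_derivative y s t) (at t)"
    and sol2: "(y s has_vector_derivative a s t) (at t)"
    and sol3: "tvec M i (cinv M i (x s t)) (y s t) \<in> D (cinv M i (x s t))"
    and sol4: "acceleration i (cinv M i (x s t)) (tvec M i (cinv M i (x s t)) (y s t)) = a s t"
    if "\<bar>s\<bar> < \<delta>" "\<bar>t\<bar> < T" for s t
    using motion_ode_solution[of T "Z s" i t, OF Zat[OF that(1)] ZSat[OF that(1)] Z00[OF that(1)] that(2)]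
    by (simp_all add: x_def w_def y_def a_def)
  have xS: "x s t \<in> chart_image i" if "\<bar>s\<bar> < \<delta>" "\<bar>t\<bar> < T" for s t
    using ZSat[OF that] by (simp add: x_def mem_Times_iff)
  have x0: "x s 0 = cmap M i q" if "\<bar>s\<bar> < \<delta>" for s using Z0[OF that] by (simp add: x_def)
  have y0: "y s 0 = (v + s *\<^sub>R u) i" if "\<bar>s\<bar> < \<delta>" for s
    using Z0[OF that] W_rep[OF vs[of s]] by (simp add: y_def x0[OF that] w_def W_lin)
  have d0: "\<bar>0\<bar> < \<delta>" using \<delta> by simp
  have cZ: "continuous_on {-T<..<T} (Z 0)"
    by (rule has_vector_derivative_imp_continuous_on[OF has_vector_derivative_at_within[OF Zat[OF d0]]]) auto
  have cx: "continuous_on {-T<..<T} (x 0)" and cw: "continuous_on {-T<..<T} (w 0)"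
    unfolding x_def w_def by (intro continuous_on_fst continuous_on_snd cZ)+
  have cy: "continuous_on {-T<..<T} (y 0)"
    by (rule has_vector_derivative_imp_continuous_on[OF has_vector_derivative_at_within[OF sol2[OF d0]]]) auto
  have ca: "continuous_on {-T<..<T} (a 0)"
    unfolding a_def
    by (rule continuous_on_compose2[OF C1_on_continuous[OF accel_rep_C1]])
       (use xS[OF d0] in \<open>auto intro!: continuous_on_Pair cx cy cw simp: abs_less_iff\<close>)
  define \<xi> where "\<xi> = (\<lambda>t. fst (\<zeta> t))"
  define \<eta> where "\<eta> = (\<lambda>t. fst (frechet_derivative (motion_ode i) (at (Z 0 t)) (\<zeta> t)))"
  have Zs': "((\<lambda>s. Z s t) has_vector_derivative \<zeta> t) (at 0)" if "\<bar>t\<bar> < T" for t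
    using that by (intro Zs) auto
  have \<xi>s: "((\<lambda>s. x s t) has_vector_derivative \<xi> t) (at 0)" if "\<bar>t\<bar> < T" for t
    unfolding x_def \<xi>_def by (rule bounded_linear.has_vector_derivative[OF bounded_linear_fst Zs'[OF that]])
  have \<xi>': "(\<xi> has_vector_derivative \<eta> t) (at t)" if "\<bar>t\<bar> < T" for t
  proof -
    have "(\<zeta> has_vector_derivative frechet_derivative (motion_ode i) (at (Z 0 t)) (\<zeta> t)) (at t)"
    proof -
      have "t \<in> {-T..T}" using that by auto
      from \<zeta>'[OF this] show ?thesis by (simp only: inner[OF that])
    qed
    from bounded_linear.has_vector_derivative[OF bounded_linear_fst this]
    show ?thesis by (simp add: \<xi>_def[abs_def] \<eta>_def)
  qed
  have \<eta>s: "((\<lambda>s. y s t) has_vector_derivative \<eta> t) (at 0)" if "\<bar>t\<bar> < T" for t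
  proof -
    have "((\<lambda>s. motion_ode i (Z s t)) has_vector_derivative
        frechet_derivative (motion_ode i) (at (Z 0 t)) (\<zeta> t)) (at 0)"
      using vector_derivative_diff_chain_within[OF Zs'[OF that]
          has_derivative_at_withinI[OF C1_on_has_derivative[OF motion_ode_C1 ZSat[OF d0 that]]]]
      by (simp add: o_def)
    from bounded_linear.has_vector_derivative[OF bounded_linear_fst this]
    show ?thesis by (simp add: \<eta>_def motion_ode_def y_def x_def w_def)
  qed
  have "((\<lambda>s. v i + s *\<^sub>R u i) has_vector_derivative u i) (at 0)"
    by (auto intro!: derivative_eq_intros)
  then have "((\<lambda>s. y s 0) has_vector_derivative u i) (at 0)"
    by (rule has_vector_derivative_transform_within_open[where S = "{-\<delta><..<\<delta>}"])
       (use \<delta> y0 in \<open>auto simp: plus_fun_def abs_less_iff\<close>)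
  moreover have "\<bar>0\<bar> < T" using T by simp
  ultimately have \<eta>0: "\<eta> 0 = u i" using \<eta>s[of 0] vector_derivative_unique_at by blast
  have exp: "t *\<^sub>R (v + s *\<^sub>R u) \<in> nh_exp_dom M D \<Gamma> q"
    "nh_exp M D \<Gamma> q (t *\<^sub>R (v + s *\<^sub>R u)) = cinv M i (x s t)" if "\<bar>s\<bar> < \<delta>" "\<bar>t\<bar> < T" for s t
    using nh_exp_trajectory[of q i "v + s *\<^sub>R u" T "x s" "y s" t, OF q vs xS[OF that(1)] sol1[OF that(1)] _
        sol3[OF that(1)] x0[OF that(1)] y0[OF that(1)] that(2)] sol2[OF that(1)] sol4[OF that(1)]
    by simp_all
  show thesis
    by (rule that[of T \<delta> y x w a \<xi> \<eta>])
       (use T \<delta> xS sol1 sol2 sol3 sol4 x0 y0 ca cw \<xi>s \<eta>s \<xi>' \<eta>0 exp \<zeta>0 in \<open>simp_all add: y_def \<xi>_def\<close>)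
qed

end


section \<open>The component of the acceleration in the distribution\<close>

context nonholonomic_system
begin

lemma nh_exp_tangent_chart:
  assumes U: "open U" "0 \<in> U" and eq: "\<And>\<sigma>. \<sigma> \<in> U \<Longrightarrow> nh_exp M D \<Gamma> q (v + \<sigma> *\<^sub>R u) = cinv M i (X \<sigma>)"
    and X: "\<And>\<sigma>. \<sigma> \<in> U \<Longrightarrow> X \<sigma> \<in> chart_image i" and X': "(X has_vector_derivative Y) (at 0)"
  shows "nh_exp_tangent M D \<Gamma> q v u = tvec M i (cinv M i (X 0)) Y"
proof -
  let ?c = "\<lambda>\<sigma>. nh_exp M D \<Gamma> q (v + \<sigma> *\<^sub>R u)"
  have c0: "?c 0 = cinv M i (X 0)" by (rule eq[OF U(2)])
  have "velocity M ?c 0 = tvec M i (?c 0) Y"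
  proof (rule velocity_chart)
    show "?c 0 \<in> cdom M i" unfolding c0 by (rule cinv_cdom[OF X[OF U(2)]])
    show "\<forall>\<^sub>F \<sigma> in nhds 0. ?c \<sigma> \<in> cdom M i"
      using eventually_nhds_in_open[OF U] by eventually_elim (use eq X cinv_cdom in simp)
    show "((\<lambda>\<sigma>. cmap M i (?c \<sigma>)) has_vector_derivative Y) (at 0)"
      by (rule has_vector_derivative_transform_within_open[OF X' U]) (simp add: eq cmap_cinv[OF X])
  qed
  then show ?thesis by (simp only: nh_exp_tangent_def c0)
qed

text \<open>
  The curve \<open>\<sigma> \<mapsto> t v + \<sigma> t v\<close> is mapped to the trajectory itself, at time \<open>t (1 + \<sigma>)\<close>.
\<close>

lemma nh_exp_tangent_radial:
  assumes X: "\<And>t. \<bar>t\<bar> < T \<Longrightarrow> X t \<in> chart_image i"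
    and X': "\<And>t. \<bar>t\<bar> < T \<Longrightarrow> (X has_vector_derivative Y t) (at t)"
    and exp: "\<And>t. \<bar>t\<bar> < T \<Longrightarrow> nh_exp M D \<Gamma> q (t *\<^sub>R v) = cinv M i (X t)"
    and t: "\<bar>t\<bar> < T"
  shows "nh_exp_tangent M D \<Gamma> q (t *\<^sub>R v) (t *\<^sub>R v) = tvec M i (cinv M i (X t)) (t *\<^sub>R Y t)"
proof -
  let ?U = "{\<sigma>. \<bar>t * (1 + \<sigma>)\<bar> < T}"
  have U: "open ?U" by (intro open_Collect_less continuous_intros)
  have lin: "((\<lambda>\<sigma>. t * (1 + \<sigma>)) has_vector_derivative t) (at 0)"
    by (auto intro!: derivative_eq_intros simp: has_vector_derivative_def)
  have d: "((\<lambda>\<sigma>. X (t * (1 + \<sigma>))) has_vector_derivative t *\<^sub>R Y t) (at 0)"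
    using vector_diff_chain_at[OF lin, of X "Y t"] X'[OF t] by (simp add: o_def)
  have "nh_exp_tangent M D \<Gamma> q (t *\<^sub>R v) (t *\<^sub>R v) =
      tvec M i (cinv M i (X (t * (1 + 0)))) (t *\<^sub>R Y t)"
  proof (rule nh_exp_tangent_chart[OF U _ _ _ d])
    fix \<sigma> assume \<sigma>: "\<sigma> \<in> ?U"
    have "t *\<^sub>R v + \<sigma> *\<^sub>R t *\<^sub>R v = (t * (1 + \<sigma>)) *\<^sub>R v"
      by (simp add: scaleR_add_left[symmetric] algebra_simps del: scaleR_add_left)
    then show "nh_exp M D \<Gamma> q (t *\<^sub>R v + \<sigma> *\<^sub>R t *\<^sub>R v) = cinv M i (X (t * (1 + \<sigma>)))"
      using exp[of "t * (1 + \<sigma>)"] \<sigma> by simp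
    show "X (t * (1 + \<sigma>)) \<in> chart_image i" using \<sigma> by (intro X) simp
  qed (use t in simp)
  then show ?thesis by simp
qed

end

locale geodesic_candidate = nonholonomic_system M g D E A \<Gamma> + H: riemannian_atlas M gh
  for M :: "('i, 'q, real^'n) atlas"
    and g gh :: "'q \<Rightarrow> ('i \<Rightarrow> real^'n) \<Rightarrow> ('i \<Rightarrow> real^'n) \<Rightarrow> real"
    and D :: "'q \<Rightarrow> ('i \<Rightarrow> real^'n) set"
    and E :: "'n \<Rightarrow> 'q \<Rightarrow> 'i \<Rightarrow> real^'n"
    and A :: "'n set"
    and \<Gamma> :: "'q \<times> ('i \<Rightarrow> real^'n) \<Rightarrow> 'i \<Rightarrow> (real^'n) \<times> (real^'n)" +
  assumes modification: "preserving_modification M D g gh"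
    and gauss: "\<And>q v u. q \<in> points M \<Longrightarrow> v \<in> nh_exp_dom M D \<Gamma> q \<Longrightarrow> u \<in> D q \<Longrightarrow>
      gh (nh_exp M D \<Gamma> q v) (nh_exp_tangent M D \<Gamma> q v v) (nh_exp_tangent M D \<Gamma> q v u) = gh q v u"
    and transport: "\<And>q v w c I W h t. q \<in> points M \<Longrightarrow> v \<in> D q \<Longrightarrow> w \<in> orth_compl M g D q \<Longrightarrow>
      c = (\<lambda>s. nh_exp M D \<Gamma> q (s *\<^sub>R v)) \<Longrightarrow>
      open_interval_about_0 I \<Longrightarrow> (\<forall>s\<in>I. s *\<^sub>R v \<in> nh_exp_dom M D \<Gamma> q) \<Longrightarrow>
      parallel_transport M E (nabla_bar M g D) I c w W \<Longrightarrow>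
      oneform_solution M E (nabla_bar M g D) I c (multiplier_form M E A (kinetic g) \<Gamma> c) h \<Longrightarrow>
      t \<in> I \<Longrightarrow>
      gh (nh_exp M D \<Gamma> q (t *\<^sub>R v)) (nh_exp_tangent M D \<Gamma> q (t *\<^sub>R v) (t *\<^sub>R v)) (W t)
        + t * h t (W t) = gh q (t *\<^sub>R v) w"
begin

text \<open>
  Along the variation field \<open>\<xi>\<close> of trajectories with initial velocities \<open>v + s u\<close> the first
  condition says \<open>gh (c', \<xi>) = t gh (v, u)\<close>, and for \<open>u = v\<close> that each trajectory has constant
  \<open>gh\<close>-speed. The derivative of the former in \<open>t\<close> minus half the derivative of the squared speed in
  \<open>s\<close> is the inner product of \<open>\<xi>\<close> with the covariant acceleration; since \<open>\<xi> / t\<close> tends to \<open>u\<close>,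
  that inner product vanishes at \<open>u\<close> in the limit.
\<close>

lemma acceleration_orthogonal_D:
  assumes q: "q \<in> cdom M i" and v: "v \<in> D q" and u: "u \<in> D q"
  shows "H.met i (cmap M i q) (acceleration i q v) (u i)
    + H.christoffel1 i (cmap M i q) (v i) (v i) (u i) = 0"
proof -
  note p = points_I[OF q]
  have tu: "u \<in> tangent_space M q" and tv: "v \<in> tangent_space M q"
    using D_tangent[OF p] u v by blast+
  have vs: "v + s *\<^sub>R u \<in> D q" for s
    by (intro subspace_add[OF subspace_D[OF p]] subspace_scale[OF subspace_D[OF p]] v u)
  obtain T \<delta> x w \<xi> \<eta> y a where T: "T > 0" and \<delta>: "\<delta> > 0"
    and xS: "\<And>s t. \<bar>s\<bar> < \<delta> \<Longrightarrow> \<bar>t\<bar> < T \<Longrightarrow> x s t \<in> chart_image i"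
    and x': "\<And>s t. \<bar>s\<bar> < \<delta> \<Longrightarrow> \<bar>t\<bar> < T \<Longrightarrow> (x s has_vector_derivative y s t) (at t)"
    and y': "\<And>s t. \<bar>s\<bar> < \<delta> \<Longrightarrow> \<bar>t\<bar> < T \<Longrightarrow> (y s has_vector_derivative a s t) (at t)"
    and acc: "\<And>s t. \<bar>s\<bar> < \<delta> \<Longrightarrow> \<bar>t\<bar> < T \<Longrightarrow>
      acceleration i (cinv M i (x s t)) (tvec M i (cinv M i (x s t)) (y s t)) = a s t"
    and x0: "\<And>s. \<bar>s\<bar> < \<delta> \<Longrightarrow> x s 0 = cmap M i q" and y0: "\<And>s. \<bar>s\<bar> < \<delta> \<Longrightarrow> y s 0 = (v + s *\<^sub>R u) i"
    and ca: "continuous_on {-T<..<T} (a 0)"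
    and \<xi>s: "\<And>t. \<bar>t\<bar> < T \<Longrightarrow> ((\<lambda>s. x s t) has_vector_derivative \<xi> t) (at 0)"
    and \<eta>s: "\<And>t. \<bar>t\<bar> < T \<Longrightarrow> ((\<lambda>s. y s t) has_vector_derivative \<eta> t) (at 0)"
    and \<xi>': "\<And>t. \<bar>t\<bar> < T \<Longrightarrow> (\<xi> has_vector_derivative \<eta> t) (at t)"
    and \<xi>0: "\<xi> 0 = 0" and \<eta>0: "\<eta> 0 = u i"
    and dom: "\<And>s t. \<bar>s\<bar> < \<delta> \<Longrightarrow> \<bar>t\<bar> < T \<Longrightarrow> t *\<^sub>R (v + s *\<^sub>R u) \<in> nh_exp_dom M D \<Gamma> q"
    and exp: "\<And>s t. \<bar>s\<bar> < \<delta> \<Longrightarrow> \<bar>t\<bar> < T \<Longrightarrow> nh_exp M D \<Gamma> q (t *\<^sub>R (v + s *\<^sub>R u)) = cinv M i (x s t)"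
    by (rule local_trajectories[OF q v u]) blast
  have d0: "\<bar>0\<bar> < \<delta>" using \<delta> by simp
  have radial: "nh_exp_tangent M D \<Gamma> q (t *\<^sub>R (v + s *\<^sub>R u)) (t *\<^sub>R (v + s *\<^sub>R u)) =
      tvec M i (cinv M i (x s t)) (t *\<^sub>R y s t)" if s: "\<bar>s\<bar> < \<delta>" and t: "\<bar>t\<bar> < T" for s t
    by (rule nh_exp_tangent_radial[OF xS[OF s] x'[OF s] exp[OF s] t])
  have transverse: "nh_exp_tangent M D \<Gamma> q (t *\<^sub>R v) u = tvec M i (cinv M i (x 0 t)) ((1 / t) *\<^sub>R \<xi> t)"
    if t: "\<bar>t\<bar> < T" "t \<noteq> 0" for t
  proof -
    let ?U = "{\<sigma>. \<bar>\<sigma> / t\<bar> < \<delta>}"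
    have "open ?U" by (intro open_Collect_less continuous_intros) (use t in auto)
    moreover have lin: "((\<lambda>\<sigma>. \<sigma> / t) has_vector_derivative 1 / t) (at 0)"
      using t by (auto intro!: derivative_eq_intros simp: has_vector_derivative_def)
    have "((\<lambda>\<sigma>. x (\<sigma> / t) t) has_vector_derivative (1 / t) *\<^sub>R \<xi> t) (at 0)"
      using vector_diff_chain_at[OF lin, of "\<lambda>s. x s t" "\<xi> t"] \<xi>s[OF t(1)] by (simp add: o_def)
    ultimately have "nh_exp_tangent M D \<Gamma> q (t *\<^sub>R v) u = tvec M i (cinv M i (x (0 / t) t)) ((1 / t) *\<^sub>R \<xi> t)"
    proof (intro nh_exp_tangent_chart[where U = ?U and X = "\<lambda>\<sigma>. x (\<sigma> / t) t"])
      fix \<sigma> assume \<sigma>: "\<sigma> \<in> ?U"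
      have "t *\<^sub>R v + \<sigma> *\<^sub>R u = t *\<^sub>R (v + (\<sigma> / t) *\<^sub>R u)" using t(2) by (simp add: scaleR_add_right)
      then show "nh_exp M D \<Gamma> q (t *\<^sub>R v + \<sigma> *\<^sub>R u) = cinv M i (x (\<sigma> / t) t)"
        using exp[of "\<sigma> / t" t] \<sigma> t(1) by simp
    qed (use t \<delta> xS in auto)
    then show ?thesis by simp
  qed
  let ?x0 = "cmap M i q"
  have x0S: "?x0 \<in> chart_image i" using q by simp
  define C where "C = H.met i ?x0 (v i) (u i)"
  have lemma_A: "H.met i (x 0 t) (y 0 t) (\<xi> t) = t * C" if t: "\<bar>t\<bar> < T" for t
  proof (cases "t = 0")
    case True
    then show ?thesis using linear_0[OF H.linear_met_right[OF xS[OF d0 t]]] by (simp add: \<xi>0)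
  next
    case False
    note X = xS[OF d0 t] note pt = cinv_cdom[OF X]
    have "H.met i (x 0 t) (t *\<^sub>R y 0 t) ((1 / t) *\<^sub>R \<xi> t) = gh q (t *\<^sub>R v) u"
      using gauss[OF p dom[OF d0 t] u] radial[OF d0 t] transverse[OF t False] exp[OF d0 t]
      by (simp add: metric_rep_def)
    moreover have "gh q (t *\<^sub>R v) u = t * C"
      using H.met_eq[OF q subspace_scale[OF subspace_tangent_space tv, of t] tu]
        linear_cmul[OF H.linear_met_left[OF x0S], of t "v i" "u i"]
      by (simp add: C_def)
    ultimately show ?thesis
      using False linear_cmul[OF H.linear_met_left[OF X], of t] linear_cmul[OF H.linear_met_right[OF X], of _ "1 / t"]
      by simp
  qed
  have lemma_B: "H.met i (x s t) (y s t) (y s t) = H.met i ?x0 (v i + s *\<^sub>R u i) (v i + s *\<^sub>R u i)"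
    if s: "\<bar>s\<bar> < \<delta>" and t: "\<bar>t\<bar> < T" "t \<noteq> 0" for s t
  proof -
    let ?v = "v + s *\<^sub>R u"
    note X = xS[OF s t(1)]
    have tvs: "?v \<in> tangent_space M q" by (rule D_tangent[OF p vs])
    have tv': "t *\<^sub>R ?v \<in> D q" by (rule subspace_scale[OF subspace_D[OF p] vs])
    have "H.met i (x s t) (t *\<^sub>R y s t) (t *\<^sub>R y s t) = gh q (t *\<^sub>R ?v) (t *\<^sub>R ?v)"
      using gauss[OF p dom[OF s t(1)] tv'] radial[OF s t(1)] exp[OF s t(1)]
      by (simp add: metric_rep_def)
    also have "\<dots> = H.met i ?x0 ((t *\<^sub>R ?v) i) ((t *\<^sub>R ?v) i)"
      using H.met_eq[OF q D_tangent[OF p tv'] D_tangent[OF p tv']] by simp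
    also have "(t *\<^sub>R ?v) i = t *\<^sub>R (v i + s *\<^sub>R u i)" by (simp add: plus_fun_def)
    finally have "(t * t) * H.met i (x s t) (y s t) (y s t) =
        (t * t) * H.met i ?x0 (v i + s *\<^sub>R u i) (v i + s *\<^sub>R u i)"
      by (simp only: linear_cmul[OF H.linear_met_left[OF X]] linear_cmul[OF H.linear_met_right[OF X]]
          linear_cmul[OF H.linear_met_left[OF x0S]] linear_cmul[OF H.linear_met_right[OF x0S]]
          real_scaleR_def mult.assoc)
    then show ?thesis using t(2) by simp
  qed
  have key: "H.met i (x 0 t) (a 0 t) (\<xi> t) + H.christoffel1 i (x 0 t) (y 0 t) (y 0 t) (\<xi> t) = 0"
    if t: "\<bar>t\<bar> < T" "t \<noteq> 0" for t
  proof -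
    note X = xS[OF d0 t(1)]
    have "((\<lambda>t. t * C) has_vector_derivative C) (at t)"
      by (auto intro!: derivative_eq_intros simp: has_vector_derivative_def)
    then have "((\<lambda>t. H.met i (x 0 t) (y 0 t) (\<xi> t)) has_vector_derivative C) (at t)"
      by (rule has_vector_derivative_transform_within_open[where S = "{-T<..<T}"])
         (use t lemma_A in \<open>auto simp: abs_less_iff\<close>)
    with H.has_vector_derivative_met[OF X x'[OF d0 t(1)] y'[OF d0 t(1)] \<xi>'[OF t(1)]]
    have 1: "H.dmet i (x 0 t) (y 0 t) (y 0 t) (\<xi> t) + H.met i (x 0 t) (a 0 t) (\<xi> t)
        + H.met i (x 0 t) (y 0 t) (\<eta> t) = C"
      by (rule vector_derivative_unique_at)
    have lin: "((\<lambda>s. v i + s *\<^sub>R u i) has_vector_derivative u i) (at 0)"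
      by (auto intro!: derivative_eq_intros)
    have "((\<lambda>s. H.met i ?x0 (v i + s *\<^sub>R u i) (v i + s *\<^sub>R u i)) has_vector_derivative
        H.dmet i ?x0 0 (v i + 0 *\<^sub>R u i) (v i + 0 *\<^sub>R u i) + H.met i ?x0 (u i) (v i + 0 *\<^sub>R u i)
        + H.met i ?x0 (v i + 0 *\<^sub>R u i) (u i)) (at 0)"
      by (rule H.has_vector_derivative_met[where x = "\<lambda>_. ?x0", OF x0S has_vector_derivative_const lin lin])
    then have "((\<lambda>s. H.met i ?x0 (v i + s *\<^sub>R u i) (v i + s *\<^sub>R u i)) has_vector_derivative 2 * C) (at 0)"
      by (simp add: linear_0[OF H.linear_dmet_dir[OF x0S]] C_def H.met_sym[OF x0S, of "u i"])
    then have "((\<lambda>s. H.met i (x s t) (y s t) (y s t)) has_vector_derivative 2 * C) (at 0)"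
      by (rule has_vector_derivative_transform_within_open[where S = "{-\<delta><..<\<delta>}"])
         (use t \<delta> lemma_B in \<open>auto simp: abs_less_iff\<close>)
    with H.has_vector_derivative_met[where x = "\<lambda>s. x s t", OF X \<xi>s[OF t(1)] \<eta>s[OF t(1)] \<eta>s[OF t(1)]]
    have 2: "H.dmet i (x 0 t) (\<xi> t) (y 0 t) (y 0 t) + H.met i (x 0 t) (\<eta> t) (y 0 t)
        + H.met i (x 0 t) (y 0 t) (\<eta> t) = 2 * C"
      by (rule vector_derivative_unique_at)
    have arith: "m + (d + d - e) / 2 = 0" if "d + m + r = C" "e + r' + r = 2 * C" "r' = r" for d m r e r' :: real
    proof -
      have "(d + d - e) / 2 = d - e / 2" by (simp add: diff_divide_distrib)
      then show ?thesis using that by linarith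
    qed
    show ?thesis
      unfolding H.christoffel1_def by (rule arith[OF 1 2 H.met_sym[OF X, of "\<eta> t" "y 0 t"]])
  qed
  define k where "k = (\<lambda>t z. H.met i (x 0 t) (a 0 t) z + H.christoffel1 i (x 0 t) (y 0 t) (y 0 t) z)"
  have k_lin: "linear (k t)" if "\<bar>t\<bar> < T" for t
  proof -
    note X = xS[OF d0 that]
    have "k t = (\<lambda>z. H.met i (x 0 t) (a 0 t) z + H.met i (x 0 t) (christoffel M gh i (x 0 t) (y 0 t) (y 0 t)) z)"
      by (simp add: k_def fun_eq_iff H.met_christoffel[OF X])
    then show ?thesis
      using linear_compose_add[OF H.linear_met_right[OF X] H.linear_met_right[OF X]] by simp
  qed
  have cx: "continuous_on {-T<..<T} (x 0)"
    by (rule has_vector_derivative_imp_continuous_on[OF has_vector_derivative_at_within[OF x'[OF d0]]]) auto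
  have cy: "continuous_on {-T<..<T} (y 0)"
    by (rule has_vector_derivative_imp_continuous_on[OF has_vector_derivative_at_within[OF y'[OF d0]]]) auto
  have ck: "continuous_on {-T<..<T} (\<lambda>t. k t b)" for b
  proof -
    have X: "x 0 t \<in> chart_image i" if "t \<in> {-T<..<T}" for t
    proof -
      have "\<bar>t\<bar> < T" using that by auto
      then show ?thesis by (rule xS[OF d0])
    qed
    note m = H.continuous_on_met[OF X cx] and d = H.continuous_on_dmet[OF X cx]
    have "continuous_on {-T<..<T} (\<lambda>t. H.met i (x 0 t) (a 0 t) b)"
      by (rule m[OF _ ca continuous_on_const])
    moreover have "continuous_on {-T<..<T} (\<lambda>t. H.dmet i (x 0 t) (y 0 t) (y 0 t) b)"
      by (rule d[OF _ cy cy continuous_on_const])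
    moreover have "continuous_on {-T<..<T} (\<lambda>t. H.dmet i (x 0 t) b (y 0 t) (y 0 t))"
      by (rule d[OF _ continuous_on_const cy cy])
    ultimately show ?thesis
      unfolding k_def H.christoffel1_def
      by (intro continuous_on_add continuous_on_diff continuous_on_divide continuous_on_const) simp_all
  qed
  have zero: "0 \<in> {-T<..<T}" using T by simp
  have lim_k: "((\<lambda>t. k t b) \<longlongrightarrow> k 0 b) (at 0)" for b
    using ck[of b, unfolded continuous_on_eq_continuous_at[OF open_greaterThanLessThan], rule_format, OF zero]
    by (simp only: isCont_def)
  have lim_\<xi>: "((\<lambda>t. (\<xi> t /\<^sub>R t) \<bullet> b) \<longlongrightarrow> u i \<bullet> b) (at 0)" for b
  proof -
    have "(\<xi> has_vector_derivative u i) (at 0)" using \<xi>'[of 0] T by (simp add: \<eta>0)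
    from bounded_linear.has_vector_derivative[OF bounded_linear_inner_left this, of b]
    have "((\<lambda>t. \<xi> t \<bullet> b) has_real_derivative u i \<bullet> b) (at 0)"
      by (simp only: has_real_derivative_iff_has_vector_derivative)
    then show ?thesis by (simp add: DERIV_def \<xi>0 divide_inverse mult.commute)
  qed
  have "((\<lambda>t. \<Sum>b\<in>Basis. ((\<xi> t /\<^sub>R t) \<bullet> b) * k t b) \<longlongrightarrow> (\<Sum>b\<in>Basis. (u i \<bullet> b) * k 0 b)) (at 0)"
    by (intro tendsto_intros lim_k lim_\<xi>)
  moreover have "\<forall>\<^sub>F t in at 0. (\<Sum>b\<in>Basis. ((\<xi> t /\<^sub>R t) \<bullet> b) * k t b) = 0"
  proof -
    have "\<forall>\<^sub>F t in at 0. t \<in> {-T<..<T} \<and> t \<noteq> 0"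
      using eventually_at_in_open[OF open_greaterThanLessThan zero] by eventually_elim auto
    then show ?thesis
    proof eventually_elim
      case (elim t)
      then have t: "\<bar>t\<bar> < T" "t \<noteq> 0" by auto
      have "(\<Sum>b\<in>Basis. ((\<xi> t /\<^sub>R t) \<bullet> b) * k t b) = k t (\<xi> t /\<^sub>R t)"
        using linear_sum_Basis[OF k_lin[OF t(1)], of "\<xi> t /\<^sub>R t"] by simp
      also have "\<dots> = k t (\<xi> t) /\<^sub>R t" by (rule linear_cmul[OF k_lin[OF t(1)]])
      also have "\<dots> = 0" using key[OF t] by (simp add: k_def)
      finally show ?case .
    qed
  qed
  ultimately have "(\<Sum>b\<in>Basis. (u i \<bullet> b) * k 0 b) = 0"
    using tendsto_cong[of "\<lambda>t. \<Sum>b\<in>Basis. ((\<xi> t /\<^sub>R t) \<bullet> b) * k t b" "\<lambda>_. 0" "at 0"]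
      tendsto_unique[OF trivial_limit_at _ tendsto_const] by blast
  then have "k 0 (u i) = 0"
    using linear_sum_Basis[OF k_lin[of 0], of "u i"] T by simp
  moreover have "a 0 0 = acceleration i q v" "y 0 0 = v i" "x 0 0 = ?x0"
    using acc[OF d0, of 0] x0[OF d0] y0[OF d0] T q tvec_rep[OF tv q] by simp_all
  ultimately show ?thesis by (simp add: k_def)
qed

end


section \<open>Parallel transport and the multipliers\<close>

lemma linear_system_exists:
  fixes \<beta> :: "real \<Rightarrow> 'n::finite \<Rightarrow> 'n \<Rightarrow> real"
  assumes T: "T > 0" and \<beta>: "\<And>j k. continuous_on {-T..T} (\<lambda>t. \<beta> t j k)"
    and b: "\<And>j. continuous_on {-T..T} (\<lambda>t. b t j)"
  obtains T' z where "0 < T'" "T' \<le> T" "z 0 = z0"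
    and "\<And>t j. \<bar>t\<bar> < T' \<Longrightarrow> ((\<lambda>t. z t j) has_real_derivative (\<Sum>k\<in>UNIV. \<beta> t j k * z t k) + b t j) (at t)"
proof -
  define B where "B = (\<lambda>t. Blinfun (\<lambda>v :: real^'n. \<chi> j. \<Sum>k\<in>UNIV. \<beta> t j k * v $ k))"
  have bl: "bounded_linear (\<lambda>v :: real^'n. \<chi> j. \<Sum>k\<in>UNIV. \<beta> t j k * v $ k)" for t
    unfolding linear_conv_bounded_linear[symmetric]
    by (rule linearI) (simp_all add: vec_eq_iff sum.distrib distrib_left sum_distrib_left mult_ac)
  have B_apply: "blinfun_apply (B t) v = (\<chi> j. \<Sum>k\<in>UNIV. \<beta> t j k * v $ k)" for t v
    unfolding B_def by (simp add: bounded_linear_Blinfun_apply[OF bl])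
  have "continuous_on {-T..T} B"
    by (rule continuous_on_blinfun_componentwise)
       (auto simp: B_apply intro!: continuous_on_vec_lambda continuous_on_sum continuous_on_mult \<beta> continuous_on_const)
  moreover have "continuous_on {-T..T} (\<lambda>t. \<chi> j. b t j)" by (intro continuous_on_vec_lambda b)
  ultimately obtain T' z where T': "0 < T'" "T' \<le> T" and z0: "z 0 = (\<chi> j. z0 j)"
    and z': "\<And>t. t \<in> {-T'..T'} \<Longrightarrow> (z has_vector_derivative B t (z t) + (\<chi> j. b t j)) (at t within {-T'..T'})"
    by (rule linear_ode_exists[OF T, of B _ "\<chi> j. z0 j"]) blast
  show thesis
  proof (rule that[OF T', of "\<lambda>t j. z t $ j"])
    show "(\<lambda>j. z 0 $ j) = z0" by (simp add: z0)
    fix t j assume t: "\<bar>t\<bar> < T'"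
    then have "t \<in> {-T'..T'}" and at: "at t within {-T'..T'} = at t"
      by (auto intro: at_within_Icc_at)
    from bounded_linear.has_vector_derivative[OF bounded_linear_vec_nth z'[OF this(1), unfolded at], of j]
    show "((\<lambda>t. z t $ j) has_real_derivative (\<Sum>k\<in>UNIV. \<beta> t j k * z t $ k) + b t j) (at t)"
      by (simp add: B_apply has_real_derivative_iff_has_vector_derivative)
  qed
qed

lemma has_real_derivative_imp_differentiable_on:
  "(\<And>t. t \<in> I \<Longrightarrow> (f has_real_derivative f' t) (at t)) \<Longrightarrow> f differentiable_on I"
  unfolding differentiable_on_def has_field_derivative_def differentiable_def
  using has_derivative_at_withinI by blast

lemma differentiable_on_imp_has_real_derivative:
  assumes "f differentiable_on I" "open I" "t \<in> I"
  shows "(f has_real_derivative deriv f t) (at t)"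
  using assms by (simp add: DERIV_deriv_iff_real_differentiable differentiable_on_eq_differentiable_at)

context nonholonomic_system
begin

lemma coeff_zero: "q \<in> points M \<Longrightarrow> coeff q 0 \<alpha> = 0"
  using coeff_linear(2)[of q 0 0 \<alpha>] subspace_0[OF subspace_tangent_space] by simp

lemma coeff_sum:
  assumes q: "q \<in> points M" and f: "\<And>k. k \<in> K \<Longrightarrow> f k \<in> tangent_space M q"
  shows "coeff q (\<Sum>k\<in>K. f k) \<alpha> = (\<Sum>k\<in>K. coeff q (f k) \<alpha>)"
  using f
proof (induction K rule: infinite_finite_induct)
  case (insert k K)
  then have K: "(\<Sum>k\<in>K. f k) \<in> tangent_space M q" and k: "f k \<in> tangent_space M q"
    by (auto intro!: subspace_sum subspace_tangent_space)
  have "sum f (insert k K) = f k + sum f K" using insert.hyps by (rule sum.insert)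
  then have "coeff q (sum f (insert k K)) \<alpha> = coeff q (f k) \<alpha> + coeff q (sum f K) \<alpha>"
    by (simp only: coeff_linear(1)[OF q k K])
  moreover have "coeff q (sum f K) \<alpha> = (\<Sum>k\<in>K. coeff q (f k) \<alpha>)" using insert by simp
  moreover have "(\<Sum>k\<in>insert k K. coeff q (f k) \<alpha>) = coeff q (f k) \<alpha> + (\<Sum>k\<in>K. coeff q (f k) \<alpha>)"
    using insert.hyps by (rule sum.insert)
  ultimately show ?case by (simp only:)
qed (simp_all add: coeff_zero[OF q])

lemma coeff_frame: "q \<in> points M \<Longrightarrow> coeff q (E \<alpha> q) = (\<lambda>\<beta>. if \<beta> = \<alpha> then 1 else 0)"
  by (rule coeff_eqI) (auto simp: if_distrib[where f = "\<lambda>r. r *\<^sub>R _"] sum.delta cong: if_cong)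

text \<open>
  The connection form, evaluated on the velocity with coefficients \<open>\<omega>\<close> in \<open>D\<close> and restricted to the
  orthogonal complement of \<open>D\<close>, where the connection is given by brackets.
\<close>

definition transport_matrix :: "'q \<Rightarrow> ('n \<Rightarrow> real) \<Rightarrow> 'n \<Rightarrow> 'n \<Rightarrow> real" where
  "transport_matrix q \<omega> k j = (\<Sum>b\<in>A. \<omega> b * coeff q (lie_bracket M (E b) (E k) q) j)"

text \<open>
  Continuity of the coefficients of the two linear systems below, whose solutions are the transported
  field and the one-form \<open>h\<close>.
\<close>

lemma continuous_on_lie_bracket_coeff:
  assumes x: "\<And>t. t \<in> T \<Longrightarrow> x t \<in> chart_image i" and cx: "continuous_on T x"
  shows "continuous_on T (\<lambda>t. coeff (cinv M i (x t)) (lie_bracket M (E b) (E k) (cinv M i (x t))) j)"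
proof -
  define w where "w = (\<lambda>t. \<chi> \<alpha>. coeff (cinv M i (x t)) (lie_bracket M (E b) (E k) (cinv M i (x t))) \<alpha>)"
  have e: "continuous_on T (\<lambda>t. frame_rep i \<alpha> (x t))" for \<alpha>
    by (rule continuous_on_compose2[OF C1_on_continuous[OF frame_rep_C1] cx]) (use x in auto)
  have de: "continuous_on T (\<lambda>t. frechet_derivative (frame_rep i \<alpha>) (at (x t)) (frame_rep i \<beta> (x t)))" for \<alpha> \<beta>
    using continuous_on_compose2[OF C1_on_continuous[OF C1_on_tangent_map[OF frame_rep_smooth[of i \<alpha>] open_chart]]
        continuous_on_Pair[OF cx e[of \<beta>]]] x
    by (simp add: image_subset_iff)
  have "frame_map i (x t) (w t) = frechet_derivative (frame_rep i k) (at (x t)) (frame_rep i b (x t))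
      - frechet_derivative (frame_rep i b) (at (x t)) (frame_rep i k (x t))" if "t \<in> T" for t
  proof -
    note q = cinv_cdom[OF x[OF that]]
    have "frame_map i (x t) (w t) = lie_bracket M (E b) (E k) (cinv M i (x t)) i"
      using frame_map_coeff[OF q lie_bracket_tangent[OF E_field E_field points_I[OF q]]]
      by (simp add: w_def cmap_cinv[OF x[OF that]])
    then show ?thesis using q by (simp add: lie_bracket_def vf_deriv_def cmap_cinv[OF x[OF that]])
  qed
  then have "continuous_on T (\<lambda>t. frame_map i (x t) (w t))"
    using continuous_on_diff[OF de de, of k b b k] by (simp cong: continuous_on_cong)
  from continuous_on_frame_coefficients[OF x cx this] have "continuous_on T w" by simp
  from bounded_linear.continuous_on[OF bounded_linear_vec_nth this, of j] show ?thesis by (simp add: w_def)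
qed

lemma coeff_cov_deriv:
  assumes q: "c t \<in> points M" and vel: "velocity M c t \<in> D (c t)" and X: "X t \<in> tangent_space M (c t)"
    and X': "\<And>\<alpha>. ((\<lambda>s. coeff (c s) (X s) \<alpha>) has_real_derivative X' \<alpha>) (at t)"
  defines "\<omega> \<equiv> coeff (c t) (velocity M c t)"
  shows cov_deriv_tangent: "cov_deriv M E (nabla_bar M g D) c X t \<in> tangent_space M (c t)"
    and coeff_cov_deriv_D_orth: "j \<notin> A \<Longrightarrow> coeff (c t) (cov_deriv M E (nabla_bar M g D) c X t) j =
      X' j + (\<Sum>k\<in>-A. coeff (c t) (X t) k * transport_matrix (c t) \<omega> k j)"
    and coeff_cov_deriv_D: "a \<in> A \<Longrightarrow> (\<And>k. k \<in> A \<Longrightarrow> coeff (c t) (X t) k = 0) \<Longrightarrow>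
      coeff (c t) (cov_deriv M E (nabla_bar M g D) c X t) a = X' a"
proof -
  let ?X = "coeff (c t) (X t)"
  define N where "N = (\<lambda>\<alpha> \<beta>. (\<omega> \<beta> * ?X \<alpha>) *\<^sub>R nabla_bar M g D (E \<beta>) (E \<alpha>) (c t))"
  have cov: "cov_deriv M E (nabla_bar M g D) c X t =
      (\<Sum>\<alpha>\<in>UNIV. X' \<alpha> *\<^sub>R E \<alpha> (c t)) + (\<Sum>\<alpha>\<in>UNIV. \<Sum>\<beta>\<in>UNIV. N \<alpha> \<beta>)"
    by (simp add: cov_deriv_def N_def \<omega>_def DERIV_imp_deriv[OF X'])
  have \<omega>0: "\<omega> \<beta> = 0" if "\<beta> \<notin> A" for \<beta> using vel that by (simp add: \<omega>_def D_iff[OF q])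
  have tN: "nabla_bar M g D (E \<beta>) (E \<alpha>) (c t) \<in> tangent_space M (c t)" if "\<beta> \<in> A" for \<alpha> \<beta>
    using D_tangent[OF q nabla_bar_D[OF q that, of \<alpha>]] nabla_bar_D_orth[OF q that, of \<alpha>]
      frame_combination_tangent[OF q] by (cases "\<alpha> \<in> A") simp_all
  have N_tangent: "N \<alpha> \<beta> \<in> tangent_space M (c t)" for \<alpha> \<beta>
    using tN[of \<beta> \<alpha>] subspace_scale[OF subspace_tangent_space] subspace_0[OF subspace_tangent_space]
    by (cases "\<beta> \<in> A") (simp_all add: N_def \<omega>0)
  have sum_tangent: "(\<Sum>\<alpha>\<in>UNIV. \<Sum>\<beta>\<in>UNIV. N \<alpha> \<beta>) \<in> tangent_space M (c t)"
    by (intro subspace_sum subspace_tangent_space N_tangent)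
  show "cov_deriv M E (nabla_bar M g D) c X t \<in> tangent_space M (c t)"
    unfolding cov by (intro subspace_add subspace_tangent_space frame_combination_tangent q sum_tangent)
  have coeff: "coeff (c t) (cov_deriv M E (nabla_bar M g D) c X t) j =
      X' j + (\<Sum>\<alpha>\<in>UNIV. \<Sum>\<beta>\<in>UNIV. coeff (c t) (N \<alpha> \<beta>) j)" for j
    unfolding cov
    by (simp add: coeff_linear(1)[OF q frame_combination_tangent[OF q] sum_tangent] coeff_combination[OF q]
        coeff_sum[OF q] subspace_sum[OF subspace_tangent_space] N_tangent)
  have coeff_N: "coeff (c t) (N \<alpha> \<beta>) j = (if \<beta> \<in> A then \<omega> \<beta> * ?X \<alpha> *
      coeff (c t) (nabla_bar M g D (E \<beta>) (E \<alpha>) (c t)) j else 0)" for \<alpha> \<beta> j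
    using coeff_linear(2)[OF q tN[of \<beta> \<alpha>]] coeff_zero[OF q] by (simp add: N_def \<omega>0)
  {
    assume j: "j \<notin> A"
    have "coeff (c t) (N \<alpha> \<beta>) j = (if \<alpha> \<in> A then 0 else if \<beta> \<in> A
        then ?X \<alpha> * (\<omega> \<beta> * coeff (c t) (lie_bracket M (E \<beta>) (E \<alpha>) (c t)) j) else 0)" for \<alpha> \<beta>
      unfolding coeff_N
      using nabla_bar_D[OF q, of \<beta> \<alpha>] nabla_bar_D_orth[OF q, of \<beta> \<alpha>] j
      by (simp add: D_iff[OF q] coeff_combination[OF q])
    then have "(\<Sum>\<alpha>\<in>UNIV. \<Sum>\<beta>\<in>UNIV. coeff (c t) (N \<alpha> \<beta>) j) =
        (\<Sum>\<alpha>\<in>UNIV. if \<alpha> \<in> A then 0 else \<Sum>\<beta>\<in>UNIV. if \<beta> \<in> A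
          then ?X \<alpha> * (\<omega> \<beta> * coeff (c t) (lie_bracket M (E \<beta>) (E \<alpha>) (c t)) j) else 0)"
      by (intro sum.cong) auto
    also have "\<dots> = (\<Sum>\<alpha>\<in>-A. \<Sum>\<beta>\<in>UNIV. if \<beta> \<in> A
          then ?X \<alpha> * (\<omega> \<beta> * coeff (c t) (lie_bracket M (E \<beta>) (E \<alpha>) (c t)) j) else 0)"
      by (rule sum.mono_neutral_cong_right) auto
    also have "\<dots> = (\<Sum>\<alpha>\<in>-A. ?X \<alpha> * transport_matrix (c t) \<omega> \<alpha> j)"
      unfolding transport_matrix_def sum_distrib_left
      by (intro sum.cong refl sum.mono_neutral_cong_right) auto
    finally show "coeff (c t) (cov_deriv M E (nabla_bar M g D) c X t) j =
        X' j + (\<Sum>k\<in>-A. ?X k * transport_matrix (c t) \<omega> k j)"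
      by (simp add: coeff)
  next
    assume a: "a \<in> A" and X0: "\<And>k. k \<in> A \<Longrightarrow> ?X k = 0"
    have "coeff (c t) (N \<alpha> \<beta>) a = 0" for \<alpha> \<beta>
      unfolding coeff_N using X0[of \<alpha>] nabla_bar_D_orth[OF q, of \<beta> \<alpha>] a
      by (cases "\<alpha> \<in> A") (simp_all add: coeff_combination[OF q])
    then show "coeff (c t) (cov_deriv M E (nabla_bar M g D) c X t) a = X' a" by (simp add: coeff)
  }
qed

text \<open>
  Along curves tangent to \<open>D\<close> the connection preserves \<open>D\<close> and its orthogonal complement. Therefore
  it is consistent to look for a transported field in the complement and for a one-form that
  annihilates \<open>D\<close>, and what remains are two linear systems that are dual to each other, apart from
  the multipliers.
\<close>

lemma parallel_transportI:
  assumes I: "0 \<in> I" and q: "\<And>t. t \<in> I \<Longrightarrow> c t \<in> points M"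
    and vel: "\<And>t. t \<in> I \<Longrightarrow> velocity M c t \<in> D (c t)"
    and opI: "open I"
    and z': "\<And>t j. t \<in> I \<Longrightarrow> j \<notin> A \<Longrightarrow> ((\<lambda>t. z t j) has_real_derivative
      - (\<Sum>k\<in>-A. transport_matrix (c t) (coeff (c t) (velocity M c t)) k j * z t k)) (at t)"
    and zA: "\<And>t j. j \<in> A \<Longrightarrow> z t j = 0"
    and w: "w = (\<Sum>\<alpha>\<in>UNIV. z 0 \<alpha> *\<^sub>R E \<alpha> (c 0))"
  shows "parallel_transport M E (nabla_bar M g D) I c w (\<lambda>t. \<Sum>\<alpha>\<in>UNIV. z t \<alpha> *\<^sub>R E \<alpha> (c t))"
proof -
  let ?W = "\<lambda>t. \<Sum>\<alpha>\<in>UNIV. z t \<alpha> *\<^sub>R E \<alpha> (c t)"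
  define z1 where "z1 = (\<lambda>t j. if j \<in> A then 0
    else - (\<Sum>k\<in>-A. transport_matrix (c t) (coeff (c t) (velocity M c t)) k j * z t k))"
  have tW: "?W t \<in> tangent_space M (c t)" if "t \<in> I" for t
    by (rule frame_combination_tangent[OF q[OF that]])
  have cW: "coeff (c t) (?W t) = z t" if "t \<in> I" for t by (rule coeff_combination[OF q[OF that]])
  have dz: "((\<lambda>t. z t j) has_real_derivative z1 t j) (at t)" if "t \<in> I" for t j
    using z'[OF that, of j] zA[of j] by (cases "j \<in> A") (simp_all add: z1_def)
  have d: "((\<lambda>s. coeff (c s) (?W s) j) has_real_derivative z1 t j) (at t)" if t: "t \<in> I" for t j
    by (rule has_field_derivative_transform_within_open[OF dz[OF t] opI t]) (simp add: cW)
  have "cov_deriv M E (nabla_bar M g D) c ?W t = 0" if t: "t \<in> I" for t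
  proof -
    note cov = coeff_cov_deriv[where X = ?W and c = c and t = t and X' = "z1 t", OF q[OF t] vel[OF t] tW[OF t] d[OF t]]
    have "coeff (c t) (cov_deriv M E (nabla_bar M g D) c ?W t) j = 0" for j
      using cov(2)[of j] cov(3)[of j] zA by (cases "j \<in> A") (simp_all add: cW[OF t] z1_def mult.commute)
    then show ?thesis using coeff_expansion[OF q[OF t] cov(1)] by simp
  qed
  moreover have "field_along M E I c ?W"
    unfolding field_along_def
    using tW has_real_derivative_imp_differentiable_on[OF d] by blast
  ultimately show ?thesis unfolding parallel_transport_def w by blast
qed

lemma oneform_solutionI:
  assumes q: "\<And>t. t \<in> I \<Longrightarrow> c t \<in> points M" and I: "0 \<in> I" "open I"
    and vel: "\<And>t. t \<in> I \<Longrightarrow> velocity M c t \<in> D (c t)"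
    and r': "\<And>t j. t \<in> I \<Longrightarrow> j \<notin> A \<Longrightarrow> ((\<lambda>t. r t j) has_real_derivative
      (\<Sum>k\<in>-A. transport_matrix (c t) (coeff (c t) (velocity M c t)) j k * r t k)
      + euler_lagrange M (kinetic g) \<Gamma> (E j) (c t, velocity M c t)) (at t)"
    and r0: "\<And>j. r 0 j = 0"
  shows "oneform_solution M E (nabla_bar M g D) I c (multiplier_form M E A (kinetic g) \<Gamma> c)
    (\<lambda>t u. \<Sum>j\<in>-A. r t j * coeff (c t) u j)"
proof -
  let ?h = "\<lambda>t u. \<Sum>j\<in>-A. r t j * coeff (c t) u j"
  let ?n = "\<lambda>t. transport_matrix (c t) (coeff (c t) (velocity M c t))"
  let ?\<mu> = "\<lambda>t j. euler_lagrange M (kinetic g) \<Gamma> (E j) (c t, velocity M c t)"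
  define r1 where "r1 = (\<lambda>t j. (\<Sum>k\<in>-A. ?n t j k * r t k) + ?\<mu> t j)"
  have dr: "((\<lambda>t. r t j) has_real_derivative r1 t j) (at t)" if "t \<in> I" "j \<notin> A" for t j
    using r'[OF that] by (simp add: r1_def)
  have lin: "linear_on_tangent M (c t) (?h t)" if "t \<in> I" for t
    unfolding linear_on_tangent_def
    by (auto simp: coeff_linear[OF q[OF that]] distrib_left sum.distrib sum_distrib_left mult_ac)
  have "?h t (E \<alpha> (c t)) = (if \<alpha> \<in> A then 0 else r t \<alpha>)" if "t \<in> I" for t \<alpha>
    by (simp add: coeff_frame[OF q[OF that]] if_distrib sum.delta cong: if_cong)
  then have dh: "((\<lambda>t. ?h t (E \<alpha> (c t))) has_real_derivative (if \<alpha> \<in> A then 0 else r1 t \<alpha>)) (at t)" if "t \<in> I" for t \<alpha>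
    using has_field_derivative_transform_within_open[OF _ I(2) that, of "\<lambda>t. if \<alpha> \<in> A then 0 else r t \<alpha>"]
      dr[OF that, of \<alpha>] by (cases "\<alpha> \<in> A") simp_all
  then have along: "oneform_along M E I c ?h"
    unfolding oneform_along_def
    by (intro conjI ballI allI lin has_real_derivative_imp_differentiable_on[OF dh])
  have "deriv (\<lambda>s. ?h s (X s)) t - ?h t (cov_deriv M E (nabla_bar M g D) c X t)
      = multiplier_form M E A (kinetic g) \<Gamma> c t (X t)" if X: "field_along M E I c X" and t: "t \<in> I" for X t
  proof -
    define x where "x = coeff (c t) (X t)"
    define x1 where "x1 = (\<lambda>\<alpha>. deriv (\<lambda>s. coeff (c s) (X s) \<alpha>) t)"
    have dX: "(\<lambda>s. coeff (c s) (X s) \<alpha>) differentiable_on I" for \<alpha>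
      using X unfolding field_along_def by blast
    have d: "((\<lambda>s. coeff (c s) (X s) \<alpha>) has_real_derivative x1 \<alpha>) (at t)" for \<alpha>
      unfolding x1_def by (rule differentiable_on_imp_has_real_derivative[OF dX I(2) t])
    have tX: "X t \<in> tangent_space M (c t)" using X t by (simp add: field_along_def)
    have "((\<lambda>s. ?h s (X s)) has_real_derivative (\<Sum>j\<in>-A. r t j * x1 j + r1 t j * x j)) (at t)"
      unfolding x_def by (intro DERIV_sum DERIV_mult' dr[OF t] d) simp
    then have 1: "deriv (\<lambda>s. ?h s (X s)) t = (\<Sum>j\<in>-A. r t j * x1 j + r1 t j * x j)"
      by (rule DERIV_imp_deriv)
    have 2: "?h t (cov_deriv M E (nabla_bar M g D) c X t) =
        (\<Sum>j\<in>-A. r t j * (x1 j + (\<Sum>k\<in>-A. x k * ?n t k j)))"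
      by (intro sum.cong) (auto simp: coeff_cov_deriv_D_orth[OF q[OF t] vel[OF t] tX d] x_def)
    have 3: "(\<Sum>j\<in>-A. r t j * (\<Sum>k\<in>-A. x k * ?n t k j)) = (\<Sum>j\<in>-A. x j * (\<Sum>k\<in>-A. ?n t j k * r t k))"
      by (simp add: sum_distrib_left, subst sum.swap) (simp add: mult_ac)
    show ?thesis
      unfolding 1 2 multiplier_form_def x_def[symmetric]
      by (simp add: distrib_left sum.distrib 3 r1_def distrib_right mult_ac)
  qed
  with along show ?thesis unfolding oneform_solution_def by (simp add: r0)
qed

end


section \<open>The component of the acceleration orthogonal to the distribution\<close>

context geodesic_candidate
begin

text \<open>
  The second condition, divided by \<open>t\<close>, says that \<open>gh (c', W) + h (W)\<close> is constant, where \<open>h (W)\<close>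
  has the derivative \<open>\<lambda> (W)\<close>, which at \<open>t = 0\<close> is the \<open>g\<close>-inner product of the covariant acceleration
  with \<open>w\<close>. The derivative \<open>W1\<close> of the transported field in the chart is the derivative of a local
  section \<open>V\<close> of \<open>D\<close> extending \<open>v\<close> in the direction of \<open>w\<close>, up to a vector \<open>\<kappa>\<close> that represents the
  bracket of \<open>V\<close> and \<open>W\<close>: parallel transport makes the component of this bracket orthogonal to \<open>D\<close> vanish.
\<close>

lemma transported_field:
  assumes q: "q \<in> cdom M i" and v: "v \<in> D q" and w0: "w0 \<in> orth_compl M g D q"
  obtains W1 \<kappa> where "\<kappa> \<in> D q"
    and "W1 = \<kappa> i + (\<Sum>b\<in>A. coeff q v b *\<^sub>R vf_deriv M (E b) i q (w0 i))"
    and "dmet i (cmap M i q) (v i) (v i) (w0 i) + met i (cmap M i q) (acceleration i q v) (w0 i)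
      + met i (cmap M i q) (v i) W1 = 0"
    and "H.dmet i (cmap M i q) (v i) (v i) (w0 i) + H.met i (cmap M i q) (acceleration i q v) (w0 i)
      + H.met i (cmap M i q) (v i) W1
      + (met i (cmap M i q) (acceleration i q v) (w0 i) + christoffel1 i (cmap M i q) (v i) (v i) (w0 i)) = 0"
proof -
  note p = points_I[OF q]
  have tv: "v \<in> tangent_space M q" and tw: "w0 \<in> tangent_space M q"
    using D_tangent[OF p v] D_orth_tangent[OF p w0] .
  obtain T \<delta> x \<omega> \<xi> \<eta> y a where T: "T > 0" and \<delta>: "\<delta> > 0"
    and y_def: "\<And>s t. y s t = frame_map i (x s t) (\<omega> s t)"
    and xS': "\<And>s t. \<bar>s\<bar> < \<delta> \<Longrightarrow> \<bar>t\<bar> < T \<Longrightarrow> x s t \<in> chart_image i"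
    and x'': "\<And>s t. \<bar>s\<bar> < \<delta> \<Longrightarrow> \<bar>t\<bar> < T \<Longrightarrow> (x s has_vector_derivative y s t) (at t)"
    and y'': "\<And>s t. \<bar>s\<bar> < \<delta> \<Longrightarrow> \<bar>t\<bar> < T \<Longrightarrow> (y s has_vector_derivative a s t) (at t)"
    and yD': "\<And>s t. \<bar>s\<bar> < \<delta> \<Longrightarrow> \<bar>t\<bar> < T \<Longrightarrow> tvec M i (cinv M i (x s t)) (y s t) \<in> D (cinv M i (x s t))"
    and acc': "\<And>s t. \<bar>s\<bar> < \<delta> \<Longrightarrow> \<bar>t\<bar> < T \<Longrightarrow>
      acceleration i (cinv M i (x s t)) (tvec M i (cinv M i (x s t)) (y s t)) = a s t"
    and x0': "\<And>s. \<bar>s\<bar> < \<delta> \<Longrightarrow> x s 0 = cmap M i q" and y0': "\<And>s. \<bar>s\<bar> < \<delta> \<Longrightarrow> y s 0 = (v + s *\<^sub>R 0) i"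
    and ca: "continuous_on {-T<..<T} (a 0)" and c\<omega>: "continuous_on {-T<..<T} (\<omega> 0)"
    and dom': "\<And>s t. \<bar>s\<bar> < \<delta> \<Longrightarrow> \<bar>t\<bar> < T \<Longrightarrow> t *\<^sub>R (v + s *\<^sub>R 0) \<in> nh_exp_dom M D \<Gamma> q"
    and exp': "\<And>s t. \<bar>s\<bar> < \<delta> \<Longrightarrow> \<bar>t\<bar> < T \<Longrightarrow> nh_exp M D \<Gamma> q (t *\<^sub>R (v + s *\<^sub>R 0)) = cinv M i (x s t)"
    by (rule local_trajectories[OF q v zero_in_D[OF p]]) blast
  have d0: "\<bar>0\<bar> < \<delta>" using \<delta> by simp
  define X where "X = x 0"
  define Y where "Y = y 0"
  define B where "B = a 0"
  define c where "c = (\<lambda>s. nh_exp M D \<Gamma> q (s *\<^sub>R v))"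
  have v_eq: "v + 0 *\<^sub>R 0 = v" by simp
  have XS: "X t \<in> chart_image i" and X': "(X has_vector_derivative Y t) (at t)"
    and Y': "(Y has_vector_derivative B t) (at t)"
    and YD: "tvec M i (cinv M i (X t)) (Y t) \<in> D (cinv M i (X t))"
    and acc: "acceleration i (cinv M i (X t)) (tvec M i (cinv M i (X t)) (Y t)) = B t"
    and dom: "t *\<^sub>R v \<in> nh_exp_dom M D \<Gamma> q" and exp: "nh_exp M D \<Gamma> q (t *\<^sub>R v) = cinv M i (X t)"
    and ct: "c t = cinv M i (X t)"
    if "\<bar>t\<bar> < T" for t
    using xS'[OF d0 that] x''[OF d0 that] y''[OF d0 that] yD'[OF d0 that] acc'[OF d0 that] dom'[OF d0 that]
      exp'[OF d0 that]
    unfolding v_eq X_def Y_def B_def c_def by simp_all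
  have zero: "\<bar>0\<bar> < T" using T by simp
  have X0: "X 0 = cmap M i q" and Y0: "Y 0 = v i" using x0'[OF d0] y0'[OF d0] unfolding v_eq X_def Y_def .
  have B0: "B 0 = acceleration i q v"
    using acc[OF zero] q tvec_rep[OF tv q] by (simp add: X0 Y0)
  have c0: "c 0 = q" using ct[OF zero] q by (simp add: X0)
  have cS: "c t \<in> cdom M i" if "\<bar>t\<bar> < T" for t unfolding ct[OF that] by (rule cinv_cdom[OF XS[OF that]])
  have cP: "c t \<in> points M" if "\<bar>t\<bar> < T" for t by (rule points_I[OF cS[OF that]])
  have cmap_c: "cmap M i (c t) = X t" if "\<bar>t\<bar> < T" for t
    by (simp add: ct[OF that] cmap_cinv[OF XS[OF that]])
  have op: "open {-T<..<T}" and abs: "t \<in> {-T<..<T} \<longleftrightarrow> \<bar>t\<bar> < T" for t by auto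
  have vel: "velocity M c t = tvec M i (c t) (Y t)" if t: "\<bar>t\<bar> < T" for t
  proof (rule velocity_chart[of c t i, OF cS[OF t]])
    show "\<forall>\<^sub>F s in nhds t. c s \<in> cdom M i"
      using eventually_nhds_in_open[OF op, of t] t unfolding abs by (auto elim!: eventually_mono intro: cS)
    show "((\<lambda>s. cmap M i (c s)) has_vector_derivative Y t) (at t)"
      by (rule has_vector_derivative_transform_within_open[OF X'[OF t] op])
         (use t abs cmap_c in auto)
  qed
  have velD: "velocity M c t \<in> D (c t)" if "\<bar>t\<bar> < T" for t
    using YD[OF that] by (simp only: vel[OF that] ct[OF that])
  have velc: "coeff (c t) (velocity M c t) = ($) (\<omega> 0 t)" if "\<bar>t\<bar> < T" for t
    using coeff_tvec_frame_map[OF XS[OF that], of "\<omega> 0 t"]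
    by (simp add: vel[OF that] ct[OF that]) (simp add: Y_def X_def y_def)
  define n where "n = (\<lambda>t k j. transport_matrix (c t) (coeff (c t) (velocity M c t)) k j)"
  define \<mu> where "\<mu> = (\<lambda>t j. euler_lagrange M (kinetic g) \<Gamma> (E j) (c t, velocity M c t))"
  have \<mu>_eq: "\<mu> t j = met i (X t) (B t) (frame_rep i j (X t)) + christoffel1 i (X t) (Y t) (Y t) (frame_rep i j (X t))"
    if t: "\<bar>t\<bar> < T" for t j
    using euler_lagrange_chart[OF E_field cS[OF t] velD[OF t], of j] acc[OF t]
    by (simp add: \<mu>_def cmap_c[OF t]) (simp add: vel[OF t] ct[OF t] cinv_cdom[OF XS[OF t]])
  define S where "S = T / 2"
  have S: "S > 0" "{-S..S} \<subseteq> {-T<..<T}" using T by (auto simp: S_def)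
  have XS_S: "X t \<in> chart_image i" if "t \<in> {-S..S}" for t using that S(2) abs XS by blast
  have cX: "continuous_on {-S..S} X"
    by (rule has_vector_derivative_imp_continuous_on[OF has_vector_derivative_at_within[OF X']])
       (use S(2) abs in blast)
  have cY: "continuous_on {-S..S} Y"
    by (rule has_vector_derivative_imp_continuous_on[OF has_vector_derivative_at_within[OF Y']])
       (use S(2) abs in blast)
  have cB: "continuous_on {-S..S} B" unfolding B_def by (rule continuous_on_subset[OF ca S(2)])
  have ce: "continuous_on {-S..S} (\<lambda>t. frame_rep i j (X t))" for j
    by (rule continuous_on_compose2[OF C1_on_continuous[OF frame_rep_C1] cX]) (use XS_S in auto)
  have cn: "continuous_on {-S..S} (\<lambda>t. n t k j)" for k j
  proof -
    have "continuous_on {-S..S} (\<lambda>t. \<omega> 0 t $ b)" for b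
      using bounded_linear.continuous_on[OF bounded_linear_vec_nth continuous_on_subset[OF c\<omega> S(2)]] .
    then have cont: "continuous_on {-S..S} (\<lambda>t. \<Sum>b\<in>A. \<omega> 0 t $ b *
        coeff (cinv M i (X t)) (lie_bracket M (E b) (E k) (cinv M i (X t))) j)"
      by (intro continuous_on_sum continuous_on_mult continuous_on_lie_bracket_coeff[OF XS_S cX])
    show ?thesis
    proof (rule continuous_on_eq[OF cont])
      fix t assume that: "t \<in> {-S..S}"
      have "\<bar>t\<bar> < T" using that S(2) abs by blast
      then show "(\<Sum>b\<in>A. \<omega> 0 t $ b *
          coeff (cinv M i (X t)) (lie_bracket M (E b) (E k) (cinv M i (X t))) j) = n t k j"
        by (simp add: n_def transport_matrix_def velc) (simp add: ct)
    qed
  qed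
  have c\<mu>: "continuous_on {-S..S} (\<lambda>t. \<mu> t j)" for j
  proof -
    have "continuous_on {-S..S} (\<lambda>t. met i (X t) (B t) (frame_rep i j (X t)))"
      by (rule continuous_on_met[OF XS_S cX cB ce])
    moreover have "continuous_on {-S..S} (\<lambda>t. dmet i (X t) (Y t) (Y t) (frame_rep i j (X t)))"
      by (rule continuous_on_dmet[OF XS_S cX cY cY ce])
    moreover have "continuous_on {-S..S} (\<lambda>t. dmet i (X t) (frame_rep i j (X t)) (Y t) (Y t))"
      by (rule continuous_on_dmet[OF XS_S cX ce cY cY])
    ultimately have cont: "continuous_on {-S..S} (\<lambda>t. met i (X t) (B t) (frame_rep i j (X t))
        + christoffel1 i (X t) (Y t) (Y t) (frame_rep i j (X t)))"
      unfolding christoffel1_def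
      by (intro continuous_on_add continuous_on_diff continuous_on_divide continuous_on_const) simp_all
    show ?thesis
      by (rule continuous_on_eq[OF cont \<mu>_eq[symmetric]]) (use S(2) abs in blast)
  qed
  \<comment> \<open>Zero columns for the indices in \<open>A\<close> make the remaining components a closed system.\<close>
  obtain T1 z' where T1: "0 < T1" and z0': "z' 0 = coeff q w0"
    and dz': "\<And>t j. \<bar>t\<bar> < T1 \<Longrightarrow> ((\<lambda>t. z' t j) has_real_derivative
      (\<Sum>k\<in>UNIV. (if k \<in> A then 0 else - n t k j) * z' t k) + 0) (at t)"
  proof (rule linear_system_exists[OF S(1), of "\<lambda>t j k. if k \<in> A then 0 else - n t k j" "\<lambda>_ _. 0" "coeff q w0"])
    show "continuous_on {-S..S} (\<lambda>t. if k \<in> A then 0 else - n t k j)" for j k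
      using cn[of k j] by (cases "k \<in> A") (auto intro: continuous_on_minus continuous_on_const)
  qed (rule continuous_on_const, blast)
  obtain T2 r where T2: "0 < T2" and r0: "r 0 = (\<lambda>_. 0)"
    and dr': "\<And>t j. \<bar>t\<bar> < T2 \<Longrightarrow> ((\<lambda>t. r t j) has_real_derivative
      (\<Sum>k\<in>UNIV. (if k \<in> A then 0 else n t j k) * r t k) + \<mu> t j) (at t)"
  proof (rule linear_system_exists[OF S(1), of "\<lambda>t j k. if k \<in> A then 0 else n t j k" \<mu> "\<lambda>_. 0"])
    show "continuous_on {-S..S} (\<lambda>t. if k \<in> A then 0 else n t j k)" for j k
      using cn[of j k] by (cases "k \<in> A") (auto intro: continuous_on_const)
  qed (rule c\<mu>, blast)
  have restrict: "(\<Sum>k\<in>UNIV. (if k \<in> A then 0 else f k) * e k) = (\<Sum>k\<in>-A. f k * e k)" for f e :: "'n \<Rightarrow> real"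
    by (rule sum.mono_neutral_cong_right) auto
  define z where "z = (\<lambda>t j. if j \<in> A then 0 else z' t j)"
  define z1 where "z1 = (\<lambda>j. if j \<in> A then 0 else - (\<Sum>k\<in>-A. n 0 k j * z 0 k))"
  define R where "R = min S (min T1 T2)"
  have R: "R > 0" using S(1) T1 T2 by (simp add: R_def)
  define I where "I = {-R<..<R}"
  have I: "open I" "0 \<in> I" "open_interval_about_0 I"
    using R by (auto simp: I_def open_interval_about_0_def is_interval_oo)
  have It: "\<bar>t\<bar> < T \<and> \<bar>t\<bar> < T1 \<and> \<bar>t\<bar> < T2" if "t \<in> I" for t
    using that T by (auto simp: I_def R_def S_def)
  have dz: "((\<lambda>t. z t j) has_real_derivative - (\<Sum>k\<in>-A. n t k j * z t k)) (at t)" if "t \<in> I" "j \<notin> A" for t j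
  proof -
    have "(\<Sum>k\<in>-A. - n t k j * z' t k) = - (\<Sum>k\<in>-A. n t k j * z t k)"
      by (simp add: sum_negf z_def)
    then show ?thesis using dz'[of t j] It[OF that(1)] that(2) by (simp add: restrict) (simp add: z_def)
  qed
  have dr: "((\<lambda>t. r t j) has_real_derivative (\<Sum>k\<in>-A. n t j k * r t k) + \<mu> t j) (at t)" if "t \<in> I" for t j
    using dr'[of t j] It[OF that] by (simp only: restrict)
  have z0: "z 0 = coeff q w0" using w0 z0' by (auto simp: z_def fun_eq_iff D_orth_iff[OF p])
  define W where "W = (\<lambda>t. \<Sum>\<alpha>\<in>UNIV. z t \<alpha> *\<^sub>R E \<alpha> (c t))"
  define h where "h = (\<lambda>t u. \<Sum>j\<in>-A. r t j * coeff (c t) u j)"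
  have par: "parallel_transport M E (nabla_bar M g D) I c w0 W"
    unfolding W_def
  proof (rule parallel_transportI[OF I(2) _ _ I(1)])
    show "((\<lambda>t. z t j) has_real_derivative
        - (\<Sum>k\<in>-A. transport_matrix (c t) (coeff (c t) (velocity M c t)) k j * z t k)) (at t)"
      if "t \<in> I" "j \<notin> A" for t j
      using dz[OF that] by (simp only: n_def)
    show "w0 = (\<Sum>\<alpha>\<in>UNIV. z 0 \<alpha> *\<^sub>R E \<alpha> (c 0))" using coeff_expansion[OF p tw] by (simp only: z0 c0)
  qed (use It cP velD in \<open>auto simp: z_def\<close>)
  have one: "oneform_solution M E (nabla_bar M g D) I c (multiplier_form M E A (kinetic g) \<Gamma> c) h"
    unfolding h_def
  proof (rule oneform_solutionI[OF _ I(2,1)])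
    show "((\<lambda>t. r t j) has_real_derivative
        (\<Sum>k\<in>-A. transport_matrix (c t) (coeff (c t) (velocity M c t)) j k * r t k)
        + euler_lagrange M (kinetic g) \<Gamma> (E j) (c t, velocity M c t)) (at t)" if "t \<in> I" "j \<notin> A" for t j
      using dr[OF that(1), of j] by (simp only: n_def \<mu>_def)
  qed (use It cP velD r0 in auto)
  have cond: "gh (nh_exp M D \<Gamma> q (t *\<^sub>R v)) (nh_exp_tangent M D \<Gamma> q (t *\<^sub>R v) (t *\<^sub>R v)) (W t)
      + t * h t (W t) = gh q (t *\<^sub>R v) w0" if "t \<in> I" for t
    by (rule transport[OF p v w0 c_def I(3) _ par one that]) (use It dom in blast)
  define Wi where "Wi = (\<lambda>t. \<Sum>\<alpha>\<in>UNIV. z t \<alpha> *\<^sub>R frame_rep i \<alpha> (X t))"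
  have W_chart: "W t i = Wi t" and W_tvec: "tvec M i (cinv M i (X t)) (Wi t) = W t"
    and W_coeff: "coeff (c t) (W t) = z t" and W_orth: "W t \<in> orth_compl M g D (c t)" if "t \<in> I" for t
  proof -
    have t: "\<bar>t\<bar> < T" using It[OF that] by blast
    show "W t i = Wi t" by (simp add: W_def Wi_def sum_apply ct[OF t])
    moreover have tW: "W t \<in> tangent_space M (c t)" unfolding W_def by (rule frame_combination_tangent[OF cP[OF t]])
    ultimately show "tvec M i (cinv M i (X t)) (Wi t) = W t"
      using tvec_rep[OF tW cS[OF t]] by (simp add: ct[OF t])
    show "coeff (c t) (W t) = z t" unfolding W_def by (rule coeff_combination[OF cP[OF t]])
    then show "W t \<in> orth_compl M g D (c t)" using tW by (simp add: D_orth_iff[OF cP[OF t]] z_def)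
  qed
  have Wi0: "Wi 0 = w0 i"
    using W_chart[OF I(2)] coeff_expansion[OF p tw] by (simp add: W_def z0 c0)
  let ?x0 = "cmap M i q"
  have x0S: "?x0 \<in> chart_image i" using q by simp
  have const: "H.met i (X t) (Y t) (Wi t) + (\<Sum>j\<in>-A. r t j * z t j) = H.met i ?x0 (v i) (w0 i)"
    if t: "t \<in> I" for t
  proof (cases "t = 0")
    case True
    then show ?thesis by (simp add: X0 Y0 Wi0 r0)
  next
    case False
    have tT: "\<bar>t\<bar> < T" using It[OF t] by blast
    note Xt = XS[OF tT]
    have "nh_exp_tangent M D \<Gamma> q (t *\<^sub>R v) (t *\<^sub>R v) = tvec M i (cinv M i (X t)) (t *\<^sub>R Y t)"
      by (rule nh_exp_tangent_radial[OF XS X' exp tT])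
    then have "H.met i (X t) (t *\<^sub>R Y t) (Wi t) + t * h t (W t) = gh q (t *\<^sub>R v) w0"
      using cond[OF t] exp[OF tT] W_tvec[OF t] by (simp add: metric_rep_def)
    also have "\<dots> = t * H.met i ?x0 (v i) (w0 i)"
      using H.met_eq[OF q subspace_scale[OF subspace_tangent_space tv, of t] tw]
        linear_cmul[OF H.linear_met_left[OF x0S], of t "v i" "w0 i"] by simp
    finally have "t * (H.met i (X t) (Y t) (Wi t) + h t (W t)) = t * H.met i ?x0 (v i) (w0 i)"
      using linear_cmul[OF H.linear_met_left[OF Xt], of t "Y t" "Wi t"] by (simp add: distrib_left)
    then show ?thesis using False by (simp add: h_def W_coeff[OF t])
  qed
  define d where "d = (\<lambda>\<alpha>. vf_deriv M (E \<alpha>) i q)"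
  have fr: "frame_rep i \<alpha> ?x0 = E \<alpha> q i" for \<alpha> using q by simp
  have dfr: "((\<lambda>t. frame_rep i \<alpha> (X t)) has_vector_derivative d \<alpha> (v i)) (at 0)" for \<alpha>
  proof -
    have "(frame_rep i \<alpha> has_derivative d \<alpha>) (at (X 0))"
      using vf_deriv_has_derivative[OF E_field q] by (simp add: X0 d_def)
    from vector_derivative_diff_chain_within[OF X'[OF zero] has_derivative_at_withinI[OF this]]
    show ?thesis by (simp add: o_def Y0)
  qed
  have dz0: "((\<lambda>t. z t \<alpha>) has_real_derivative z1 \<alpha>) (at 0)" for \<alpha>
    using dz[OF I(2), of \<alpha>] by (cases "\<alpha> \<in> A") (simp_all add: z1_def z_def[abs_def])
  define W1 where "W1 = (\<Sum>\<alpha>\<in>UNIV. z 0 \<alpha> *\<^sub>R d \<alpha> (v i) + z1 \<alpha> *\<^sub>R E \<alpha> q i)"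
  have dWi: "(Wi has_vector_derivative W1) (at 0)"
  proof -
    have "(Wi has_vector_derivative (\<Sum>\<alpha>\<in>UNIV. z 0 \<alpha> *\<^sub>R d \<alpha> (v i) + z1 \<alpha> *\<^sub>R frame_rep i \<alpha> (X 0))) (at 0)"
      unfolding Wi_def by (intro has_vector_derivative_sum has_vector_derivative_scaleR dz0 dfr)
    then show ?thesis by (simp only: W1_def X0 fr)
  qed
  \<comment> \<open>Velocity and transported field are \<open>g\<close>-orthogonal.\<close>
  have "met i (X t) (Y t) (Wi t) = 0" if "t \<in> I" for t
  proof -
    have t: "\<bar>t\<bar> < T" using It[OF that] by blast
    have "g (c t) (tvec M i (c t) (Y t)) (W t) = 0"
      using g_D_orth[OF cP[OF t] velD[OF t] W_orth[OF that]] by (simp only: vel[OF t])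
    then show ?thesis using W_tvec[OF that] by (simp add: metric_rep_def ct[OF t])
  qed
  then have "((\<lambda>t. met i (X t) (Y t) (Wi t)) has_vector_derivative 0) (at 0)"
    using has_vector_derivative_transform_within_open[OF has_vector_derivative_const I(1,2),
        of 0 "\<lambda>t. met i (X t) (Y t) (Wi t)"] by simp
  with has_vector_derivative_met[OF XS[OF zero] X'[OF zero] Y'[OF zero] dWi]
  have iv: "dmet i ?x0 (v i) (v i) (w0 i) + met i ?x0 (acceleration i q v) (w0 i) + met i ?x0 (v i) W1 = 0"
    unfolding X0 Y0 B0 Wi0 by (rule vector_derivative_unique_at)
  have S0: "((\<lambda>t. H.met i (X t) (Y t) (Wi t) + (\<Sum>j\<in>-A. r t j * z t j)) has_vector_derivative 0) (at 0)"
    using has_vector_derivative_transform_within_open[OF has_vector_derivative_const I(1,2),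
        of "H.met i ?x0 (v i) (w0 i)" "\<lambda>t. H.met i (X t) (Y t) (Wi t) + (\<Sum>j\<in>-A. r t j * z t j)"] const by simp
  have S2: "((\<lambda>t. \<Sum>j\<in>-A. r t j * z t j) has_vector_derivative (\<Sum>j\<in>-A. \<mu> 0 j * z 0 j)) (at 0)"
  proof -
    have "((\<lambda>t. \<Sum>j\<in>-A. r t j * z t j) has_real_derivative
        (\<Sum>j\<in>-A. r 0 j * z1 j + ((\<Sum>k\<in>-A. n 0 j k * r 0 k) + \<mu> 0 j) * z 0 j)) (at 0)"
      by (intro DERIV_sum DERIV_mult' dr[OF I(2)] dz0)
    then show ?thesis by (simp add: r0 has_real_derivative_iff_has_vector_derivative)
  qed
  have i: "H.dmet i ?x0 (v i) (v i) (w0 i) + H.met i ?x0 (acceleration i q v) (w0 i)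
      + H.met i ?x0 (v i) W1 + (\<Sum>j\<in>-A. \<mu> 0 j * z 0 j) = 0"
    using vector_derivative_unique_at[OF has_vector_derivative_add[OF
        H.has_vector_derivative_met[OF XS[OF zero] X'[OF zero] Y'[OF zero] dWi] S2] S0]
    unfolding X0 Y0 B0 Wi0 .
  have "(\<Sum>j\<in>-A. \<mu> 0 j * z 0 j) = met i ?x0 (acceleration i q v) (w0 i) + christoffel1 i ?x0 (v i) (v i) (w0 i)"
  proof -
    define k where "k = (\<lambda>u. met i ?x0 (acceleration i q v) u + met i ?x0 (christoffel M g i ?x0 (v i) (v i)) u)"
    have lin: "linear k" unfolding k_def by (intro linear_compose_add linear_met_right[OF x0S])
    have "w0 i = (\<Sum>\<alpha>\<in>UNIV. z 0 \<alpha> *\<^sub>R E \<alpha> q i)" using Wi0 by (simp add: Wi_def X0 q)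
    then have "k (w0 i) = (\<Sum>\<alpha>\<in>UNIV. z 0 \<alpha> * k (E \<alpha> q i))"
      by (simp add: linear_sum[OF lin] linear_cmul[OF lin])
    also have "\<dots> = (\<Sum>\<alpha>\<in>-A. z 0 \<alpha> * k (E \<alpha> q i))"
      by (rule sum.mono_neutral_right) (auto simp: z_def)
    also have "\<dots> = (\<Sum>j\<in>-A. \<mu> 0 j * z 0 j)"
      using \<mu>_eq[OF zero] by (simp add: k_def met_christoffel[OF x0S] X0 Y0 B0 q mult.commute)
    finally show ?thesis by (simp add: k_def met_christoffel[OF x0S])
  qed
  with i have i': "H.dmet i ?x0 (v i) (v i) (w0 i) + H.met i ?x0 (acceleration i q v) (w0 i)
      + H.met i ?x0 (v i) W1
      + (met i ?x0 (acceleration i q v) (w0 i) + christoffel1 i ?x0 (v i) (v i) (w0 i)) = 0"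
    by (simp only:)
  let ?\<omega> = "coeff q v"
  define L where "L = (\<lambda>\<alpha>. \<Sum>b\<in>A. ?\<omega> b *\<^sub>R lie_bracket M (E b) (E \<alpha>) q)"
  define \<kappa> where "\<kappa> = (\<Sum>\<alpha>\<in>UNIV. z1 \<alpha> *\<^sub>R E \<alpha> q) + (\<Sum>\<alpha>\<in>UNIV. z 0 \<alpha> *\<^sub>R L \<alpha>)"
  have tb: "?\<omega> b *\<^sub>R lie_bracket M (E b) (E \<alpha>) q \<in> tangent_space M q" for b \<alpha>
    by (intro subspace_scale subspace_tangent_space lie_bracket_tangent E_field p)
  have tL: "L \<alpha> \<in> tangent_space M q" for \<alpha>
    unfolding L_def by (intro subspace_sum subspace_tangent_space tb)
  have tzL: "z 0 \<alpha> *\<^sub>R L \<alpha> \<in> tangent_space M q" for \<alpha>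
    by (intro subspace_scale subspace_tangent_space tL)
  have t\<kappa>: "\<kappa> \<in> tangent_space M q"
    unfolding \<kappa>_def
    by (intro subspace_add subspace_sum subspace_tangent_space frame_combination_tangent[OF p] tzL)
  have "coeff q \<kappa> j = 0" if j: "j \<notin> A" for j
  proof -
    have "velocity M c 0 = v" using vel[OF zero] tvec_rep[OF tv q] by (simp add: c0 Y0)
    then have "coeff q (L \<alpha>) j = n 0 \<alpha> j" for \<alpha>
      by (simp add: L_def coeff_sum[OF p tb] coeff_linear(2)[OF p lie_bracket_tangent[OF E_field E_field p]]
          n_def transport_matrix_def c0)
    then have "coeff q \<kappa> j = z1 j + (\<Sum>\<alpha>\<in>UNIV. z 0 \<alpha> * n 0 \<alpha> j)"
      unfolding \<kappa>_def
      by (simp add: coeff_linear(1)[OF p frame_combination_tangent[OF p] subspace_sum[OF subspace_tangent_space tzL]]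
          coeff_combination[OF p] coeff_sum[OF p tzL] coeff_linear(2)[OF p tL])
    also have "(\<Sum>\<alpha>\<in>UNIV. z 0 \<alpha> * n 0 \<alpha> j) = (\<Sum>\<alpha>\<in>-A. n 0 \<alpha> j * z 0 \<alpha>)"
      by (rule sum.mono_neutral_cong_right) (auto simp: z_def)
    finally show ?thesis using j by (simp add: z1_def)
  qed
  then have \<kappa>D: "\<kappa> \<in> D q" using t\<kappa> by (simp add: D_iff[OF p])
  have W1_eq: "W1 = \<kappa> i + (\<Sum>b\<in>A. ?\<omega> b *\<^sub>R d b (w0 i))"
  proof -
    have lin: "linear (d \<alpha>)" for \<alpha>
      unfolding d_def by (rule has_derivative_linear[OF vf_deriv_has_derivative[OF E_field q]])
    have d_eq: "vf_deriv M (E \<alpha>) i q = d \<alpha>" for \<alpha> by (simp add: d_def)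
    have vi: "v i = (\<Sum>b\<in>A. ?\<omega> b *\<^sub>R E b q i)"
      using arg_cong[OF D_expansion[OF p v], of "\<lambda>v. v i"] by (simp add: sum_apply)
    have wi: "w0 i = (\<Sum>\<alpha>\<in>UNIV. z 0 \<alpha> *\<^sub>R E \<alpha> q i)" using Wi0 by (simp add: Wi_def X0 q)
    have Li: "L \<alpha> i = d \<alpha> (v i) - (\<Sum>b\<in>A. ?\<omega> b *\<^sub>R d b (E \<alpha> q i))" for \<alpha>
      unfolding L_def vi
      by (simp add: sum_apply lie_bracket_def q d_eq linear_sum[OF lin] linear_cmul[OF lin]
          scaleR_diff_right sum_subtractf)
    have "(\<Sum>b\<in>A. ?\<omega> b *\<^sub>R d b (w0 i)) = (\<Sum>\<alpha>\<in>UNIV. z 0 \<alpha> *\<^sub>R (\<Sum>b\<in>A. ?\<omega> b *\<^sub>R d b (E \<alpha> q i)))"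
      unfolding wi
      by (simp add: linear_sum[OF lin] linear_cmul[OF lin] scaleR_sum_right, subst sum.swap) (simp add: mult.commute)
    then show ?thesis
      by (simp add: W1_def \<kappa>_def plus_fun_def sum_apply Li scaleR_diff_right sum_subtractf sum.distrib)
  qed
  show thesis by (rule that[OF \<kappa>D _ iv i']) (simp add: W1_eq d_def)
qed

lemma metrics_agree_on_D: "q \<in> points M \<Longrightarrow> u \<in> D q \<Longrightarrow> v \<in> D q \<Longrightarrow> gh q u v = g q u v"
  using modification by (simp add: preserving_modification_def)

text \<open>
  In the difference of the two relations of \<open>transported_field\<close> the products of \<open>v\<close> with \<open>W1\<close> for
  both metrics remain. They agree on \<open>\<kappa>\<close>, since both metrics agree on \<open>D\<close>, and on the derivative of
  \<open>V\<close> up to half the derivative of the metric, since the length of \<open>V\<close> is the same function for both.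
\<close>

lemma acceleration_orthogonal_D_orth:
  assumes q: "q \<in> cdom M i" and v: "v \<in> D q" and w0: "w0 \<in> orth_compl M g D q"
  shows "H.met i (cmap M i q) (acceleration i q v) (w0 i)
    + H.christoffel1 i (cmap M i q) (v i) (v i) (w0 i) = 0"
proof -
  note p = points_I[OF q]
  let ?x = "cmap M i q" and ?a = "acceleration i q v" and ?v = "v i" and ?w = "w0 i"
  have x: "?x \<in> chart_image i" using q by simp
  define dV where "dV = (\<lambda>h. \<Sum>b\<in>A. coeff q v b *\<^sub>R vf_deriv M (E b) i q h)"
  obtain W1 \<kappa> where \<kappa>: "\<kappa> \<in> D q" and W1: "W1 = \<kappa> i + dV ?w"
    and 1: "dmet i ?x ?v ?v ?w + met i ?x ?a ?w + met i ?x ?v W1 = 0"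
    and 2: "H.dmet i ?x ?v ?v ?w + H.met i ?x ?a ?w + H.met i ?x ?v W1
      + (met i ?x ?a ?w + christoffel1 i ?x ?v ?v ?w) = 0"
    unfolding dV_def by (rule transported_field[OF q v w0])
  \<comment> \<open>The section \<open>V\<close> of \<open>D\<close> has the same length for both metrics, in a whole neighbourhood.\<close>
  define V where "V = (\<lambda>x. \<Sum>b\<in>A. coeff q v b *\<^sub>R frame_rep i b x)"
  have V: "V ?x = ?v"
    using arg_cong[OF D_expansion[OF p v], of "\<lambda>v. v i"] q by (simp add: V_def sum_apply)
  have dV: "(V has_derivative dV) (at ?x)"
    unfolding V_def dV_def
    by (intro has_derivative_sum has_derivative_scaleR_right vf_deriv_has_derivative[OF E_field q])
  have agree: "H.met i x (V x) (V x) = met i x (V x) (V x)" if "x \<in> chart_image i" for x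
  proof -
    note q' = cinv_cdom[OF that] note p' = points_I[OF q']
    define u where "u = (\<Sum>b\<in>A. coeff q v b *\<^sub>R E b (cinv M i x))"
    have uD: "u \<in> D (cinv M i x)"
      unfolding u_def by (intro subspace_sum subspace_scale subspace_D p' E_in_D)
    have "V x = u i" by (simp add: V_def u_def sum_apply)
    then have "tvec M i (cinv M i x) (V x) = u" using tvec_rep[OF D_tangent[OF p' uD] q'] by simp
    then show ?thesis using metrics_agree_on_D[OF p' uD uD] by (simp add: metric_rep_def)
  qed
  have "((\<lambda>x. H.met i x (V x) (V x)) has_derivative
      (\<lambda>h. dmet i ?x h ?v ?v + met i ?x (dV h) ?v + met i ?x ?v (dV h))) (at ?x)"
    by (rule has_derivative_transform_within_open[OF
          has_derivative_met[where X = "\<lambda>x. x" and V = V and W = V, OF x has_derivative_ident dV dV, unfolded V]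
          open_chart x]) (simp add: agree)
  from fun_cong[OF has_derivative_unique[OF H.has_derivative_met[where X = "\<lambda>x. x" and V = V and W = V,
      OF x has_derivative_ident dV dV, unfolded V] this], of ?w]
  have 3: "H.dmet i ?x ?w ?v ?v + 2 * H.met i ?x ?v (dV ?w) = dmet i ?x ?w ?v ?v + 2 * met i ?x ?v (dV ?w)"
    using H.met_sym[OF x, of "dV ?w" ?v] met_sym[OF x, of "dV ?w" ?v] by simp
  have 4: "H.met i ?x ?v (\<kappa> i) = met i ?x ?v (\<kappa> i)"
    using H.met_eq[OF q D_tangent[OF p v] D_tangent[OF p \<kappa>]] met_eq[OF q D_tangent[OF p v] D_tangent[OF p \<kappa>]]
      metrics_agree_on_D[OF p v \<kappa>] by simp
  have half: "(d + d - e) / 2 = d - e / 2" for d e :: real by (simp add: diff_divide_distrib)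
  show ?thesis
    using 1 2 3 4 unfolding W1 christoffel1_def H.christoffel1_def half
      linear_add[OF linear_met_right[OF x]] linear_add[OF H.linear_met_right[OF x]]
    by linarith
qed

lemma christoffel_acceleration:
  assumes q: "q \<in> cdom M i" and v: "v \<in> D q"
  shows "christoffel M gh i (cmap M i q) (v i) (v i) = - acceleration i q v"
proof (rule H.christoffel_eqI)
  note p = points_I[OF q]
  let ?x = "cmap M i q" and ?c = "christoffel M gh i (cmap M i q) (v i) (v i)"
  show x: "?x \<in> chart_image i" using q by simp
  fix y
  have t: "tvec M i q y \<in> tangent_space M q" by (rule tvec_tangent[OF q])
  obtain u w where u: "u \<in> D q" and w: "w \<in> orth_compl M g D q" and uw: "tvec M i q y = u + w"
    by (rule orth_decomposition[OF p t])
  have y: "y = u i + w i" using arg_cong[OF uw, of "\<lambda>v. v i"] q by (simp add: plus_fun_def)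
  have "H.met i ?x (acceleration i q v) (u i) + H.met i ?x ?c (u i) = 0"
    "H.met i ?x (acceleration i q v) (w i) + H.met i ?x ?c (w i) = 0"
    using acceleration_orthogonal_D[OF q v u] acceleration_orthogonal_D_orth[OF q v w]
    by (simp_all add: H.met_christoffel[OF x])
  then have "H.met i ?x (acceleration i q v) y + H.met i ?x ?c y = 0"
    unfolding y linear_add[OF H.linear_met_right[OF x]] by linarith
  then show "H.met i ?x (- acceleration i q v) y = H.christoffel1 i ?x (v i) (v i) y"
    by (simp add: linear_neg[OF H.linear_met_left[OF x]] H.met_christoffel[OF x])
qed

end


section \<open>Geodesic extensions\<close>

theorem proposition10:
  fixes M :: "('i, 'q, real^'n) atlas"
    and g gh :: "'q \<Rightarrow> ('i \<Rightarrow> real^'n) \<Rightarrow> ('i \<Rightarrow> real^'n) \<Rightarrow> real"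
    and m :: nat
    and D :: "'q \<Rightarrow> ('i \<Rightarrow> real^'n) set"
    and E :: "'n \<Rightarrow> 'q \<Rightarrow> 'i \<Rightarrow> real^'n"
    and A :: "'n set"
    and \<Gamma> :: "'q \<times> ('i \<Rightarrow> real^'n) \<Rightarrow> 'i \<Rightarrow> (real^'n) \<times> (real^'n)"
  assumes "smooth_manifold M"
    and "riemannian_metric M g"
    and "distribution M m D"
    and "adapted_frame M g D E A"
    and "nonholonomic_field M D E A (kinetic g) \<Gamma>"
    and "riemannian_metric M gh"
    and "preserving_modification M D g gh"
    and "\<And>q v u. q \<in> points M \<Longrightarrow> v \<in> nh_exp_dom M D \<Gamma> q \<Longrightarrow> u \<in> D q \<Longrightarrow>
      gh (nh_exp M D \<Gamma> q v) (nh_exp_tangent M D \<Gamma> q v v) (nh_exp_tangent M D \<Gamma> q v u) = gh q v u"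
    and "\<And>q v w c I W h t. q \<in> points M \<Longrightarrow> v \<in> D q \<Longrightarrow> w \<in> orth_compl M g D q \<Longrightarrow>
      c = (\<lambda>s. nh_exp M D \<Gamma> q (s *\<^sub>R v)) \<Longrightarrow>
      open_interval_about_0 I \<Longrightarrow> (\<forall>s\<in>I. s *\<^sub>R v \<in> nh_exp_dom M D \<Gamma> q) \<Longrightarrow>
      parallel_transport M E (nabla_bar M g D) I c w W \<Longrightarrow>
      oneform_solution M E (nabla_bar M g D) I c (multiplier_form M E A (kinetic g) \<Gamma> c) h \<Longrightarrow>
      t \<in> I \<Longrightarrow>
      gh (nh_exp M D \<Gamma> q (t *\<^sub>R v)) (nh_exp_tangent M D \<Gamma> q (t *\<^sub>R v) (t *\<^sub>R v)) (W t)
        + t * h t (W t) = gh q (t *\<^sub>R v) w"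
  shows "geodesic_extension M D \<Gamma> gh"
proof -
  interpret geodesic_candidate M g gh D E A \<Gamma>
    by unfold_locales fact+
  have "geodesic_spray M gh (q, v) = \<Gamma> (q, v)" if p: "q \<in> points M" and v: "v \<in> D q" for q v
  proof
    fix i
    show "geodesic_spray M gh (q, v) i = \<Gamma> (q, v) i"
      using \<Gamma>_chart[of q i v] \<Gamma>_outside[OF p v, of i] christoffel_acceleration[of q i v] v
      by (cases "q \<in> cdom M i") (simp_all add: geodesic_spray_def)
  qed
  then show ?thesis
    using assms(6) by (auto simp: geodesic_extension_def constraint_mfd_def)
qed

end
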